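(* Let $\mu,\lambda\in\mathbb{C}$ with $\mu\neq0$, $\lambda\notin\mathbb{N}=\{0,1,2,\dots\}$ and $\lambda+k\mu\notin\{0,-1,\dots,-(k-1)\}$. Then the left $D_N$-linear map $\square(E+\mu):\mathcal{N}_{\mu+1,\lambda}\to\mathcal{N}_{\mu,\lambda}$ induced by right multiplication by $E+\mu$ is an isomorphism.
   Context: Let $k\ge 2$ be an integer and $N=\mathbb{C}^k$ with coordinates $\sigma_1,\dots,\sigma_k$, $\partial_h=\partial/\partial\sigma_h$; $D_N$ is the sheaf of holomorphic differential operators on $N$. Intervals $[p,q]$ are intervals of integers. Put $E=\sum_{h=1}^k\sigma_h\partial_h$ and $U_0=\sum_{h=1}^k h\sigma_h\partial_h$. For $\mu\in\mathbb{C}$, $\mathcal{I}_\mu$ is the left ideal of $D_N$ generated by $A_{p,q}=\partial_p\partial_q-\partial_{p+1}\partial_{q-1}$ ($p\in[1,k-1]$, $q\in[2,k]$) and $\mathcal{T}^m_\mu=\partial_1\partial_{m-1}+\partial_m(E+\mu)$ ($m\in[2,k]$). For $\lambda\in\mathbb{C}$, $\mathcal{N}_{\mu,\lambda}:=D_N/(\mathcal{I}_\mu+D_N(U_0-\lambda))$. The map $\square(E+\mu)$ sends the class of $\Pi$ to the class of $\Pi(E+\mu)$; it is well defined. *)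

theory Defs
  imports "HOL-Analysis.Analysis" "HOL-Algebra.Generated_Rings"
begin

section \<open>Holomorphic functions and sheaf endomorphisms\<close>

text \<open>
  The manifold is the space of all vectors of type \<^typ>\<open>complex^'n\<close>.  Sections over an open set
  are extensional functions, so that equality of sections is equality in HOL.
\<close>

definition opens :: "(complex^'n) set \<Rightarrow> (complex^'n) set set" where
  "opens U = {V. open V \<and> V \<subseteq> U}"

definition holo :: "(complex^'n) set \<Rightarrow> (complex^'n \<Rightarrow> complex) set" where
  "holo U = {f \<in> extensional U. \<forall>z\<in>U. \<exists>f'. (f has_derivative f') (at z) \<and>
               (\<forall>c v. f' (c *s v) = c * f' v)}"

text \<open>
  An operator on \<open>U\<close> is a family of maps, one for each open subset \<open>V\<close> of \<open>U\<close>, acting on the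
  holomorphic functions on \<open>V\<close>.
\<close>

type_synonym 'n oper =
  "(complex^'n) set \<Rightarrow> (complex^'n \<Rightarrow> complex) \<Rightarrow> (complex^'n \<Rightarrow> complex)"

text \<open>The ring of \<open>\<complex>\<close>-linear endomorphisms of the structure sheaf restricted to \<open>U\<close>.\<close>

definition endo :: "(complex^'n) set \<Rightarrow> ('n oper) ring" where
  "endo U = \<lparr>
     carrier = {P \<in> (\<Pi>\<^sub>E V\<in>opens U. holo V \<rightarrow>\<^sub>E holo V).
        (\<forall>V\<in>opens U. \<forall>f\<in>holo V. \<forall>g\<in>holo V. \<forall>c.
            P V (\<lambda>z\<in>V. c * f z + g z) = (\<lambda>z\<in>V. c * P V f z + P V g z)) \<and>
        (\<forall>V\<in>opens U. \<forall>W\<in>opens V. \<forall>f\<in>holo V. P W (restrict f W) = restrict (P V f) W)},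
     mult = (\<lambda>P Q. \<lambda>V\<in>opens U. \<lambda>f\<in>holo V. P V (Q V f)),
     one = (\<lambda>V\<in>opens U. \<lambda>f\<in>holo V. f),
     zero = (\<lambda>V\<in>opens U. \<lambda>f\<in>holo V. \<lambda>z\<in>V. 0),
     add = (\<lambda>P Q. \<lambda>V\<in>opens U. \<lambda>f\<in>holo V. \<lambda>z\<in>V. P V f z + Q V f z)\<rparr>"

definition op_res :: "(complex^'n) set \<Rightarrow> 'n oper \<Rightarrow> 'n oper" where
  "op_res W P = restrict P (opens W)"


section \<open>The sheaf of holomorphic differential operators\<close>

definition mul_op :: "(complex^'n) set \<Rightarrow> (complex^'n \<Rightarrow> complex) \<Rightarrow> 'n oper" where
  "mul_op U g = (\<lambda>V\<in>opens U. \<lambda>f\<in>holo V. \<lambda>z\<in>V. g z * f z)"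

definition pd_op :: "(complex^'n) set \<Rightarrow> 'n \<Rightarrow> 'n oper" where
  "pd_op U i = (\<lambda>V\<in>opens U. \<lambda>f\<in>holo V. \<lambda>z\<in>V. deriv (\<lambda>t. f (z + axis i t)) 0)"

text \<open>
  The subsheaf of rings of the endomorphism sheaf which is generated by the holomorphic functions
  and the partial derivatives: the sections are the endomorphisms that lie locally in the
  generated subring.
\<close>

definition diffop :: "(complex^'n) set \<Rightarrow> ('n oper) ring" where
  "diffop U = (endo U)\<lparr>carrier :=
     {P \<in> carrier (endo U). \<forall>x\<in>U. \<exists>V\<in>opens U. x \<in> V \<and>
        op_res V P \<in> generate_ring (endo V) (mul_op V ` holo V \<union> range (pd_op V))}\<rparr>"


section \<open>Sheaves of left ideals\<close>

definition left_ideal :: "'a set \<Rightarrow> ('a, 'b) ring_scheme \<Rightarrow> bool" where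
  "left_ideal I R \<longleftrightarrow> additive_subgroup I R \<and> (\<forall>a\<in>I. \<forall>x\<in>carrier R. x \<otimes>\<^bsub>R\<^esub> a \<in> I)"

definition left_genideal :: "('a, 'b) ring_scheme \<Rightarrow> 'a set \<Rightarrow> 'a set" where
  "left_genideal R S = \<Inter>{I. left_ideal I R \<and> S \<subseteq> I}"

type_synonym 'n ideal_sheaf = "(complex^'n) set \<Rightarrow> 'n oper set"

text \<open>The sheaf of left ideals generated by a set \<open>G\<close> of global differential operators.\<close>

definition gen_ideal_sheaf :: "'n::finite oper set \<Rightarrow> 'n ideal_sheaf" where
  "gen_ideal_sheaf G U = {P \<in> carrier (diffop U). \<forall>x\<in>U. \<exists>V\<in>opens U. x \<in> V \<and>
     op_res V P \<in> left_genideal (diffop V) (op_res V ` G)}"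

definition sum_ideal_sheaf :: "'n::finite ideal_sheaf \<Rightarrow> 'n ideal_sheaf \<Rightarrow> 'n ideal_sheaf" where
  "sum_ideal_sheaf I J U = {P \<in> carrier (diffop U). \<forall>x\<in>U. \<exists>V\<in>opens U. x \<in> V \<and>
     op_res V P \<in> I V <+>\<^bsub>diffop V\<^esub> J V}"


section \<open>Sheaves of left modules over the differential operators\<close>

record ('n::finite, 'm) dmodule =
  sects :: "(complex^'n) set \<Rightarrow> 'm set"
  madd :: "(complex^'n) set \<Rightarrow> 'm \<Rightarrow> 'm \<Rightarrow> 'm"
  msmult :: "(complex^'n) set \<Rightarrow> 'n oper \<Rightarrow> 'm \<Rightarrow> 'm"
  mres :: "(complex^'n) set \<Rightarrow> 'm \<Rightarrow> 'm"

definition dmod_hom ::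
  "('n::finite, 'a) dmodule \<Rightarrow> ('n, 'b) dmodule \<Rightarrow> ((complex^'n) set \<Rightarrow> 'a \<Rightarrow> 'b) \<Rightarrow> bool" where
  "dmod_hom M M' \<phi> \<longleftrightarrow> (\<forall>U. open U \<longrightarrow>
     \<phi> U \<in> sects M U \<rightarrow> sects M' U \<and>
     (\<forall>s\<in>sects M U. \<forall>t\<in>sects M U. \<phi> U (madd M U s t) = madd M' U (\<phi> U s) (\<phi> U t)) \<and>
     (\<forall>R\<in>carrier (diffop U). \<forall>s\<in>sects M U. \<phi> U (msmult M U R s) = msmult M' U R (\<phi> U s)) \<and>
     (\<forall>V\<in>opens U. \<forall>s\<in>sects M U. \<phi> V (mres M V s) = mres M' V (\<phi> U s)))"

definition dmod_iso ::
  "('n::finite, 'a) dmodule \<Rightarrow> ('n, 'b) dmodule \<Rightarrow> ((complex^'n) set \<Rightarrow> 'a \<Rightarrow> 'b) \<Rightarrow> bool" where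
  "dmod_iso M M' \<phi> \<longleftrightarrow> dmod_hom M M' \<phi> \<and>
     (\<exists>\<psi>. dmod_hom M' M \<psi> \<and>
       (\<forall>U. open U \<longrightarrow> (\<forall>s\<in>sects M U. \<psi> U (\<phi> U s) = s) \<and> (\<forall>t\<in>sects M' U. \<phi> U (\<psi> U t) = t)))"


section \<open>The quotient by a sheaf of left ideals\<close>

text \<open>
  The class at \<open>x\<close>, modulo the stalk of \<open>J\<close> at \<open>x\<close>, of the germ of a differential operator \<open>P\<close> on
  \<open>V\<close>.  It is the set of all pairs \<open>(W, Q)\<close> that represent it.
\<close>

type_synonym 'n stalk_class = "((complex^'n) set \<times> 'n oper) set"

definition germ_class ::
  "'n::finite ideal_sheaf \<Rightarrow> complex^'n \<Rightarrow> (complex^'n) set \<Rightarrow> 'n oper \<Rightarrow> 'n stalk_class" where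
  "germ_class J x V P = {(W, Q). open W \<and> x \<in> W \<and> Q \<in> carrier (diffop W) \<and>
     (\<exists>Z\<in>opens (V \<inter> W). x \<in> Z \<and> op_res Z P \<ominus>\<^bsub>diffop Z\<^esub> op_res Z Q \<in> J Z)}"

text \<open>
  The quotient sheaf is the sheafification of the presheaf quotient: a section over \<open>U\<close> assigns to
  each point an element of the stalk, and is locally the class of a differential operator.
  The operations are induced from representatives, so each union below is over sets that
  are all equal.
\<close>

definition quot_module :: "'n::finite ideal_sheaf \<Rightarrow> ('n, complex^'n \<Rightarrow> 'n stalk_class) dmodule" where
  "quot_module J = \<lparr>
     sects = (\<lambda>U. {s \<in> extensional U. \<forall>x\<in>U. \<exists>V\<in>opens U. x \<in> V \<and>
        (\<exists>P\<in>carrier (diffop V). \<forall>y\<in>V. s y = germ_class J y V P)}),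
     madd = (\<lambda>U s t. \<lambda>x\<in>U. \<Union>(V, P)\<in>s x. \<Union>(W, Q)\<in>t x.
        germ_class J x (V \<inter> W) (op_res (V \<inter> W) P \<oplus>\<^bsub>diffop (V \<inter> W)\<^esub> op_res (V \<inter> W) Q)),
     msmult = (\<lambda>U R s. \<lambda>x\<in>U. \<Union>(V, P)\<in>s x.
        germ_class J x (U \<inter> V) (op_res (U \<inter> V) R \<otimes>\<^bsub>diffop (U \<inter> V)\<^esub> op_res (U \<inter> V) P)),
     mres = (\<lambda>V s. restrict s V)\<rparr>"

text \<open>
  The map into the quotient by \<open>J\<close> that is induced by right multiplication with the global
  operator \<open>R\<close>.
\<close>

definition right_mult_map ::
  "'n::finite ideal_sheaf \<Rightarrow> 'n oper \<Rightarrow> (complex^'n) set \<Rightarrow>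
    (complex^'n \<Rightarrow> 'n stalk_class) \<Rightarrow> (complex^'n \<Rightarrow> 'n stalk_class)" where
  "right_mult_map J R U s =
     (\<lambda>x\<in>U. \<Union>(V, P)\<in>s x. germ_class J x V (P \<otimes>\<^bsub>diffop V\<^esub> op_res V R))"


section \<open>The operators and modules\<close>

text \<open>
  The labelling \<open>\<iota>\<close> is meant to be a bijection from \<open>{1..k}\<close> to the index type, where
  \<open>k = CARD('n)\<close>, so that the coordinate \<open>\<sigma>\<^sub>h\<close> of a point \<open>z\<close> is \<open>z $ \<iota> h\<close>.
\<close>

abbreviation DN :: "('n::finite oper) ring" where
  "DN \<equiv> diffop UNIV"

definition cnst :: "complex \<Rightarrow> 'n::finite oper" where
  "cnst c = mul_op UNIV (\<lambda>z. c)"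

definition coord :: "(nat \<Rightarrow> 'n::finite) \<Rightarrow> nat \<Rightarrow> 'n oper" where
  "coord \<iota> h = mul_op UNIV (\<lambda>z. z $ \<iota> h)"

definition pd :: "(nat \<Rightarrow> 'n::finite) \<Rightarrow> nat \<Rightarrow> 'n oper" where
  "pd \<iota> h = pd_op UNIV (\<iota> h)"

definition E_op :: "(nat \<Rightarrow> 'n::finite) \<Rightarrow> 'n oper" where
  "E_op \<iota> = (\<Oplus>\<^bsub>DN\<^esub>h\<in>{1..CARD('n)}. coord \<iota> h \<otimes>\<^bsub>DN\<^esub> pd \<iota> h)"

definition U0_op :: "(nat \<Rightarrow> 'n::finite) \<Rightarrow> 'n oper" where
  "U0_op \<iota> =
     (\<Oplus>\<^bsub>DN\<^esub>h\<in>{1..CARD('n)}. cnst (of_nat h) \<otimes>\<^bsub>DN\<^esub> (coord \<iota> h \<otimes>\<^bsub>DN\<^esub> pd \<iota> h))"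

definition A_op :: "(nat \<Rightarrow> 'n::finite) \<Rightarrow> nat \<Rightarrow> nat \<Rightarrow> 'n oper" where
  "A_op \<iota> p q = (pd \<iota> p \<otimes>\<^bsub>DN\<^esub> pd \<iota> q) \<ominus>\<^bsub>DN\<^esub> (pd \<iota> (p + 1) \<otimes>\<^bsub>DN\<^esub> pd \<iota> (q - 1))"

definition T_op :: "(nat \<Rightarrow> 'n::finite) \<Rightarrow> complex \<Rightarrow> nat \<Rightarrow> 'n oper" where
  "T_op \<iota> \<mu> m =
     (pd \<iota> 1 \<otimes>\<^bsub>DN\<^esub> pd \<iota> (m - 1)) \<oplus>\<^bsub>DN\<^esub> (pd \<iota> m \<otimes>\<^bsub>DN\<^esub> (E_op \<iota> \<oplus>\<^bsub>DN\<^esub> cnst \<mu>))"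

definition I_sheaf :: "(nat \<Rightarrow> 'n::finite) \<Rightarrow> complex \<Rightarrow> 'n ideal_sheaf" where
  "I_sheaf \<iota> \<mu> = gen_ideal_sheaf
     ({A_op \<iota> p q | p q. p \<in> {1..CARD('n) - 1} \<and> q \<in> {2..CARD('n)}} \<union>
      {T_op \<iota> \<mu> m | m. m \<in> {2..CARD('n)}})"

definition J_sheaf :: "(nat \<Rightarrow> 'n::finite) \<Rightarrow> complex \<Rightarrow> complex \<Rightarrow> 'n ideal_sheaf" where
  "J_sheaf \<iota> \<mu> l =
     sum_ideal_sheaf (I_sheaf \<iota> \<mu>) (gen_ideal_sheaf {U0_op \<iota> \<ominus>\<^bsub>DN\<^esub> cnst l})"

definition N_module ::
  "(nat \<Rightarrow> 'n::finite) \<Rightarrow> complex \<Rightarrow> complex \<Rightarrow> ('n, complex^'n \<Rightarrow> 'n stalk_class) dmodule" where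
  "N_module \<iota> \<mu> l = quot_module (J_sheaf \<iota> \<mu> l)"

definition square_map ::
  "(nat \<Rightarrow> 'n::finite) \<Rightarrow> complex \<Rightarrow> complex \<Rightarrow> (complex^'n) set \<Rightarrow>
    (complex^'n \<Rightarrow> 'n stalk_class) \<Rightarrow> (complex^'n \<Rightarrow> 'n stalk_class)" where
  "square_map \<iota> \<mu> l = right_mult_map (J_sheaf \<iota> \<mu> l) (E_op \<iota> \<oplus>\<^bsub>DN\<^esub> cnst \<mu>)"

end

theory Submission
  imports Defs "HOL-Complex_Analysis.Cauchy_Integral_Formula"
begin

text \<open>
  Put \<open>\<partial>\<^sub>0 = - (E + \<mu>)\<close>.  Up to the shift \<open>\<partial>\<^sub>h (E + \<mu>) = (E + \<mu> + 1) \<partial>\<^sub>h\<close>, this is the derivative in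
  an additional homogenizing coordinate \<open>\<sigma>\<^sub>0 = 1\<close>.  The generators then say that \<open>\<partial>\<^sub>p \<partial>\<^sub>q\<close> depends only
  on \<open>p + q\<close> for \<open>0 \<le> p, q \<le> k\<close>, together with the Euler relation
  \<open>(\<Sum>j<k. (k - j) \<sigma>\<^sub>j \<partial>\<^sub>j) F = c F\<close> with \<open>c = - \<lambda> - k \<mu>\<close>.  Applying \<open>\<partial>\<^sub>q\<close> to this relation gives
  \<open>(c - k + q) \<partial>\<^sub>q F = (\<Sum>j<k. (k - j) \<sigma>\<^sub>j \<partial>\<^sub>j \<partial>\<^sub>q F)\<close>, where \<open>\<partial>\<^sub>j \<partial>\<^sub>q F\<close> is \<open>\<partial>\<^sub>j\<^sub>+\<^sub>q \<partial>\<^sub>0 F\<close> if \<open>j + q \<le> k\<close> and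
  \<open>\<partial>\<^sub>k \<partial>\<^sub>j\<^sub>+\<^sub>q\<^sub>-\<^sub>k F\<close> otherwise.  Hence \<open>\<partial>\<^sub>1 F, \<dots>, \<partial>\<^sub>k F\<close> and finally \<open>F\<close> are determined recursively by
  \<open>\<partial>\<^sub>0 F\<close>, the divisors being \<open>c - j\<close> with \<open>0 \<le> j < k\<close>.  The recursion defines a global
  differential operator, and right multiplication by its negative inverts \<open>\<square>(E + \<mu>)\<close>.
\<close>


section \<open>Recovering a solution from its derivative in the homogenizing coordinate\<close>

text \<open>Homogeneity in all k + 1 coordinates reads sum_{j=0..k} sigma_j d_j = -\<mu>. Taking k
  times this relation and subtracting U_0 = \<lambda> gives the weights k - j and the constant c =
  -\<lambda> - k\<mu>. The combination is chosen so that the weight of d_k vanishes: only j < k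
  occur, hence j + q - k is smaller than q and the recursion is well founded. A derivative raises
  the homogeneity parameter by one and a coordinate lowers it. After setting sigma_0 = 1 the
  operator d_0 depends on that parameter, so its level has to be carried along in every product. The
  two one-sided inverses differ in difficulty. For a genuine solution F the recursion recovers F
  from d_0 F by substitution alone. Conversely, for an arbitrary solution g with parameter \<mu> +
  1, the recursively defined candidates must be shown to be the derivatives of a single F. This
  integrability is \<open>D1_f\<close>: d_p of the q-th candidate depends only on p + q. Since the
  inverse is a global operator, ideal quotients reduce the statement on sheaves to finitely many
  memberships over the whole space.\<close>

locale left_ideal_set =
  fixes J :: "'a::ring_1 set"
  assumes zero_mem: "0 \<in> J"
    and add_mem: "x \<in> J \<Longrightarrow> y \<in> J \<Longrightarrow> x + y \<in> J"
    and lmult_mem: "x \<in> J \<Longrightarrow> r * x \<in> J"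
begin

text \<open>This congruence is respected by multiplication from the left only, as \<open>J\<close>
  is a left ideal. A right factor such as \<open>D 0 0\<close> therefore has to be inside the
  congruence from the start.\<close>

definition cg :: "'a \<Rightarrow> 'a \<Rightarrow> bool" (infix \<open>\<doteq>\<close> 50) where
  "x \<doteq> y \<longleftrightarrow> x - y \<in> J"

lemma uminus_mem: "x \<in> J \<Longrightarrow> - x \<in> J"
  using lmult_mem[of x "- 1"] by simp

lemma cg_refl [simp]: "x \<doteq> x"
  by (simp add: cg_def zero_mem)

lemma cg_sym: "x \<doteq> y \<Longrightarrow> y \<doteq> x"
  unfolding cg_def using uminus_mem by fastforce

lemma cg_trans [trans]: "x \<doteq> y \<Longrightarrow> y \<doteq> z \<Longrightarrow> x \<doteq> z"
  unfolding cg_def using add_mem by fastforce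

lemma cg_add: "x \<doteq> y \<Longrightarrow> x' \<doteq> y' \<Longrightarrow> x + x' \<doteq> y + y'"
  unfolding cg_def using add_mem[of "x - y" "x' - y'"] by (simp add: algebra_simps)

lemma cg_lmult: "x \<doteq> y \<Longrightarrow> r * x \<doteq> r * y"
  unfolding cg_def using lmult_mem[of "x - y" r] by (simp add: algebra_simps)

lemma cg_sum: "(\<And>j. j \<in> A \<Longrightarrow> h j \<doteq> h' j) \<Longrightarrow> sum h A \<doteq> sum h' A"
  by (induction A rule: infinite_finite_induct) (auto intro: cg_add)

end

text \<open>
  \<open>D i p\<close> stands for \<open>\<partial>\<^sub>p\<close> acting on objects of homogeneity parameter \<open>\<mu> + i\<close>, where
  \<open>\<partial>\<^sub>0 = - (E + \<mu> + i)\<close> is the derivative in an additional coordinate \<open>\<sigma>\<^sub>0\<close> specialised to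
  \<open>\<sigma>\<^sub>0 = 1\<close>.
\<close>

locale dehomogenized_weyl =
  fixes k :: nat and s :: "nat \<Rightarrow> 'a::ring_1" and D :: "nat \<Rightarrow> nat \<Rightarrow> 'a" and K :: "complex \<Rightarrow> 'a"
    and c :: complex
  assumes K_add: "K (x + y) = K x + K y"
    and K_mult: "K (x * y) = K x * K y"
    and K_1: "K 1 = 1"
    and K_D: "p \<le> k \<Longrightarrow> D i p * K x = K x * D i p"
    and D_comm: "p \<le> k \<Longrightarrow> q \<le> k \<Longrightarrow> D (Suc i) p * D i q = D (Suc i) q * D i p"
    and D_s: "p \<le> k \<Longrightarrow> j \<le> k \<Longrightarrow> D i p * s j = s j * D (Suc i) p + (if j = p then 1 else 0)"
    and c_ne: "1 \<le> q \<Longrightarrow> q \<le> k \<Longrightarrow> c - of_nat k + of_nat q \<noteq> 0"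
    and k_pos: "1 \<le> k"
begin

text \<open>For \<open>h = D i\<close> this is the Euler operator of the overview.\<close>

definition wsum :: "(nat \<Rightarrow> 'a) \<Rightarrow> 'a" where
  "wsum h = (\<Sum>j<k. K (of_nat (k - j)) * s j * h j)"

lemma K_0 [simp]: "K 0 = 0"
  using K_add[of 0 0] by simp

lemma K_minus: "K (- x) = - K x"
  using K_add[of x "- x"] by (simp add: minus_unique)

lemma K_inverse: "x \<noteq> 0 \<Longrightarrow> K (1 / x) * (K x * y) = y"
  by (simp add: K_mult[symmetric] K_1 mult.assoc[symmetric])

lemma K_cancel:
  assumes "left_ideal_set J" "x \<noteq> 0" "left_ideal_set.cg J (K x * y) (K x * z)"
  shows "left_ideal_set.cg J y z"
  using left_ideal_set.cg_lmult[OF assms(1,3), of "K (1 / x)"] by (simp add: K_inverse assms(2))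

text \<open>The additional term arises from differentiating the coefficient \<open>s p\<close>. Its
  weight is 0 for \<open>p = k\<close>, so \<open>D i k\<close> passes through \<open>wsum\<close>
  without leaving a remainder.\<close>

lemma D_wsum:
  assumes p: "p \<le> k"
  shows "D i p * wsum h = wsum (\<lambda>j. D (Suc i) p * h j) + K (of_nat (k - p)) * h p"
proof -
  have "D i p * wsum h = (\<Sum>j<k. K (of_nat (k - j)) * (D i p * s j) * h j)"
    unfolding wsum_def sum_distrib_left
    by (rule sum.cong) (auto simp: mult.assoc[symmetric] K_D p)
  also have "\<dots> = (\<Sum>j<k. K (of_nat (k - j)) * s j * (D (Suc i) p * h j)
      + (if j = p then K (of_nat (k - p)) * h p else 0))"
    by (rule sum.cong) (auto simp: D_s p algebra_simps)
  also have "\<dots> = wsum (\<lambda>j. D (Suc i) p * h j) + K (of_nat (k - p)) * h p"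
    using p by (cases "p = k") (auto simp: wsum_def sum.distrib)
  finally show ?thesis .
qed

lemma wsum_right: "wsum (\<lambda>j. h j * x) = wsum h * x"
  by (simp add: wsum_def sum_distrib_right mult.assoc)

lemma wsum_cong:
  assumes "left_ideal_set J" "\<And>j. j < k \<Longrightarrow> left_ideal_set.cg J (h j) (h' j)"
  shows "left_ideal_set.cg J (wsum h) (wsum h')"
  unfolding wsum_def
  by (rule left_ideal_set.cg_sum[OF assms(1)])
     (auto simp: mult.assoc intro!: left_ideal_set.cg_lmult[OF assms(1)] assms(2))

lemma wsum_eq: "(\<And>j. j < k \<Longrightarrow> h j = h' j) \<Longrightarrow> wsum h = wsum h'"
  unfolding wsum_def by (rule sum.cong) auto

text \<open>
  If \<open>g\<close> solves the system with parameter \<open>\<mu> + 1\<close>, then \<open>f p g\<close> is \<open>\<partial>\<^sub>p F\<close> for the solution \<open>F\<close>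
  with parameter \<open>\<mu>\<close> and \<open>\<partial>\<^sub>0 F = g\<close>.  The recursion comes from applying \<open>\<partial>\<^sub>q\<close> to the equation
  \<open>c F = (\<Sum>j<k. (k - j) \<sigma>\<^sub>j \<partial>\<^sub>j F)\<close> and rewriting \<open>\<partial>\<^sub>j \<partial>\<^sub>q F\<close> as \<open>\<partial>\<^sub>j\<^sub>+\<^sub>q \<partial>\<^sub>0 F\<close> or as
  \<open>\<partial>\<^sub>k \<partial>\<^sub>j\<^sub>+\<^sub>q\<^sub>-\<^sub>k F\<close>.
\<close>

function f :: "nat \<Rightarrow> 'a" where
  "f q = (if q = 0 then 1 else K (1 / (c - of_nat k + of_nat q)) *
    (\<Sum>j\<in>{..<k}. K (of_nat (k - j)) * s j *
      (if j + q \<le> k then D 1 (j + q) else D 1 k * f (j + q - k))))"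
  by pat_completeness auto
text \<open>The congruence rule for sums supplies \<open>j < k\<close> at the recursive call, whence
  \<open>j + q - k < q\<close>.\<close>

termination
  by (relation "Wellfounded.measure id") auto

declare f.simps [simp del]

text \<open>The common value expected of all products \<open>D 1 p * f q\<close> with
  \<open>p + q = m\<close>. It is written with the first index as large as possible, so that
  \<open>f\<close> occurs at the smallest possible index.\<close>

definition u :: "nat \<Rightarrow> 'a" where
  "u m = (if m \<le> k then D 1 m else D 1 k * f (m - k))"

text \<open>The last step of the recursion: the Euler relation is solved for F once its derivatives
  have been replaced by the values of \<open>f\<close>.\<close>

definition Q :: 'a where
  "Q = K (1 / c) * wsum f"

lemma f_0 [simp]: "f 0 = 1"
  by (simp add: f.simps)

lemma u_le: "m \<le> k \<Longrightarrow> u m = D 1 m"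
  by (simp add: u_def)

text \<open>Both branches of \<open>u\<close> agree at \<open>m = k\<close> because
  \<open>f 0 = 1\<close>.\<close>

lemma u_ge: "k \<le> m \<Longrightarrow> u m = D 1 k * f (m - k)"
  by (auto simp: u_def)

lemma K_f: "1 \<le> q \<Longrightarrow> q \<le> k \<Longrightarrow> K (c - of_nat k + of_nat q) * f q = wsum (\<lambda>j. u (j + q))"
  by (subst f.simps)
     (use c_ne[of q] in \<open>simp add: wsum_def u_def mult.assoc[symmetric] K_mult[symmetric] K_1\<close>)

lemma c_nonzero: "c \<noteq> 0"
  using c_ne[of k] k_pos by simp

lemma K_c_Q: "K c * Q = wsum f"
  by (simp add: Q_def mult.assoc[symmetric] K_mult[symmetric] K_1 c_nonzero)

text \<open>In the symbols d_0, ..., d_k these are the quadrics through the rational normal curve of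
  degree k.\<close>

definition toric :: "nat \<Rightarrow> 'a set \<Rightarrow> bool" where
  "toric i J \<longleftrightarrow> (\<forall>p\<le>k. \<forall>q\<le>k. \<forall>p'\<le>k. \<forall>q'\<le>k. p + q = p' + q' \<longrightarrow>
     D (Suc i) p * D i q - D (Suc i) p' * D i q' \<in> J)"

section \<open>Modulo the relations for \<mu>: \<open>Q\<close> is a left inverse of
  \<open>D 0 0\<close>\<close>

context
  fixes J :: "'a set"
  assumes lid: "left_ideal_set J"
    and tor: "toric 0 J"
    and hom: "wsum (D 0) - K c \<in> J"
begin

interpretation left_ideal_set J by (rule lid)

lemma toric0: "p \<le> k \<Longrightarrow> q \<le> k \<Longrightarrow> p' \<le> k \<Longrightarrow> q' \<le> k \<Longrightarrow> p + q = p' + q' \<Longrightarrow>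
    D 1 p * D 0 q \<doteq> D 1 p' * D 0 q'"
  using tor unfolding toric_def cg_def by auto

text \<open>The Euler relation is multiplied by \<open>D 0 q\<close> from the left. Passing the
  coefficients costs the term with weight \<open>k - q\<close>, and commuting the two derivatives
  puts \<open>D 0 q\<close> on the right of every summand.\<close>

lemma wsum_D1_D0: "q \<le> k \<Longrightarrow> wsum (\<lambda>j. D 1 j * D 0 q) + K (of_nat (k - q)) * D 0 q \<doteq> K c * D 0 q"
proof -
  assume q: "q \<le> k"
  have "D 0 q * (wsum (D 0) - K c) \<in> J"
    by (rule lmult_mem[OF hom])
  moreover have "wsum (\<lambda>j. D (Suc 0) q * D 0 j) = wsum (\<lambda>j. D 1 j * D 0 q)"
    by (rule wsum_eq) (use q D_comm[of _ q 0] in auto)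
  ultimately show ?thesis
    unfolding cg_def by (simp add: right_diff_distrib D_wsum[OF q] K_D[OF q])
qed

text \<open>This is the computation from which the recursion was read off. The induction is strong
  because \<open>u (j + q)\<close> contains \<open>f (j + q - k)\<close> as soon as
  \<open>j + q > k\<close>.\<close>

lemma f_D0: "q \<le> k \<Longrightarrow> f q * D 0 0 \<doteq> D 0 q"
proof (induction q rule: less_induct)
  case (less q)
  show ?case
  proof (cases "q = 0")
    case False
    have u: "u (j + q) * D 0 0 \<doteq> D 1 j * D 0 q" if j: "j < k" for j
    proof (cases "j + q \<le> k")
      case True
      then show ?thesis
        using toric0[of "j + q" 0 j q] less.prems j by (simp add: u_le)
    next
      case nle: False
      have "D 1 k * (f (j + q - k) * D 0 0) \<doteq> D 1 k * D 0 (j + q - k)"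
        by (rule cg_lmult, rule less.IH) (use j nle less.prems in auto)
      also have "\<dots> \<doteq> D 1 j * D 0 q"
        by (rule toric0) (use j nle less.prems in auto)
      finally show ?thesis
        using nle by (simp add: u_ge mult.assoc)
    qed
    have "K (c - of_nat k + of_nat q) * (f q * D 0 0) = wsum (\<lambda>j. u (j + q) * D 0 0)"
      using False less.prems by (simp add: mult.assoc[symmetric] K_f wsum_right)
    also have "\<dots> \<doteq> wsum (\<lambda>j. D 1 j * D 0 q)"
      by (rule wsum_cong[OF lid]) (rule u)
    also have "\<dots> \<doteq> K (c - of_nat k + of_nat q) * D 0 q"
    proof -
      \<comment> \<open>Absorbing the weight \<open>k - q\<close> into \<open>c\<close> produces the
        divisor of the recursion.\<close>
      have "K c = K (c - of_nat k + of_nat q) + K (of_nat (k - q))"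
        using less.prems by (simp add: K_add[symmetric] of_nat_diff)
      then show ?thesis
        using wsum_D1_D0[OF less.prems] unfolding cg_def by (simp add: algebra_simps)
    qed
    finally show ?thesis
      by (rule K_cancel[OF lid c_ne, rotated 2]) (use False less.prems in auto)
  qed simp
qed

lemma Q_D0: "Q * D 0 0 - 1 \<in> J"
proof -
  have "K c * (Q * D 0 0) = wsum (\<lambda>j. f j * D 0 0)"
    by (simp add: mult.assoc[symmetric] K_c_Q wsum_right)
  also have "\<dots> \<doteq> wsum (D 0)"
    by (rule wsum_cong[OF lid]) (rule f_D0, simp)
  also have "\<dots> \<doteq> K c * 1"
    using hom by (simp add: cg_def)
  finally have "Q * D 0 0 \<doteq> 1"
    by (rule K_cancel[OF lid c_nonzero])
  then show ?thesis
    by (simp add: cg_def)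
qed

text \<open>The factor \<open>D 0 0\<close> moves to the left through both derivatives, lowering
  their levels by one each, and arrives in front as \<open>D 2 0\<close>, where the left ideal
  absorbs it. Together with \<open>wsum_right_D0\<close> this makes right multiplication by
  \<open>D 0 0\<close> well defined from parameter \<mu> + 1 to \<mu>.\<close>

lemma toric_right_D0:
  assumes "p \<le> k" "q \<le> k" "p' \<le> k" "q' \<le> k" "p + q = p' + q'"
  shows "(D 2 p * D 1 q - D 2 p' * D 1 q') * D 0 0 \<in> J"
proof -
  have *: "D 2 p * D 1 q * D 0 0 = D 2 0 * (D 1 p * D 0 q)" if "p \<le> k" "q \<le> k" for p q
    using D_comm[of q 0 0] D_comm[of p 0 1] that by (metis One_nat_def Suc_1 zero_le mult.assoc)
  have "(D 2 p * D 1 q - D 2 p' * D 1 q') * D 0 0 = D 2 0 * (D 1 p * D 0 q - D 1 p' * D 0 q')"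
    using assms * by (simp only: left_diff_distrib right_diff_distrib)
  then show ?thesis
    using toric0[OF assms] lmult_mem unfolding cg_def by simp
qed

text \<open>Raising \<mu> by one lowers the Euler constant by k. The missing k is the extra term of
  \<open>wsum_D1_D0\<close> at \<open>q = 0\<close>.\<close>

lemma wsum_right_D0: "(wsum (D 1) - K (c - of_nat k)) * D 0 0 \<in> J"
proof -
  have "K c = K (c - of_nat k) + K (of_nat k)"
    by (simp add: K_add[symmetric])
  then have "(wsum (D 1) - K (c - of_nat k)) * D 0 0
      = wsum (\<lambda>j. D 1 j * D 0 0) + K (of_nat (k - 0)) * D 0 0 - K c * D 0 0"
    by (simp add: wsum_right algebra_simps)
  then show ?thesis
    using wsum_D1_D0[of 0] by (simp add: cg_def)
qed

end

section \<open>Modulo the relations for \<mu> + 1: \<open>Q\<close> is a right inverse of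
  \<open>D 0 0\<close>\<close>

context
  fixes J :: "'a set"
  assumes lid: "left_ideal_set J"
    and tor: "toric 1 J"
    and hom: "wsum (D 1) - K (c - of_nat k) \<in> J"
begin

interpretation left_ideal_set J by (rule lid)

lemma toric1: "p \<le> k \<Longrightarrow> q \<le> k \<Longrightarrow> p' \<le> k \<Longrightarrow> q' \<le> k \<Longrightarrow> p + q = p' + q' \<Longrightarrow>
    D 2 p * D 1 q \<doteq> D 2 p' * D 1 q'"
  using tor unfolding toric_def cg_def by (auto simp: numeral_2_eq_2)

lemma D2_D1_comm: "p \<le> k \<Longrightarrow> q \<le> k \<Longrightarrow> D 2 p * D 1 q = D 2 q * D 1 p"
  using D_comm[of p q 1] by (simp add: numeral_2_eq_2)

lemma wsum_D2_D1:
  assumes m: "m \<le> k"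
  shows "wsum (\<lambda>j. D 2 j * D 1 m) + K (of_nat (k - m)) * D 1 m \<doteq> K (c - of_nat k) * D 1 m"
proof -
  have "D 1 m * (wsum (D 1) - K (c - of_nat k)) \<in> J"
    by (rule lmult_mem[OF hom])
  moreover have "wsum (\<lambda>j. D (Suc 1) m * D 1 j) = wsum (\<lambda>j. D 2 j * D 1 m)"
    by (rule wsum_eq) (use m D2_D1_comm[of _ m] in \<open>simp add: numeral_2_eq_2\<close>)
  ultimately show ?thesis
    unfolding cg_def by (simp add: right_diff_distrib D_wsum[OF m] K_D[OF m])
qed

text \<open>Exchange of indices one level higher, as far as the induction hypothesis of
  \<open>D1_f\<close> reaches. For \<open>m > k\<close> the leading \<open>D 1 k\<close> of
  \<open>u m\<close> is swapped with \<open>D 2 p\<close>, and the hypothesis then acts on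
  \<open>f (m - k)\<close>. The bound \<open>m < k + q\<close> says precisely that this index is
  below \<open>q\<close>.\<close>

lemma D2_u:
  assumes IH: "\<And>q' p. q' < q \<Longrightarrow> p \<le> k \<Longrightarrow> D 1 p * f q' \<doteq> u (p + q')"
    and "p \<le> k" "p' \<le> k" "p + m = p' + m'" "m < k + q" "m' < k + q"
  shows "D 2 p * u m \<doteq> D 2 p' * u m'"
proof -
  have big: "D 2 p * u m \<doteq> D 2 k * u (p + m - k)" if "p \<le> k" "k < m" "m < k + q" for p m
  proof -
    have "D 2 p * u m = D 2 k * (D 1 p * f (m - k))"
      using that D2_D1_comm[of p k] by (simp add: u_ge mult.assoc[symmetric])
    also have "\<dots> \<doteq> D 2 k * u (p + (m - k))"
      by (rule cg_lmult, rule IH) (use that in auto)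
    finally show ?thesis using that by simp
  qed
  \<comment> \<open>Here \<open>p + m = p' + m'\<close> is at most \<open>2 * k\<close>, so
    \<open>u (p + m - k)\<close> is a single derivative and the toric relations apply to it.\<close>
  have mixed: "D 2 p * u m \<doteq> D 2 p' * u m'"
    if "p \<le> k" "p' \<le> k" "p + m = p' + m'" "m < k + q" "k < m" "m' \<le> k" for p p' m m'
  proof -
    note big[OF \<open>p \<le> k\<close> \<open>k < m\<close> \<open>m < k + q\<close>]
    also have "D 2 k * u (p + m - k) \<doteq> D 2 p' * u m'"
      using toric1[of k "p + m - k" p' m'] that by (simp add: u_le)
    finally show ?thesis .
  qed
  show ?thesis
  proof (cases "k < m")
    case True
    show ?thesis
    proof (cases "k < m'")
      case True
      show ?thesis
        using big[of p m] cg_sym[OF big[of p' m']] True \<open>k < m\<close> assms by (auto intro: cg_trans)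
    next
      case False
      then show ?thesis using mixed[of p p' m m'] True assms by auto
    qed
  next
    case False
    show ?thesis
    proof (cases "k < m'")
      case True
      then show ?thesis using cg_sym[OF mixed[of p' p m' m]] False assms by auto
    next
      case nlt: False
      then show ?thesis
        using toric1[of p m p' m'] False assms by (simp add: u_le)
    qed
  qed
qed

text \<open>The integrability statement. \<open>D 1 p\<close> is applied to the recursion for
  \<open>f q\<close>; the result is \<open>?e\<close> times the expected value, and
  \<open>?e\<close> is one of the nonzero divisors. For \<open>q = 0\<close> and for
  \<open>p = k\<close> the claim is the definition of \<open>u\<close>.\<close>

lemma D1_f: "q \<le> k \<Longrightarrow> p \<le> k \<Longrightarrow> D 1 p * f q \<doteq> u (p + q)"
proof (induction q arbitrary: p rule: less_induct)
  case (less q)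
  show ?case
  proof (cases "q = 0 \<or> p = k")
    case True
    then show ?thesis using less.prems by (auto simp: u_le u_ge)
  next
    case False
    \<comment> \<open>\<open>?e\<close> is the divisor belonging to \<open>f q\<close>. Moving
      \<open>D 1 p\<close> through \<open>wsum\<close> contributes \<open>k - p\<close>, and
      \<open>?d\<close> is what the remaining sum has to contribute.\<close>
    let ?e = "c - of_nat k + of_nat q"
    let ?d = "c - of_nat k - of_nat k + of_nat p + of_nat q"
    have IH: "D 1 p * f q' \<doteq> u (p + q')" if "q' < q" "p \<le> k" for q' p
      using less that by auto
    have "wsum (\<lambda>j. D 2 p * u (j + q)) \<doteq> K ?d * u (p + q)"
    \<comment> \<open>If \<open>p + q \<le> k\<close>, every summand can be turned into
      \<open>D 2 j * D 1 (p + q)\<close>, and the Euler relation differentiated in direction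
      \<open>p + q\<close> applies. Otherwise \<open>D 2 k\<close> is pulled out of every summand;
      it leaves no remainder, and what is left is the recursion for the index
      \<open>p + q - k\<close>.\<close>
    proof (cases "p + q \<le> k")
      case True
      have "wsum (\<lambda>j. D 2 p * u (j + q)) \<doteq> wsum (\<lambda>j. D 2 j * u (p + q))"
        by (intro wsum_cong[OF lid] D2_u[of q] IH) (use True False less.prems in auto)
      also have "\<dots> \<doteq> K ?d * D 1 (p + q)"
      proof -
        have "K (c - of_nat k) = K ?d + K (of_nat (k - (p + q)))"
          using True by (simp add: K_add[symmetric] of_nat_diff)
        then show ?thesis
          using wsum_D2_D1[OF True] True unfolding cg_def by (simp add: algebra_simps u_le)
      qed
      finally show ?thesis using True by (simp add: u_le)
    next
      case nle: False
      let ?q = "p + q - k"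
      have "wsum (\<lambda>j. D 2 p * u (j + q)) \<doteq> wsum (\<lambda>j. D 2 k * u (j + ?q))"
        by (intro wsum_cong[OF lid] D2_u[of q] IH) (use nle False less.prems in auto)
      also have "\<dots> = D 1 k * wsum (\<lambda>j. u (j + ?q))"
        using D_wsum[of k 1 "\<lambda>j. u (j + ?q)"] by (simp add: numeral_2_eq_2)
      also have "\<dots> = D 1 k * (K (c - of_nat k + of_nat ?q) * f ?q)"
        by (subst K_f) (use nle less.prems in auto)
      also have "c - of_nat k + of_nat ?q = ?d"
        using nle by (simp add: of_nat_diff)
      also have "D 1 k * (K ?d * f ?q) = K ?d * u (p + q)"
        using nle by (simp add: u_ge mult.assoc[symmetric] K_D)
      finally show ?thesis .
    qed
    then have "wsum (\<lambda>j. D 2 p * u (j + q)) + K (of_nat (k - p)) * u (p + q)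
        \<doteq> K ?d * u (p + q) + K (of_nat (k - p)) * u (p + q)"
      by (rule cg_add) simp
    also have "\<dots> = K ?e * u (p + q)"
    proof -
      have "?e = ?d + of_nat (k - p)"
        using less.prems by (simp add: of_nat_diff)
      then have "K ?e = K ?d + K (of_nat (k - p))"
        by (simp only: K_add)
      then show ?thesis by (simp add: distrib_right)
    qed
    also have "wsum (\<lambda>j. D 2 p * u (j + q)) + K (of_nat (k - p)) * u (p + q) = D 1 p * (K ?e * f q)"
      using D_wsum[of p 1 "\<lambda>j. u (j + q)"] K_f[of q] False less.prems
      by (simp add: numeral_2_eq_2)
    also have "D 1 p * (K ?e * f q) = K ?e * (D 1 p * f q)"
      using K_D[of p 1 ?e] less.prems by (simp flip: mult.assoc)
    finally have "K ?e * (D 1 p * f q) \<doteq> K ?e * u (p + q)" .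
    then show ?thesis
      by (rule K_cancel[OF lid c_ne, rotated 2]) (use False less.prems in auto)
  qed
qed

text \<open>Moving \<open>D 0 h\<close> through \<open>wsum f\<close> leaves
  \<open>u (j + h)\<close> in the summands by \<open>D1_f\<close>. The recursion, or the Euler
  relation when \<open>h = 0\<close>, evaluates this sum with the constant \<open>c - k + h\<close>,
  and the extra term of weight \<open>k - h\<close> completes it to \<open>c\<close>.\<close>

lemma D0_Q:
  assumes h: "h \<le> k"
  shows "D 0 h * Q \<doteq> f h"
proof -
  have "wsum (\<lambda>j. D 1 h * f j) \<doteq> wsum (\<lambda>j. u (j + h))"
  proof (intro wsum_cong[OF lid])
    show "D 1 h * f j \<doteq> u (j + h)" if "j < k" for j
      using D1_f[of j h] that h by (simp add: add.commute)
  qed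
  also have "\<dots> \<doteq> K (c - of_nat k + of_nat h) * f h"
  proof (cases "h = 0")
    case True
    have "wsum u = wsum (D 1)"
      by (rule wsum_eq) (simp add: u_le)
    then show ?thesis
      using True hom by (simp add: cg_def)
  next
    case False
    then show ?thesis using K_f[of h] h by simp
  qed
  finally have "wsum (\<lambda>j. D 1 h * f j) + K (of_nat (k - h)) * f h
      \<doteq> K (c - of_nat k + of_nat h) * f h + K (of_nat (k - h)) * f h"
    by (rule cg_add) simp
  also have "\<dots> = K c * f h"
    using h by (simp add: distrib_right[symmetric] K_add[symmetric] of_nat_diff)
  also have "wsum (\<lambda>j. D 1 h * f j) + K (of_nat (k - h)) * f h = K c * (D 0 h * Q)"
    using D_wsum[OF h, of 0 f] K_D[OF h, of 0 c] by (metis K_c_Q One_nat_def mult.assoc)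
  finally show ?thesis
    by (rule K_cancel[OF lid c_nonzero])
qed

lemma D0_Q_1: "D 0 0 * Q - 1 \<in> J"
  using D0_Q[of 0] by (simp add: cg_def)

text \<open>First \<open>D 0 q * Q\<close> becomes \<open>f q\<close>, then
  \<open>D 1 p * f q\<close> becomes \<open>u (p + q)\<close>, which sees only the sum of the
  indices.\<close>

lemma toric_right_Q:
  assumes "p \<le> k" "q \<le> k" "p' \<le> k" "q' \<le> k" "p + q = p' + q'"
  shows "(D 1 p * D 0 q - D 1 p' * D 0 q') * Q \<in> J"
proof -
  have *: "D 1 p * (D 0 q * Q) \<doteq> u (p + q)" if "p \<le> k" "q \<le> k" for p q
    using cg_trans[OF cg_lmult[OF D0_Q] D1_f] that by blast
  show ?thesis
    using cg_trans[OF *[of p q], of "D 1 p' * (D 0 q' * Q)"] cg_sym[OF *[of p' q']] assms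
    by (simp add: cg_def left_diff_distrib mult.assoc)
qed

lemma wsum_right_Q: "(wsum (D 0) - K c) * Q \<in> J"
proof -
  have "wsum (\<lambda>j. D 0 j * Q) \<doteq> wsum f"
    by (intro wsum_cong[OF lid] D0_Q) simp
  then show ?thesis
    by (simp add: cg_def left_diff_distrib wsum_right K_c_Q)
qed

end

end


section \<open>The toric system in a Weyl algebra\<close>

text \<open>Scalars enter through a map \<open>K\<close> whose values commute with the generators,
  because the type class provides a ring and not a complex algebra.\<close>

locale weyl_algebra =
  fixes k :: nat and x d :: "nat \<Rightarrow> 'a::ring_1" and K :: "complex \<Rightarrow> 'a"
  assumes K_add: "K (a + b) = K a + K b"
    and K_mult: "K (a * b) = K a * K b"
    and K_1: "K 1 = 1"
    and K_d: "p \<in> {1..k} \<Longrightarrow> d p * K a = K a * d p"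
    and K_x: "p \<in> {1..k} \<Longrightarrow> x p * K a = K a * x p"
    and d_comm: "p \<in> {1..k} \<Longrightarrow> q \<in> {1..k} \<Longrightarrow> d p * d q = d q * d p"
    and x_comm: "p \<in> {1..k} \<Longrightarrow> q \<in> {1..k} \<Longrightarrow> x p * x q = x q * x p"
    and d_x: "p \<in> {1..k} \<Longrightarrow> q \<in> {1..k} \<Longrightarrow> d p * x q = x q * d p + (if p = q then 1 else 0)"
    and k_ge_2: "2 \<le> k"
begin

definition E :: 'a where
  "E = (\<Sum>h\<in>{1..k}. x h * d h)"

definition U0 :: 'a where
  "U0 = (\<Sum>h\<in>{1..k}. K (of_nat h) * (x h * d h))"

text \<open>The level is visible only in the homogenizing derivative, the one that depends on the
  homogeneity parameter.\<close>

definition D :: "complex \<Rightarrow> nat \<Rightarrow> nat \<Rightarrow> 'a" where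
  "D \<mu> i p = (if p = 0 then - (E + K (\<mu> + of_nat i)) else d p)"

definition s :: "nat \<Rightarrow> 'a" where
  "s j = (if j = 0 then 1 else x j)"

lemma K_E: "E * K a = K a * E"
  unfolding E_def sum_distrib_left sum_distrib_right
  by (rule sum.cong) (auto simp: mult.assoc K_d, auto simp: mult.assoc[symmetric] K_x)

lemma d_E: "p \<in> {1..k} \<Longrightarrow> d p * E = E * d p + d p"
proof -
  assume p: "p \<in> {1..k}"
  have "d p * E = (\<Sum>h\<in>{1..k}. x h * d h * d p + (if h = p then d p else 0))"
    unfolding E_def sum_distrib_left
  proof (rule sum.cong)
    fix h assume h: "h \<in> {1..k}"
    have "d p * (x h * d h) = (d p * x h) * d h" by (simp add: mult.assoc)
    also have "\<dots> = x h * (d p * d h) + (if h = p then d p else 0)"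
      using p h by (simp add: d_x distrib_right mult.assoc)
    finally show "d p * (x h * d h) = x h * d h * d p + (if h = p then d p else 0)"
      using p h by (simp add: d_comm mult.assoc)
  qed simp
  also have "\<dots> = E * d p + d p"
    using p by (simp add: sum.distrib E_def sum_distrib_right)
  finally show ?thesis .
qed

lemma E_x: "j \<in> {1..k} \<Longrightarrow> E * x j = x j * E + x j"
proof -
  assume j: "j \<in> {1..k}"
  have "E * x j = (\<Sum>h\<in>{1..k}. x j * (x h * d h) + (if h = j then x j else 0))"
    unfolding E_def sum_distrib_right
  proof (rule sum.cong)
    fix h assume h: "h \<in> {1..k}"
    have "x h * d h * x j = x h * x j * d h + (if h = j then x j else 0)"
      using j h by (simp add: d_x distrib_left mult.assoc)
    also have "x h * x j * d h = x j * (x h * d h)"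
      using j h by (simp add: x_comm mult.assoc[symmetric])
    finally show "x h * d h * x j = x j * (x h * d h) + (if h = j then x j else 0)" .
  qed simp
  also have "\<dots> = x j * E + x j"
    using j by (simp add: sum.distrib E_def sum_distrib_left)
  finally show ?thesis .
qed

lemma K_minus: "K (- a) = - K a"
proof -
  have "K 0 = 0" using K_add[of 0 0] by simp
  then show ?thesis using K_add[of a "- a"] by (simp add: minus_unique)
qed

lemma K_diff: "K (a - b) = K a - K b"
  using K_add[of a "- b"] by (simp add: K_minus)

text \<open>The shift by one replaces the commutation rule of d_0 with sigma_0, which is lost once
  sigma_0 is set to 1.\<close>

lemma D_0_Suc: "D \<mu> (Suc i) 0 = D \<mu> i 0 - 1"
  by (simp add: D_def K_add K_1 add.commute add.left_commute)

lemma d_D: "p \<in> {1..k} \<Longrightarrow> d p * D \<mu> i 0 = D \<mu> (Suc i) 0 * d p"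
  unfolding D_0_Suc by (simp add: D_def left_diff_distrib right_diff_distrib distrib_left d_E K_d)

lemma D_x: "p \<in> {1..k} \<Longrightarrow> D \<mu> i 0 * x p = x p * D \<mu> (Suc i) 0"
  unfolding D_0_Suc by (simp add: D_def left_diff_distrib right_diff_distrib distrib_left E_x K_x)

lemma dehomogenized_weyl:
  assumes "\<And>q. 1 \<le> q \<Longrightarrow> q \<le> k \<Longrightarrow> c - of_nat k + of_nat q \<noteq> 0"
  shows "dehomogenized_weyl k s (D \<mu>) K c"
proof
  fix p q i j :: nat and a b :: complex
  show "K (a + b) = K a + K b" by (rule K_add)
  show "K (a * b) = K a * K b" by (rule K_mult)
  show "K 1 = 1" by (rule K_1)
  show "D \<mu> i p * K a = K a * D \<mu> i p" if "p \<le> k"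
    using that by (auto simp: D_def K_d K_E left_diff_distrib right_diff_distrib K_mult[symmetric] mult.commute)
  show "D \<mu> (Suc i) p * D \<mu> i q = D \<mu> (Suc i) q * D \<mu> i p" if "p \<le> k" "q \<le> k"
  proof -
    have *: "D \<mu> i p = d p" if "p \<noteq> 0" for i p using that by (simp add: D_def)
    show ?thesis
      using that d_D[of p \<mu> i] d_D[of q \<mu> i] d_comm[of p q]
      by (cases "p = 0"; cases "q = 0") (auto simp: *)
  qed
  show "D \<mu> i p * s j = s j * D \<mu> (Suc i) p + (if j = p then 1 else 0)" if "p \<le> k" "j \<le> k"
  proof (cases "p = 0"; cases "j = 0")
    assume "p \<noteq> 0" "j \<noteq> 0" then show ?thesis using that d_x[of p j] by (auto simp: D_def s_def)
  next
    assume "p = 0" "j \<noteq> 0" then show ?thesis using that D_x[of j] by (auto simp: s_def)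
  qed (auto simp: D_0_Suc s_def, auto simp: D_def)
  show "c - of_nat k + of_nat q \<noteq> 0" if "1 \<le> q" "q \<le> k" by (rule assms[OF that])
  show "1 \<le> k" using k_ge_2 by simp
qed

section \<open>The given generators as toric and Euler relations\<close>

definition A_gen :: "nat \<Rightarrow> nat \<Rightarrow> 'a" where
  "A_gen p q = d p * d q - d (p + 1) * d (q - 1)"

definition T_gen :: "complex \<Rightarrow> nat \<Rightarrow> 'a" where
  "T_gen \<mu> m = d 1 * d (m - 1) + d m * (E + K \<mu>)"

context
  fixes \<mu> c :: complex
  assumes c_ne: "\<And>q. 1 \<le> q \<Longrightarrow> q \<le> k \<Longrightarrow> c - of_nat k + of_nat q \<noteq> 0"
begin

interpretation W: dehomogenized_weyl k s "D \<mu>" K c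
  by (rule dehomogenized_weyl[OF c_ne])

lemma A_gen_eq: "p \<in> {1..k - 1} \<Longrightarrow> q \<in> {2..k} \<Longrightarrow>
    A_gen p q = D \<mu> (Suc i) p * D \<mu> i q - D \<mu> (Suc i) (p + 1) * D \<mu> i (q - 1)"
  by (auto simp: A_gen_def D_def)

lemma T_gen_eq: "m \<in> {2..k} \<Longrightarrow>
    T_gen (\<mu> + of_nat i) m = D \<mu> (Suc i) 1 * D \<mu> i (m - 1) - D \<mu> (Suc i) m * D \<mu> i 0"
  by (auto simp: T_gen_def D_def right_diff_distrib distrib_left)

text \<open>The summand \<open>K k * D i 0\<close> contributes -kE and cancels the kE in the
  remaining sum, which leaves -U_0. One level more changes that summand by -k, matched by the
  constant \<open>c - i * k\<close>; thus every level yields the same generator.\<close>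

lemma U0_gen_eq: "W.wsum (D \<mu> i) - K (c - of_nat i * of_nat k) = - (U0 - K (- c - of_nat k * \<mu>))"
proof -
  have "W.wsum (D \<mu> i) = K (of_nat k) * D \<mu> i 0 + (\<Sum>j\<in>{1..k}. K (of_nat (k - j)) * s j * D \<mu> i j)"
  proof -
    \<comment> \<open>The summand \<open>j = k\<close> that is added here has weight 0.\<close>
    have "W.wsum (D \<mu> i) = (\<Sum>j\<in>{0..k}. K (of_nat (k - j)) * s j * D \<mu> i j)"
      unfolding W.wsum_def by (simp add: atLeast0AtMost lessThan_Suc_atMost[symmetric])
    then show ?thesis by (simp add: sum.atLeast_Suc_atMost s_def)
  qed
  also have "(\<Sum>j\<in>{1..k}. K (of_nat (k - j)) * s j * D \<mu> i j)
      = (\<Sum>j\<in>{1..k}. K (of_nat k) * (x j * d j) - K (of_nat j) * (x j * d j))"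
    by (rule sum.cong) (auto simp: of_nat_diff K_diff s_def D_def mult.assoc left_diff_distrib)
  also have "\<dots> = K (of_nat k) * E - U0"
    by (simp add: sum_subtractf E_def U0_def sum_distrib_left)
  finally have eq: "W.wsum (D \<mu> i) = K (of_nat k) * D \<mu> i 0 + (K (of_nat k) * E - U0)" .
  have 1: "K (of_nat k) * D \<mu> i 0 = - (K (of_nat k) * E) - K (of_nat k * \<mu> + of_nat k * of_nat i)"
    by (simp add: D_def right_diff_distrib distrib_left K_add K_mult)
  have 2: "K (c - of_nat i * of_nat k) = K (c + of_nat k * \<mu>) - K (of_nat k * \<mu> + of_nat k * of_nat i)"
    by (simp add: K_diff[symmetric] mult.commute)
  have 3: "K (- c - of_nat k * \<mu>) = - K (c + of_nat k * \<mu>)"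
    by (simp add: K_minus[symmetric])
  show ?thesis
    unfolding eq 1 2 3 by simp
qed

text \<open>Pairs of indices with equal sum are connected by moving one unit at a time. A unit move
  is an \<open>A_gen\<close> if index 0 is avoided, a \<open>T_gen\<close> up to sign and
  commutation if one of the two pairs contains 0, and a mere commutation from (0, 1) to (1,
  0).\<close>

lemma toric_of_gens:
  assumes "left_ideal_set J"
    and A: "\<And>p q. p \<in> {1..k - 1} \<Longrightarrow> q \<in> {2..k} \<Longrightarrow> A_gen p q \<in> J"
    and T: "\<And>m. m \<in> {2..k} \<Longrightarrow> T_gen (\<mu> + of_nat i) m \<in> J"
  shows "W.toric i J"
proof -
  interpret J: left_ideal_set J by fact
  let ?X = "\<lambda>p q. D \<mu> (Suc i) p * D \<mu> i q"
  have step: "J.cg (?X p q) (?X (p + 1) (q - 1))" if pq: "p < k" "1 \<le> q" "q \<le> k" for p q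
  proof -
    consider "p \<ge> 1" "q \<ge> 2" | "p = 0" "q = 1" | "p = 0" "q \<ge> 2" | "p \<ge> 1" "q = 1"
      using pq by linarith
    then show ?thesis
    proof cases
      case 1
      then show ?thesis using A[of p q] A_gen_eq[of p q i] pq by (auto simp: J.cg_def)
    next
      case 2
      then show ?thesis using W.D_comm[of 0 1 i] pq by auto
    next
      case 3
      then show ?thesis
        using J.uminus_mem[OF T[of q]] T_gen_eq[of q i] W.D_comm[of 0 q i] pq by (auto simp: J.cg_def)
    next
      case 4
      then show ?thesis
        using T[of "p + 1"] T_gen_eq[of "p + 1" i] W.D_comm[of p 1 i] pq by (auto simp: J.cg_def)
    qed
  qed
  have steps: "p + n \<le> k \<Longrightarrow> n \<le> q \<Longrightarrow> q \<le> k \<Longrightarrow> J.cg (?X p q) (?X (p + n) (q - n))" for p q n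
  proof (induction n)
    case (Suc n)
    have "J.cg (?X p q) (?X (p + n) (q - n))" using Suc by simp
    also have "J.cg (?X (p + n) (q - n)) (?X (p + n + 1) (q - n - 1))"
      by (rule step) (use Suc.prems in auto)
    finally show ?case by simp
  qed simp
  have le: "J.cg (?X p q) (?X p' q')" if "p \<le> p'" "p' \<le> k" "q \<le> k" "p + q = p' + q'" for p q p' q'
  proof -
    have "p' = p + (p' - p)" "q' = q - (p' - p)" using that by auto
    then show ?thesis using steps[of p "p' - p" q] that by auto
  qed
  show ?thesis
    unfolding W.toric_def J.cg_def[symmetric]
  proof (intro allI impI)
    fix p q p' q' assume "p \<le> k" "q \<le> k" "p' \<le> k" "q' \<le> k" "p + q = p' + q'"
    then show "J.cg (?X p q) (?X p' q')"
      using le[of p p' q q'] J.cg_sym[OF le[of p' p q' q]] by (cases "p \<le> p'") auto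
  qed
qed

lemma hom_of_gen:
  assumes "left_ideal_set J" "U0 - K l \<in> J" "l = - c - of_nat k * \<mu>"
  shows "W.wsum (D \<mu> i) - K (c - of_nat i * of_nat k) \<in> J"
  unfolding U0_gen_eq using left_ideal_set.uminus_mem[OF assms(1,2)] by (simp add: assms(3))

text \<open>The interface to the sheaf part. The products with \<open>A_gen\<close>,
  \<open>T_gen\<close> and \<open>U0 - K l\<close> make right multiplication by \<open>R\<close> and
  by \<open>S\<close> well defined between the quotients; the first two memberships make these maps
  inverse to each other.\<close>

lemma inverse_exists:
  assumes l: "l = - c - of_nat k * \<mu>"
    and J: "left_ideal_set J" "\<And>p q. p \<in> {1..k - 1} \<Longrightarrow> q \<in> {2..k} \<Longrightarrow> A_gen p q \<in> J"
      "\<And>m. m \<in> {2..k} \<Longrightarrow> T_gen \<mu> m \<in> J" "U0 - K l \<in> J"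
    and J': "left_ideal_set J'" "\<And>p q. p \<in> {1..k - 1} \<Longrightarrow> q \<in> {2..k} \<Longrightarrow> A_gen p q \<in> J'"
      "\<And>m. m \<in> {2..k} \<Longrightarrow> T_gen (\<mu> + 1) m \<in> J'" "U0 - K l \<in> J'"
  defines "R \<equiv> E + K \<mu>"
  shows "\<exists>S. S * R - 1 \<in> J \<and> R * S - 1 \<in> J' \<and>
    (\<forall>p\<in>{1..k - 1}. \<forall>q\<in>{2..k}. A_gen p q * R \<in> J \<and> A_gen p q * S \<in> J') \<and>
    (\<forall>m\<in>{2..k}. T_gen (\<mu> + 1) m * R \<in> J \<and> T_gen \<mu> m * S \<in> J') \<and>
    (U0 - K l) * R \<in> J \<and> (U0 - K l) * S \<in> J'"
proof -
  interpret J: left_ideal_set J by fact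
  interpret J': left_ideal_set J' by fact
  have R: "R = - D \<mu> 0 0" by (simp add: R_def D_def)
  have t: "W.toric 0 J" by (rule toric_of_gens) (use J in auto)
  have t': "W.toric 1 J'" by (rule toric_of_gens) (use J' in auto)
  have h: "W.wsum (D \<mu> 0) - K c \<in> J" using hom_of_gen[OF J(1,4) l, of 0] by simp
  have h': "W.wsum (D \<mu> 1) - K (c - of_nat k) \<in> J'" using hom_of_gen[OF J'(1,4) l, of 1] by simp
  note SR = W.Q_D0[OF J(1) t h] and RS = W.D0_Q_1[OF J'(1) t' h']
  have A: "A_gen p q * R \<in> J \<and> A_gen p q * - W.Q \<in> J'" if pq: "p \<in> {1..k - 1}" "q \<in> {2..k}" for p q
  proof -
    have b: "p \<le> k" "q \<le> k" "p + 1 \<le> k" "q - 1 \<le> k" "p + q = p + 1 + (q - 1)" using pq by auto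
    show ?thesis
      using J.uminus_mem[OF W.toric_right_D0[OF J(1) t h b]] J'.uminus_mem[OF W.toric_right_Q[OF J'(1) t' h' b]]
        A_gen_eq[OF pq, of 0] A_gen_eq[OF pq, of 1] by (simp add: R numeral_2_eq_2)
  qed
  have T: "T_gen (\<mu> + 1) m * R \<in> J \<and> T_gen \<mu> m * - W.Q \<in> J'" if m: "m \<in> {2..k}" for m
  proof -
    have b: "1 \<le> k" "m - 1 \<le> k" "m \<le> k" "0 \<le> k" "1 + (m - 1) = m + 0" using m by auto
    show ?thesis
      using J.uminus_mem[OF W.toric_right_D0[OF J(1) t h b]] J'.uminus_mem[OF W.toric_right_Q[OF J'(1) t' h' b]]
        T_gen_eq[OF m, of 0] T_gen_eq[OF m, of 1] by (simp add: R numeral_2_eq_2)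
  qed
  have e: "W.wsum (D \<mu> 0) - K c = - (U0 - K l)" "W.wsum (D \<mu> 1) - K (c - of_nat k) = - (U0 - K l)"
    using U0_gen_eq[of 0] U0_gen_eq[of 1] l by simp_all
  have H: "(U0 - K l) * R \<in> J" "(U0 - K l) * - W.Q \<in> J'"
    using W.wsum_right_D0[OF J(1) t h] W.wsum_right_Q[OF J'(1) t' h'] unfolding e R
    by (simp_all only: minus_mult_commute)
  \<comment> \<open>As \<open>R\<close> is \<open>- D \<mu> 0 0\<close>, the witness is
    \<open>- W.Q\<close>, and the signs cancel in both products.\<close>
  show ?thesis
    using SR RS A T H by (intro exI[of _ "- W.Q"]) (simp add: R)
qed

end

end


section \<open>Partial derivatives of holomorphic functions\<close>

lemma opensD: "V \<in> opens U \<Longrightarrow> open V" "V \<in> opens U \<Longrightarrow> V \<subseteq> U"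
  by (auto simp: opens_def)

lemma opensI: "open V \<Longrightarrow> V \<subseteq> U \<Longrightarrow> V \<in> opens U"
  by (auto simp: opens_def)

lemma opens_trans: "W \<in> opens V \<Longrightarrow> V \<in> opens U \<Longrightarrow> W \<in> opens U"
  by (auto simp: opens_def)

definition pderiv_at :: "'n::finite \<Rightarrow> (complex^'n \<Rightarrow> complex) \<Rightarrow> complex^'n \<Rightarrow> complex" where
  "pderiv_at i f z = deriv (\<lambda>t. f (z + axis i t)) 0"

text \<open>A form of \<open>holo\<close> without extensionality, so that unrestricted products and
  partial derivatives can be handled before they are cut down to \<open>V\<close>.\<close>

definition holo_diff :: "(complex^'n) set \<Rightarrow> (complex^'n \<Rightarrow> complex) \<Rightarrow> bool" where
  "holo_diff V f \<longleftrightarrow> open V \<and> (\<forall>z\<in>V. \<exists>f'. (f has_derivative f') (at z) \<and>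
               (\<forall>c v. f' (c *s v) = c * f' v))"

lemma bounded_linear_vector_scalar_mult [bounded_linear]:
  "bounded_linear (\<lambda>t::complex. t *s (v::complex^'n::finite))"
proof -
  have "linear (\<lambda>t::complex. t *s v)"
    by (intro linearI) (auto simp: vec_eq_iff algebra_simps)
  then show ?thesis by (simp add: linear_conv_bounded_linear)
qed

lemma axis_eq_scalar: "axis i t = t *s (axis i 1 :: complex^'n::finite)"
  by (simp add: vec_eq_iff axis_def)

lemma norm_axis_complex: "norm (axis i (t::complex) :: complex^'n::finite) = norm t"
  unfolding norm_vec_def L2_set_def axis_def
  by (simp add: if_distrib[of "\<lambda>x. (norm x)\<^sup>2"] cong: if_cong)

lemma bounded_linear_axis [bounded_linear]: "bounded_linear (\<lambda>t::complex. axis i t :: complex^'n::finite)"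
proof -
  have *: "(\<lambda>t::complex. axis i t :: complex^'n) = (\<lambda>t. t *s axis i 1)"
    by (rule ext) (rule axis_eq_scalar)
  show ?thesis by (subst *) (rule bounded_linear_vector_scalar_mult)
qed

lemma axis_add: "axis i (s + t) = axis i s + (axis i t :: complex^'n::finite)"
  by (rule linear_add) (rule bounded_linear.linear[OF bounded_linear_axis])

lemma continuous_on_axis [continuous_intros]:
  "continuous_on A g \<Longrightarrow> continuous_on A (\<lambda>x. axis i (g x :: complex) :: complex^'n::finite)"
  by (rule bounded_linear.continuous_on[OF bounded_linear_axis])

lemma holo_diff_directional:
  fixes z :: "complex^'n::finite"
  assumes "(f has_derivative f') (at z)" "\<And>c v. f' (c *s v) = c * f' v"
  shows "((\<lambda>t. f (z + axis i t)) has_field_derivative f' (axis i 1)) (at 0)"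
proof -
  have "((\<lambda>t::complex. z + axis i t) has_derivative (\<lambda>t. axis i t)) (at 0)"
    by (auto intro!: derivative_eq_intros bounded_linear_imp_has_derivative bounded_linear_axis)
  from has_derivative_compose[OF this, of f f'] assms(1)
  have "((\<lambda>t. f (z + axis i t)) has_derivative (\<lambda>t. f' (axis i t))) (at 0)"
    by (simp add: axis_eq_scalar[of i 0])
  moreover have "f' (axis i t) = f' (axis i 1) * t" for t
    using assms(2)[of t "axis i 1"] by (subst axis_eq_scalar) simp
  then have "(\<lambda>t. f' (axis i t)) = (*) (f' (axis i 1))"
    by (rule ext)
  ultimately show ?thesis
    unfolding has_field_derivative_def by (simp only:)
qed

lemma pderiv_at_eq:
  assumes "(f has_derivative f') (at z)" "\<And>c v. f' (c *s v) = c * f' v"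
  shows "pderiv_at i f z = f' (axis i 1)"
  unfolding pderiv_at_def using holo_diff_directional[OF assms] by (rule DERIV_imp_deriv)

lemma sum_axis: "(\<Sum>i\<in>UNIV. v $ i *s axis i 1) = (v::complex^'n::finite)"
  by (simp add: vec_eq_iff axis_def if_distrib[of "\<lambda>x. _ * x"] cong: if_cong)

lemma holo_diff_has_derivative:
  fixes z :: "complex^'n::finite"
  assumes "holo_diff V f" "z \<in> V"
  shows "(f has_derivative (\<lambda>v. \<Sum>i\<in>UNIV. v $ i * pderiv_at i f z)) (at z)"
proof -
  obtain f' where f': "(f has_derivative f') (at z)" "\<And>c v. f' (c *s v) = c * f' v"
    using assms unfolding holo_diff_def by blast
  have "linear f'" using f'(1) has_derivative_linear by blast
  have "f' v = (\<Sum>i\<in>UNIV. v $ i * pderiv_at i f z)" for v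
  proof -
    have "f' v = f' (\<Sum>i\<in>UNIV. v $ i *s axis i 1)" by (simp add: sum_axis)
    also have "\<dots> = (\<Sum>i\<in>UNIV. f' (v $ i *s axis i 1))"
      by (rule linear_sum[OF \<open>linear f'\<close>])
    finally show ?thesis by (simp add: f'(2) pderiv_at_eq[OF f'])
  qed
  then have "f' = (\<lambda>v. \<Sum>i\<in>UNIV. v $ i * pderiv_at i f z)" by blast
  with f'(1) show ?thesis by simp
qed

lemma holo_diffI:
  fixes V :: "(complex^'n::finite) set"
  assumes "open V" "\<And>z. z \<in> V \<Longrightarrow> (f has_derivative (\<lambda>v. \<Sum>i\<in>UNIV. v $ i * g i z)) (at z)"
  shows "holo_diff V f"
  unfolding holo_diff_def
proof (intro conjI ballI assms(1))
  fix z assume "z \<in> V"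
  from assms(2)[OF this] show "\<exists>f'. (f has_derivative f') (at z) \<and> (\<forall>c v. f' (c *s v) = c * f' v)"
    by (intro exI[of _ "\<lambda>v. \<Sum>i\<in>UNIV. v $ i * g i z"]) (auto simp: sum_distrib_left mult.assoc)
qed

lemma pderiv_at_unique:
  fixes z :: "complex^'n::finite"
  assumes "(f has_derivative (\<lambda>v. \<Sum>i\<in>UNIV. v $ i * g i)) (at z)"
  shows "pderiv_at i f z = g i"
proof -
  have "pderiv_at i f z = (\<Sum>j\<in>UNIV. (axis i 1 :: complex^'n) $ j * g j)"
    by (rule pderiv_at_eq[OF assms]) (simp add: sum_distrib_left mult.assoc)
  also have "\<dots> = (\<Sum>j\<in>UNIV. if j = i then g j else 0)"
    by (rule sum.cong) (auto simp: axis_def)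
  also have "\<dots> = g i" by simp
  finally show ?thesis .
qed

lemma holo_diff_continuous_on: "holo_diff V f \<Longrightarrow> continuous_on V f"
  by (rule continuous_at_imp_continuous_on)
     (auto intro: has_derivative_continuous holo_diff_has_derivative)

lemma holo_diff_slice:
  assumes "holo_diff V f" "\<And>t. t \<in> S \<Longrightarrow> z + axis i t \<in> V"
  shows "(\<lambda>t. f (z + axis i t)) holomorphic_on S"
proof (rule holomorphic_onI)
  fix t assume "t \<in> S"
  obtain f' where f': "(f has_derivative f') (at (z + axis i t))" "\<And>c v. f' (c *s v) = c * f' v"
    using assms \<open>t \<in> S\<close> unfolding holo_diff_def by blast
  from holo_diff_directional[OF this, of i]
  have "((\<lambda>r. f (z + axis i (t + r))) has_field_derivative f' (axis i 1)) (at 0)"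
    by (simp add: add.assoc axis_add)
  then have "((\<lambda>r. f (z + axis i r)) has_field_derivative f' (axis i 1)) (at t)"
    using DERIV_shift[of "\<lambda>r. f (z + axis i r)" "f' (axis i 1)" 0 t] by (simp add: add.commute[of _ t])
  then show "(\<lambda>t. f (z + axis i t)) field_differentiable at t within S"
    unfolding field_differentiable_def using has_field_derivative_at_within by blast
qed

section \<open>Regularity and commutation of partial derivatives by Cauchy's formula\<close>

definition circ :: "real \<Rightarrow> real \<Rightarrow> complex" where
  "circ r x = of_real r * exp (2 * of_real pi * \<i> * of_real x)"

lemma continuous_on_circ [continuous_intros]:
  "continuous_on A g \<Longrightarrow> continuous_on A (\<lambda>x. circ r (g x))"
  unfolding circ_def by (intro continuous_intros)

lemma norm_circ: "r > 0 \<Longrightarrow> norm (circ r x) = r"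
  by (simp add: circ_def norm_mult)

lemma circ_ne_0: "r > 0 \<Longrightarrow> circ r x \<noteq> 0"
  by (simp add: circ_def)

text \<open>Cauchy's formula for the first derivative of a slice in one variable. On the circle du =
  2 pi i u dx, so the kernel 1 / u^2 becomes 1 / u. Holomorphy is given by pointwise
  differentiability alone; this formula is the source of all regularity of the partial
  derivatives.\<close>

lemma pderiv_at_integral:
  assumes f: "holo_diff V f" and r: "r > 0" and V: "\<And>t. norm t \<le> r \<Longrightarrow> z + axis i t \<in> V"
  shows "((\<lambda>x. f (z + axis i (circ r x)) / circ r x) has_integral pderiv_at i f z) {0..1}"
proof -
  let ?g = "\<lambda>t. f (z + axis i t)"
  have hol: "?g holomorphic_on cball 0 r"
    by (rule holo_diff_slice[OF f]) (use V in \<open>auto simp: dist_norm\<close>)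
  have "((\<lambda>u. ?g u / (u - 0) ^ Suc 1) has_contour_integral (2 * pi * \<i> / fact 1 * (deriv ^^ 1) ?g 0)) (circlepath 0 r)"
    by (rule Cauchy_has_contour_integral_higher_derivative_circlepath)
       (use hol r in \<open>auto intro: holomorphic_on_imp_continuous_on holomorphic_on_subset\<close>)
  then have "((\<lambda>x. ?g (circlepath 0 r x) / circlepath 0 r x ^ 2 * (2 * pi * \<i> * of_real r * exp (2 * of_real pi * \<i> * x)))
      has_integral (2 * pi * \<i> * pderiv_at i f z)) {0..1}"
    unfolding has_contour_integral
    by (simp add: pderiv_at_def numeral_2_eq_2 vector_derivative_circlepath)
  from has_integral_mult_right[OF this, of "1 / (2 * pi * \<i>)"]
  have "((\<lambda>x. 1 / (2 * pi * \<i>) * (?g (circlepath 0 r x) / circlepath 0 r x ^ 2 * (2 * pi * \<i> * of_real r * exp (2 * of_real pi * \<i> * x))))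
      has_integral pderiv_at i f z) {0..1}"
    by simp
  then show ?thesis
    by (rule has_integral_eq[rotated])
       (use r in \<open>simp add: circlepath circ_def power2_eq_square divide_simps mult_ac\<close>)
qed

text \<open>One radius has to serve all nearby base points, since the Cauchy integral is used as an
  integral with parameter. Half of the radius is spent on the base point and half on the
  circle.\<close>

lemma holo_diff_ball:
  assumes "open V" "z \<in> V"
  obtains r where "r > 0" "\<And>w i t. w \<in> ball z r \<Longrightarrow> norm t \<le> r \<Longrightarrow> w + axis i t \<in> (V::(complex^'n::finite) set)"
proof -
  obtain e where e: "e > 0" "ball z e \<subseteq> V" using assms open_contains_ball by blast
  show ?thesis
  proof
    show "e / 2 > 0" using e by simp
    fix w i and t::complex assume "w \<in> ball z (e/2)" "norm t \<le> e/2"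
    then have "dist z (w + axis i t) < e"
      using norm_triangle_ineq[of "z - w" "- axis i t"] by (simp add: dist_norm norm_axis_complex diff_diff_add)
    then show "w + axis i t \<in> V" using e by auto
  qed
qed

text \<open>The integrand of Cauchy's formula involves only \<open>f\<close>, which is continuous.
  The continuity gained here is the input for differentiating under the integral sign
  afterwards.\<close>

lemma continuous_on_pderiv_at:
  assumes f: "holo_diff V f"
  shows "continuous_on V (pderiv_at i f)"
proof (rule continuous_at_imp_continuous_on, intro ballI)
  fix z assume "z \<in> V"
  have "open V" using f by (simp add: holo_diff_def)
  obtain r where r: "r > 0" and V: "\<And>w i t. w \<in> ball z r \<Longrightarrow> norm t \<le> r \<Longrightarrow> w + axis i t \<in> V"
    using holo_diff_ball[OF \<open>open V\<close> \<open>z \<in> V\<close>] by metis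
  have "continuous_on (ball z r) (\<lambda>w. integral (cbox 0 1) (\<lambda>x. f (w + axis i (circ r x)) / circ r x))"
  proof (rule integral_continuous_on_param)
    show "continuous_on (ball z r \<times> cbox 0 1) (\<lambda>(w, x). f (w + axis i (circ r x)) / circ r x)"
      unfolding split_def
      by (intro continuous_intros continuous_on_compose2[OF holo_diff_continuous_on[OF f]])
         (auto simp: circ_ne_0 r intro!: V norm_circ[THEN eq_refl])
  qed
  then have "continuous_on (ball z r) (pderiv_at i f)"
    by (rule continuous_on_eq)
       (use pderiv_at_integral[OF f r V] in \<open>auto intro!: integral_unique\<close>)
  then show "isCont (pderiv_at i f) z"
    using r continuous_on_eq_continuous_at by (metis centre_in_ball open_ball)
qed

text \<open>Cauchy's formula differentiated under the integral sign. The radius stays in the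
  conclusion because \<open>pderiv_at_commute\<close> applies Cauchy's formula on the same circle
  again.\<close>

lemma pderiv_at_has_derivative:
  fixes V :: "(complex^'n::finite) set"
  assumes f: "holo_diff V f" and z: "z \<in> V"
  shows "\<exists>r>0. (\<forall>t. norm t \<le> r \<longrightarrow> z + axis i t \<in> V) \<and>
     (pderiv_at i f has_derivative (\<lambda>v. \<Sum>j\<in>UNIV. v $ j *
        integral {0..1} (\<lambda>x. pderiv_at j f (z + axis i (circ r x)) / circ r x))) (at z)"
proof -
  have "open V" using f by (simp add: holo_diff_def)
  obtain r where r: "r > 0" and V: "\<And>w i t. w \<in> ball z r \<Longrightarrow> norm t \<le> r \<Longrightarrow> w + axis i t \<in> V"
    using holo_diff_ball[OF \<open>open V\<close> z] by metis
  have Vc: "w + axis i (circ r x) \<in> V" if "w \<in> ball z r" for w x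
    by (rule V[OF that norm_circ[OF r, THEN eq_refl]])
  define g where "g j w x = pderiv_at j f (w + axis i (circ r x)) / circ r x" for j w x
  have cont_g: "continuous_on (ball z r \<times> {0..1}) (\<lambda>p. g j (fst p) (snd p))" for j
    unfolding g_def
    by (intro continuous_intros continuous_on_compose2[OF continuous_on_pderiv_at[OF f]])
       (auto simp: circ_ne_0 r intro!: Vc)
  \<comment> \<open>\<open>leibniz_rule\<close> expects the derivative as a continuous family of
    bounded linear maps; the coordinate projections \<open>P j\<close> are its building
    blocks.\<close>
  define P :: "'n \<Rightarrow> (complex^'n) \<Rightarrow>\<^sub>L complex" where "P j = Blinfun (\<lambda>v. v $ j)" for j
  have P: "blinfun_apply (P j) v = v $ j" for j v
    unfolding P_def by (subst bounded_linear_Blinfun_apply) (auto intro: bounded_linear_vec_nth)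
  define fx where "fx w x = (\<Sum>j\<in>UNIV. blinfun_mult_left (g j w x) o\<^sub>L P j)" for w x
  have fx: "blinfun_apply (fx w x) v = (\<Sum>j\<in>UNIV. v $ j * g j w x)" for w x v
    by (simp add: fx_def P blinfun.sum_left)
  have cont_fx: "continuous_on (ball z r \<times> cbox 0 1) (\<lambda>(w, x). fx w x)"
    unfolding split_def fx_def cbox_interval
    by (intro continuous_intros bounded_linear.continuous_on[OF bounded_linear_blinfun_mult_left] cont_g)
  have zr: "z \<in> ball z r" using r by simp
  have "((\<lambda>w. integral (cbox 0 1) (\<lambda>x. f (w + axis i (circ r x)) / circ r x)) has_derivative
      blinfun_apply (integral (cbox 0 1) (fx z))) (at z within ball z r)"
  proof (rule leibniz_rule[where fx = fx])
    fix w x assume w: "w \<in> ball z r"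
    have shift: "((\<lambda>w. w + axis i (circ r x)) has_derivative (\<lambda>v. v)) (at w)"
      by (auto intro!: derivative_eq_intros)
    have "((\<lambda>w. f (w + axis i (circ r x))) has_derivative
        (\<lambda>v. \<Sum>j\<in>UNIV. v $ j * pderiv_at j f (w + axis i (circ r x)))) (at w)"
      by (rule has_derivative_compose[OF shift holo_diff_has_derivative[OF f Vc[OF w]]])
    then have "((\<lambda>w. f (w + axis i (circ r x)) / circ r x) has_derivative
        (\<lambda>v. (\<Sum>j\<in>UNIV. v $ j * pderiv_at j f (w + axis i (circ r x))) / circ r x)) (at w)"
      unfolding divide_inverse by (rule has_derivative_mult_left)
    moreover have "(\<lambda>v. (\<Sum>j\<in>UNIV. v $ j * pderiv_at j f (w + axis i (circ r x))) / circ r x) = blinfun_apply (fx w x)"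
      by (rule ext) (simp add: fx g_def sum_divide_distrib)
    ultimately show "((\<lambda>w. f (w + axis i (circ r x)) / circ r x) has_derivative blinfun_apply (fx w x)) (at w within ball z r)"
      by (simp add: has_derivative_at_withinI)
  next
    fix w assume "w \<in> ball z r"
    then show "(\<lambda>x. f (w + axis i (circ r x)) / circ r x) integrable_on cbox 0 1"
      using pderiv_at_integral[OF f r V] by (auto intro: has_integral_integrable)
  qed (use cont_fx zr in auto)
  then have "((\<lambda>w. integral (cbox 0 1) (\<lambda>x. f (w + axis i (circ r x)) / circ r x)) has_derivative
      blinfun_apply (integral (cbox 0 1) (fx z))) (at z)"
    by (simp add: at_within_open[OF zr])
  then have "(pderiv_at i f has_derivative blinfun_apply (integral (cbox 0 1) (fx z))) (at z)"
    by (rule has_derivative_transform_within_open[OF _ open_ball zr])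
       (use pderiv_at_integral[OF f r V] in \<open>auto intro!: integral_unique\<close>)
  moreover have "blinfun_apply (integral (cbox 0 1) (fx z)) v = (\<Sum>j\<in>UNIV. v $ j * integral {0..1} (g j z))" for v
  proof -
    have cfx: "fx z integrable_on cbox 0 1"
      by (intro integrable_continuous continuous_on_compose2[OF cont_fx[unfolded split_def], of _ "\<lambda>x. (z, x)", simplified])
         (use zr in \<open>auto intro!: continuous_intros\<close>)
    have cg: "g j z integrable_on {0..1}" for j
      by (intro integrable_continuous_real continuous_on_compose2[OF cont_g, of _ "\<lambda>x. (z, x)", simplified])
         (use zr in \<open>auto intro!: continuous_intros\<close>)
    have "blinfun_apply (integral (cbox 0 1) (fx z)) v = integral (cbox 0 1) (\<lambda>x. blinfun_apply (fx z x) v)"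
      by (rule blinfun_apply_integral[OF cfx])
    also have "\<dots> = integral {0..1} (\<lambda>x. \<Sum>j\<in>UNIV. v $ j * g j z x)"
      by (simp add: fx)
    also have "\<dots> = (\<Sum>j\<in>UNIV. integral {0..1} (\<lambda>x. v $ j * g j z x))"
      by (rule integral_sum) (auto intro!: cg integrable_on_mult_right)
    finally show ?thesis by simp
  qed
  then have "blinfun_apply (integral (cbox 0 1) (fx z)) = (\<lambda>v. \<Sum>j\<in>UNIV. v $ j * integral {0..1} (g j z))"
    by (rule ext)
  ultimately have "(pderiv_at i f has_derivative (\<lambda>v. \<Sum>j\<in>UNIV. v $ j * integral {0..1} (g j z))) (at z)"
    by simp
  then show ?thesis
    using r V[OF zr] unfolding g_def by blast
qed

lemma holo_diff_pderiv_at: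
  fixes V :: "(complex^'n::finite) set"
  assumes f: "holo_diff V f"
  shows "holo_diff V (pderiv_at i f)"
proof -
  have "\<exists>g. (pderiv_at i f has_derivative (\<lambda>v. \<Sum>j\<in>UNIV. v $ j * g j)) (at z)" if "z \<in> V" for z
    using pderiv_at_has_derivative[OF f that, of i]
    by (elim exE conjE) (rule exI)
  then obtain g where "\<And>z. z \<in> V \<Longrightarrow> (pderiv_at i f has_derivative (\<lambda>v. \<Sum>j\<in>UNIV. v $ j * g z j)) (at z)"
    by metis
  then show ?thesis
    using f by (intro holo_diffI[where g = "\<lambda>j z. g z j"]) (auto simp: holo_diff_def)
qed

text \<open>Both sides are the Cauchy integral of \<open>pderiv_at i f\<close> over a circle in
  direction \<open>j\<close>: once by differentiating the formula for \<open>pderiv_at j f\<close>,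
  once by the formula for \<open>pderiv_at i f\<close> itself.\<close>

lemma pderiv_at_commute:
  fixes V :: "(complex^'n::finite) set"
  assumes f: "holo_diff V f" and z: "z \<in> V"
  shows "pderiv_at i (pderiv_at j f) z = pderiv_at j (pderiv_at i f) z"
proof -
  obtain r where r: "r > 0" "\<And>t. norm t \<le> r \<Longrightarrow> z + axis j t \<in> V"
    and D: "(pderiv_at j f has_derivative (\<lambda>v. \<Sum>i\<in>UNIV. v $ i *
        integral {0..1} (\<lambda>x. pderiv_at i f (z + axis j (circ r x)) / circ r x))) (at z)"
    using pderiv_at_has_derivative[OF f z, of j] by blast
  have "pderiv_at i (pderiv_at j f) z
      = integral {0..1} (\<lambda>x. pderiv_at i f (z + axis j (circ r x)) / circ r x)"
    by (rule pderiv_at_unique[OF D])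
  also have "\<dots> = pderiv_at j (pderiv_at i f) z"
    by (rule integral_unique[OF pderiv_at_integral[OF holo_diff_pderiv_at[OF f] r]])
  finally show ?thesis .
qed

lemma holo_diff_cong:
  assumes "holo_diff V f" "\<And>z. z \<in> V \<Longrightarrow> f z = g z"
  shows "holo_diff V g"
  using assms has_derivative_transform_within_open[of f _ _ UNIV V g]
  unfolding holo_diff_def by blast

lemma pderiv_at_cong:
  fixes V :: "(complex^'n::finite) set"
  assumes "holo_diff V f" "\<And>z. z \<in> V \<Longrightarrow> f z = g z" "z \<in> V"
  shows "pderiv_at i g z = pderiv_at i f z"
proof (rule pderiv_at_unique)
  show "(g has_derivative (\<lambda>v. \<Sum>i\<in>UNIV. v $ i * pderiv_at i f z)) (at z)"
    by (rule has_derivative_transform_within_open[OF holo_diff_has_derivative[OF assms(1,3)] _ assms(3)])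
       (use assms in \<open>auto simp: holo_diff_def\<close>)
qed

lemma holo_diff_subset: "holo_diff V f \<Longrightarrow> open W \<Longrightarrow> W \<subseteq> V \<Longrightarrow> holo_diff W f"
  unfolding holo_diff_def by blast

lemma has_derivative_lincomb:
  fixes V :: "(complex^'n::finite) set"
  assumes "holo_diff V f" "holo_diff V g" "z \<in> V"
  shows "((\<lambda>z. c * f z + g z) has_derivative
     (\<lambda>v. \<Sum>i\<in>UNIV. v $ i * (c * pderiv_at i f z + pderiv_at i g z))) (at z)"
proof -
  have "((\<lambda>z. c * f z + g z) has_derivative
     (\<lambda>v. c * (\<Sum>i\<in>UNIV. v $ i * pderiv_at i f z) + (\<Sum>i\<in>UNIV. v $ i * pderiv_at i g z))) (at z)"
    by (intro has_derivative_add has_derivative_mult_right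
      holo_diff_has_derivative[OF assms(1,3)] holo_diff_has_derivative[OF assms(2,3)])
  then show ?thesis
    by (simp add: sum_distrib_left distrib_left sum.distrib mult_ac)
qed

lemma holo_diff_lincomb: "holo_diff V f \<Longrightarrow> holo_diff V g \<Longrightarrow> holo_diff V (\<lambda>z. c * f z + g z)"
  by (rule holo_diffI[OF _ has_derivative_lincomb]) (auto simp: holo_diff_def)

lemma pderiv_at_lincomb:
  "holo_diff V f \<Longrightarrow> holo_diff V g \<Longrightarrow> z \<in> V \<Longrightarrow>
    pderiv_at i (\<lambda>z. c * f z + g z) z = c * pderiv_at i f z + pderiv_at i g z"
  using pderiv_at_unique[OF has_derivative_lincomb] by blast

lemma has_derivative_product:
  fixes V :: "(complex^'n::finite) set"
  assumes "holo_diff V f" "holo_diff V g" "z \<in> V"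
  shows "((\<lambda>z. f z * g z) has_derivative
     (\<lambda>v. \<Sum>i\<in>UNIV. v $ i * (f z * pderiv_at i g z + pderiv_at i f z * g z))) (at z)"
proof -
  have "((\<lambda>z. f z * g z) has_derivative
     (\<lambda>v. f z * (\<Sum>i\<in>UNIV. v $ i * pderiv_at i g z) + (\<Sum>i\<in>UNIV. v $ i * pderiv_at i f z) * g z)) (at z)"
    by (intro has_derivative_mult
      holo_diff_has_derivative[OF assms(1,3)] holo_diff_has_derivative[OF assms(2,3)])
  then show ?thesis
    by (simp add: sum_distrib_left sum_distrib_right distrib_left sum.distrib mult_ac)
qed

lemma holo_diff_mult: "holo_diff V f \<Longrightarrow> holo_diff V g \<Longrightarrow> holo_diff V (\<lambda>z. f z * g z)"
  by (rule holo_diffI[OF _ has_derivative_product]) (auto simp: holo_diff_def)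

lemma pderiv_at_mult:
  "holo_diff V f \<Longrightarrow> holo_diff V g \<Longrightarrow> z \<in> V \<Longrightarrow>
    pderiv_at i (\<lambda>z. f z * g z) z = f z * pderiv_at i g z + pderiv_at i f z * g z"
  using pderiv_at_unique[OF has_derivative_product] by blast

lemma has_derivative_const_coord:
  fixes z :: "complex^'n::finite"
  shows "((\<lambda>z. c) has_derivative (\<lambda>v. \<Sum>i\<in>UNIV. v $ i * 0)) (at z)"
    and "((\<lambda>z. z $ j) has_derivative (\<lambda>v. \<Sum>i\<in>UNIV. v $ i * (if i = j then 1 else 0))) (at z)"
  by (auto simp: if_distrib[of "\<lambda>x. _ * x"] bounded_linear_imp_has_derivative bounded_linear_vec_nth
      cong: if_cong)

lemma holo_diff_const: "open V \<Longrightarrow> holo_diff V (\<lambda>z. c)"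
  by (rule holo_diffI[OF _ has_derivative_const_coord(1)])

lemma holo_diff_coord: "open V \<Longrightarrow> holo_diff V (\<lambda>z. z $ j)"
  by (rule holo_diffI[OF _ has_derivative_const_coord(2)])

lemma pderiv_at_const: "pderiv_at i (\<lambda>z. c) z = 0"
  using pderiv_at_unique[OF has_derivative_const_coord(1)] by blast

lemma pderiv_at_coord: "pderiv_at i (\<lambda>z. z $ j) z = (if i = j then 1 else 0)"
  using pderiv_at_unique[OF has_derivative_const_coord(2), of i] by blast

lemma holo_iff: "open V \<Longrightarrow> f \<in> holo V \<longleftrightarrow> f \<in> extensional V \<and> holo_diff V f"
  by (simp add: holo_def holo_diff_def)


section \<open>The sheaf of rings of differential operators\<close>

lemma holo_restrict: "f \<in> holo V \<Longrightarrow> W \<in> opens V \<Longrightarrow> restrict f W \<in> holo W"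
  unfolding holo_def
proof safe
  fix z assume W: "W \<in> opens V" and z: "z \<in> W"
    and D: "\<forall>z\<in>V. \<exists>f'. (f has_derivative f') (at z) \<and> (\<forall>c v. f' (c *s v) = c * f' v)"
  obtain f' where f': "(f has_derivative f') (at z)" "\<forall>c v. f' (c *s v) = c * f' v"
    using D opensD(2)[OF W] z by blast
  have "(restrict f W has_derivative f') (at z)"
    by (rule has_derivative_transform_within_open[OF f'(1) opensD(1)[OF W] z]) simp
  then show "\<exists>f'. (restrict f W has_derivative f') (at z) \<and> (\<forall>c v. f' (c *s v) = c * f' v)"
    using f'(2) by blast
qed auto

lemma holo_lincomb: "open V \<Longrightarrow> f \<in> holo V \<Longrightarrow> g \<in> holo V \<Longrightarrow> (\<lambda>z\<in>V. c * f z + g z) \<in> holo V"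
  by (auto simp: holo_iff intro: holo_diff_cong[OF holo_diff_lincomb])

lemma holo_mult: "open V \<Longrightarrow> f \<in> holo V \<Longrightarrow> g \<in> holo V \<Longrightarrow> (\<lambda>z\<in>V. f z * g z) \<in> holo V"
  by (auto simp: holo_iff intro: holo_diff_cong[OF holo_diff_mult])

lemma holo_zero: "open V \<Longrightarrow> (\<lambda>z\<in>V. 0) \<in> holo V"
  by (auto simp: holo_iff intro: holo_diff_cong[OF holo_diff_const])

lemma holo_add: "open V \<Longrightarrow> f \<in> holo V \<Longrightarrow> g \<in> holo V \<Longrightarrow> (\<lambda>z\<in>V. f z + g z) \<in> holo V"
  using holo_lincomb[of V f g 1] by simp

lemma holo_minus: "open V \<Longrightarrow> f \<in> holo V \<Longrightarrow> (\<lambda>z\<in>V. - f z) \<in> holo V"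
  using holo_lincomb[of V f "\<lambda>z\<in>V. 0" "- 1"] holo_zero[of V]
  by (simp cong: restrict_cong)

lemma holo_pderiv: "open V \<Longrightarrow> f \<in> holo V \<Longrightarrow> (\<lambda>z\<in>V. pderiv_at i f z) \<in> holo V"
  by (auto simp: holo_iff intro: holo_diff_cong[OF holo_diff_pderiv_at])

lemma holo_eqI: "f \<in> holo V \<Longrightarrow> g \<in> holo V \<Longrightarrow> (\<And>z. z \<in> V \<Longrightarrow> f z = g z) \<Longrightarrow> f = g"
  by (auto simp: holo_def intro: extensionalityI)

lemma endo_holo: "P \<in> carrier (endo U) \<Longrightarrow> V \<in> opens U \<Longrightarrow> f \<in> holo V \<Longrightarrow> P V f \<in> holo V"
  by (auto simp: endo_def dest!: PiE_mem)

lemma endo_lin: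
  "P \<in> carrier (endo U) \<Longrightarrow> V \<in> opens U \<Longrightarrow> f \<in> holo V \<Longrightarrow> g \<in> holo V \<Longrightarrow>
    P V (\<lambda>z\<in>V. c * f z + g z) = (\<lambda>z\<in>V. c * P V f z + P V g z)"
  by (auto simp: endo_def)

lemma endo_add_arg:
  "P \<in> carrier (endo U) \<Longrightarrow> V \<in> opens U \<Longrightarrow> f \<in> holo V \<Longrightarrow> g \<in> holo V \<Longrightarrow>
    P V (\<lambda>z\<in>V. f z + g z) = (\<lambda>z\<in>V. P V f z + P V g z)"
  using endo_lin[of P U V f g 1] by simp

lemma endo_restrict:
  "P \<in> carrier (endo U) \<Longrightarrow> V \<in> opens U \<Longrightarrow> f \<in> holo V \<Longrightarrow> W \<in> opens V \<Longrightarrow>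
    P W (restrict f W) = restrict (P V f) W"
  by (auto simp: endo_def)

lemma endo_eqI:
  assumes "P \<in> carrier (endo U)" "Q \<in> carrier (endo U)"
    and "\<And>V f z. V \<in> opens U \<Longrightarrow> f \<in> holo V \<Longrightarrow> z \<in> V \<Longrightarrow> P V f z = Q V f z"
  shows "P = Q"
proof -
  have PE: "P \<in> (\<Pi>\<^sub>E V\<in>opens U. holo V \<rightarrow>\<^sub>E holo V)" "Q \<in> (\<Pi>\<^sub>E V\<in>opens U. holo V \<rightarrow>\<^sub>E holo V)"
    using assms(1,2) by (auto simp: endo_def)
  show ?thesis
  proof (rule PiE_ext[OF PE])
    fix V assume V: "V \<in> opens U"
    show "P V = Q V"
    proof (rule PiE_ext)
      show "P V \<in> holo V \<rightarrow>\<^sub>E holo V" "Q V \<in> holo V \<rightarrow>\<^sub>E holo V"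
        using PE V by auto
      show "P V f = Q V f" if "f \<in> holo V" for f
        by (rule holo_eqI[of _ V]) (use that assms V in \<open>auto intro: endo_holo\<close>)
    qed
  qed
qed

lemma endoI:
  assumes "\<And>V f. V \<in> opens U \<Longrightarrow> f \<in> holo V \<Longrightarrow> h V f \<in> holo V"
    and "\<And>V f g c z. V \<in> opens U \<Longrightarrow> f \<in> holo V \<Longrightarrow> g \<in> holo V \<Longrightarrow> z \<in> V \<Longrightarrow>
      h V (\<lambda>z\<in>V. c * f z + g z) z = c * h V f z + h V g z"
    and "\<And>V W f z. V \<in> opens U \<Longrightarrow> W \<in> opens V \<Longrightarrow> f \<in> holo V \<Longrightarrow> z \<in> W \<Longrightarrow>
      h W (restrict f W) z = h V f z"
  shows "(\<lambda>V\<in>opens U. \<lambda>f\<in>holo V. h V f) \<in> carrier (endo U)"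
proof -
  let ?P = "\<lambda>V\<in>opens U. \<lambda>f\<in>holo V. h V f"
  have "?P V (\<lambda>z\<in>V. c * f z + g z) = (\<lambda>z\<in>V. c * ?P V f z + ?P V g z)"
    if "V \<in> opens U" "f \<in> holo V" "g \<in> holo V" for V f g c
  proof (rule holo_eqI)
    have "open V" using that opensD by auto
    show "?P V (\<lambda>z\<in>V. c * f z + g z) \<in> holo V" "(\<lambda>z\<in>V. c * ?P V f z + ?P V g z) \<in> holo V"
      using that \<open>open V\<close> by (auto simp: assms(1) holo_lincomb)
    show "?P V (\<lambda>z\<in>V. c * f z + g z) z = (\<lambda>z\<in>V. c * ?P V f z + ?P V g z) z" if "z \<in> V" for z
      using that \<open>V \<in> opens U\<close> \<open>f \<in> holo V\<close> \<open>g \<in> holo V\<close> \<open>open V\<close>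
      by (simp add: assms(2) holo_lincomb)
  qed
  moreover have "?P W (restrict f W) = restrict (?P V f) W"
    if "V \<in> opens U" "W \<in> opens V" "f \<in> holo V" for V W f
  proof (rule holo_eqI)
    have W: "W \<in> opens U" using that opens_trans by blast
    show "?P W (restrict f W) \<in> holo W" "restrict (?P V f) W \<in> holo W"
      using assms(1)[OF W holo_restrict[OF that(3,2)]] holo_restrict[OF assms(1)[OF that(1,3)] that(2)]
        that(1,3) W holo_restrict[OF that(3,2)] by simp_all
    show "?P W (restrict f W) z = restrict (?P V f) W z" if "z \<in> W" for z
      using that W \<open>V \<in> opens U\<close> \<open>W \<in> opens V\<close> \<open>f \<in> holo V\<close> holo_restrict[of f V W] assms(3)
      by simp
  qed
  ultimately show ?thesis
    by (auto simp: endo_def assms(1))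
qed

lemma endo_ops:
  "mult (endo U) P Q = (\<lambda>V\<in>opens U. \<lambda>f\<in>holo V. P V (Q V f))"
  "one (endo U) = (\<lambda>V\<in>opens U. \<lambda>f\<in>holo V. f)"
  "zero (endo U) = (\<lambda>V\<in>opens U. \<lambda>f\<in>holo V. \<lambda>z\<in>V. 0)"
  "add (endo U) P Q = (\<lambda>V\<in>opens U. \<lambda>f\<in>holo V. \<lambda>z\<in>V. P V f z + Q V f z)"
  by (simp_all add: endo_def)

lemma endo_closed:
  assumes "P \<in> carrier (endo U)" "Q \<in> carrier (endo U)"
  shows "P \<otimes>\<^bsub>endo U\<^esub> Q \<in> carrier (endo U)"
    and "P \<oplus>\<^bsub>endo U\<^esub> Q \<in> carrier (endo U)"
    and "(\<lambda>V\<in>opens U. \<lambda>f\<in>holo V. \<lambda>z\<in>V. - P V f z) \<in> carrier (endo U)"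
proof -
  note P = assms(1) and Q = assms(2)
  show "P \<otimes>\<^bsub>endo U\<^esub> Q \<in> carrier (endo U)"
    unfolding endo_ops
  proof (rule endoI)
    show "P V (Q V (\<lambda>z\<in>V. c * f z + g z)) z = c * P V (Q V f) z + P V (Q V g) z"
      if "V \<in> opens U" "f \<in> holo V" "g \<in> holo V" "z \<in> V" for V f g c z
      using that by (simp add: endo_lin[OF Q] endo_lin[OF P] endo_holo[OF Q])
    show "P W (Q W (restrict f W)) z = P V (Q V f) z"
      if "V \<in> opens U" "W \<in> opens V" "f \<in> holo V" "z \<in> W" for V W f z
      using that by (simp only: endo_restrict[OF Q that(1,3,2)]
        endo_restrict[OF P that(1) endo_holo[OF Q that(1,3)] that(2)]) simp
  qed (auto intro!: endo_holo[OF P] endo_holo[OF Q])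
  show "P \<oplus>\<^bsub>endo U\<^esub> Q \<in> carrier (endo U)"
    unfolding endo_ops
  proof (rule endoI)
    show "(\<lambda>z\<in>V. P V (\<lambda>z\<in>V. c * f z + g z) z + Q V (\<lambda>z\<in>V. c * f z + g z) z) z
        = c * (\<lambda>z\<in>V. P V f z + Q V f z) z + (\<lambda>z\<in>V. P V g z + Q V g z) z"
      if "V \<in> opens U" "f \<in> holo V" "g \<in> holo V" "z \<in> V" for V f g c z
      using that by (simp add: endo_lin[OF Q] endo_lin[OF P] distrib_left)
    show "(\<lambda>z\<in>W. P W (restrict f W) z + Q W (restrict f W) z) z = (\<lambda>z\<in>V. P V f z + Q V f z) z"
      if "V \<in> opens U" "W \<in> opens V" "f \<in> holo V" "z \<in> W" for V W f z
      using that opensD(2)[OF that(2)]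
      by (simp only: endo_restrict[OF Q that(1,3,2)] endo_restrict[OF P that(1,3,2)]) auto
  qed (auto intro!: holo_add endo_holo[OF P] endo_holo[OF Q] dest: opensD)
  show "(\<lambda>V\<in>opens U. \<lambda>f\<in>holo V. \<lambda>z\<in>V. - P V f z) \<in> carrier (endo U)"
  proof (rule endoI)
    show "(\<lambda>z\<in>V. - P V (\<lambda>z\<in>V. c * f z + g z) z) z = c * (\<lambda>z\<in>V. - P V f z) z + (\<lambda>z\<in>V. - P V g z) z"
      if "V \<in> opens U" "f \<in> holo V" "g \<in> holo V" "z \<in> V" for V f g c z
      using that by (simp add: endo_lin[OF P])
    show "(\<lambda>z\<in>W. - P W (restrict f W) z) z = (\<lambda>z\<in>V. - P V f z) z"
      if "V \<in> opens U" "W \<in> opens V" "f \<in> holo V" "z \<in> W" for V W f z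
      using that opensD(2)[OF that(2)]
      by (simp only: endo_restrict[OF P that(1,3,2)]) auto
  qed (auto intro!: holo_minus endo_holo[OF P] dest: opensD)
qed

lemma endo_closed_const:
  "\<one>\<^bsub>endo U\<^esub> \<in> carrier (endo U)" "\<zero>\<^bsub>endo U\<^esub> \<in> carrier (endo U)"
proof -
  show "\<one>\<^bsub>endo U\<^esub> \<in> carrier (endo U)"
    unfolding endo_ops by (rule endoI) auto
  show "\<zero>\<^bsub>endo U\<^esub> \<in> carrier (endo U)"
    unfolding endo_ops by (rule endoI) (auto intro!: holo_zero dest: opensD)
qed

lemma monoid_endo: "monoid (endo U)"
proof (rule monoidI)
  fix P Q R assume "P \<in> carrier (endo U)" "Q \<in> carrier (endo U)" "R \<in> carrier (endo U)"
  then show "P \<otimes>\<^bsub>endo U\<^esub> Q \<otimes>\<^bsub>endo U\<^esub> R = P \<otimes>\<^bsub>endo U\<^esub> (Q \<otimes>\<^bsub>endo U\<^esub> R)"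
    by (intro endo_eqI[of _ U] endo_closed endo_closed_const) (auto simp: endo_ops endo_holo)
next
  fix P assume "P \<in> carrier (endo U)"
  then show "\<one>\<^bsub>endo U\<^esub> \<otimes>\<^bsub>endo U\<^esub> P = P" "P \<otimes>\<^bsub>endo U\<^esub> \<one>\<^bsub>endo U\<^esub> = P"
    by (auto intro!: endo_eqI[of _ U] endo_closed(1) endo_closed_const) (auto simp: endo_ops endo_holo)
qed (auto intro: endo_closed(1) endo_closed_const)

lemma abelian_group_endo: "abelian_group (endo U)"
proof (rule abelian_groupI)
  fix P Q R assume "P \<in> carrier (endo U)" "Q \<in> carrier (endo U)" "R \<in> carrier (endo U)"
  then show "P \<oplus>\<^bsub>endo U\<^esub> Q \<oplus>\<^bsub>endo U\<^esub> R = P \<oplus>\<^bsub>endo U\<^esub> (Q \<oplus>\<^bsub>endo U\<^esub> R)"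
    by (intro endo_eqI[of _ U] endo_closed endo_closed_const) (auto simp: endo_ops)
next
  fix P Q assume "P \<in> carrier (endo U)" "Q \<in> carrier (endo U)"
  then show "P \<oplus>\<^bsub>endo U\<^esub> Q = Q \<oplus>\<^bsub>endo U\<^esub> P"
    by (intro endo_eqI[of _ U] endo_closed endo_closed_const) (auto simp: endo_ops)
next
  fix P assume P: "P \<in> carrier (endo U)"
  then show "\<zero>\<^bsub>endo U\<^esub> \<oplus>\<^bsub>endo U\<^esub> P = P"
    by (intro endo_eqI[of _ U] endo_closed endo_closed_const) (auto simp: endo_ops)
  have "(\<lambda>V\<in>opens U. \<lambda>f\<in>holo V. \<lambda>z\<in>V. - P V f z) \<oplus>\<^bsub>endo U\<^esub> P = \<zero>\<^bsub>endo U\<^esub>"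
    using P by (intro endo_eqI[of _ U] endo_closed endo_closed_const) (auto simp: endo_ops)
  then show "\<exists>Q\<in>carrier (endo U). Q \<oplus>\<^bsub>endo U\<^esub> P = \<zero>\<^bsub>endo U\<^esub>"
    using endo_closed(3)[OF P P] by blast
qed (auto intro: endo_closed(2) endo_closed_const)

lemma ring_endo: "ring (endo U)"
proof (rule ringI[OF abelian_group_endo monoid_endo])
  fix P Q R assume *: "P \<in> carrier (endo U)" "Q \<in> carrier (endo U)" "R \<in> carrier (endo U)"
  then show "(P \<oplus>\<^bsub>endo U\<^esub> Q) \<otimes>\<^bsub>endo U\<^esub> R = P \<otimes>\<^bsub>endo U\<^esub> R \<oplus>\<^bsub>endo U\<^esub> Q \<otimes>\<^bsub>endo U\<^esub> R"
    by (intro endo_eqI[of _ U] endo_closed endo_closed_const) (auto simp: endo_ops endo_holo)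
  from * show "R \<otimes>\<^bsub>endo U\<^esub> (P \<oplus>\<^bsub>endo U\<^esub> Q) = R \<otimes>\<^bsub>endo U\<^esub> P \<oplus>\<^bsub>endo U\<^esub> R \<otimes>\<^bsub>endo U\<^esub> Q"
    by (intro endo_eqI[of _ U] endo_closed endo_closed_const) (auto simp: endo_ops endo_holo endo_add_arg)
qed

lemma op_res_endo: "P \<in> carrier (endo U) \<Longrightarrow> V \<in> opens U \<Longrightarrow> op_res V P \<in> carrier (endo V)"
  unfolding endo_def op_res_def
  by (auto dest: opens_trans simp: PiE_iff)

lemma op_res_op_res: "W \<in> opens V \<Longrightarrow> op_res W (op_res V P) = op_res W P"
  unfolding op_res_def restrict_def by (rule ext) (auto dest: opens_trans)

lemma op_res_self: "P \<in> carrier (endo U) \<Longrightarrow> op_res U P = P"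
  unfolding op_res_def endo_def by (auto simp: PiE_iff intro: extensional_restrict)

lemma op_res_hom_endo: "V \<in> opens U \<Longrightarrow> ring_hom_ring (endo U) (endo V) (op_res V)"
proof (rule ring_hom_ringI)
  assume V: "V \<in> opens U"
  then show "op_res V P \<in> carrier (endo V)" if "P \<in> carrier (endo U)" for P
    using op_res_endo that by blast
qed (auto simp: ring_endo endo_ops op_res_def restrict_def fun_eq_iff dest: opens_trans)

lemma mul_op_endo:
  assumes g: "g \<in> holo U"
  shows "mul_op U g \<in> carrier (endo U)"
  unfolding mul_op_def
proof (rule endoI)
  fix V f assume V: "V \<in> opens U" and f: "f \<in> holo V"
  have "(\<lambda>z\<in>V. restrict g V z * f z) \<in> holo V"
    using holo_mult[OF opensD(1)[OF V] holo_restrict[OF g V] f] .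
  then show "(\<lambda>z\<in>V. g z * f z) \<in> holo V"
    by (simp cong: restrict_cong)
qed (auto simp: algebra_simps dest: opensD)

lemma pd_op_eq: "pd_op U i = (\<lambda>V\<in>opens U. \<lambda>f\<in>holo V. \<lambda>z\<in>V. pderiv_at i f z)"
  by (simp add: pd_op_def pderiv_at_def)

lemma pd_op_endo: "pd_op U i \<in> carrier (endo U)"
  unfolding pd_op_eq
proof (rule endoI)
  fix V f g c z assume V: "V \<in> opens U" and fg: "f \<in> holo V" "g \<in> holo V" and z: "z \<in> V"
  have "open V" using V opensD by auto
  then have hd: "holo_diff V f" "holo_diff V g" using fg by (auto simp: holo_iff)
  show "(\<lambda>z\<in>V. pderiv_at i (\<lambda>z\<in>V. c * f z + g z) z) z
      = c * (\<lambda>z\<in>V. pderiv_at i f z) z + (\<lambda>z\<in>V. pderiv_at i g z) z"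
    using z pderiv_at_cong[OF holo_diff_lincomb[OF hd, of c], of "\<lambda>z\<in>V. c * f z + g z" z i]
      pderiv_at_lincomb[OF hd z] by simp
next
  fix V W f z assume V: "V \<in> opens U" and W: "W \<in> opens V" and f: "f \<in> holo V" and z: "z \<in> W"
  have "holo_diff W f"
    using V W f opensD by (metis holo_iff holo_diff_subset)
  then show "(\<lambda>z\<in>W. pderiv_at i (restrict f W) z) z = (\<lambda>z\<in>V. pderiv_at i f z) z"
    using z W pderiv_at_cong[of W f "restrict f W" z i] by (auto dest: opensD)
qed (auto intro: holo_pderiv opensD)

lemma op_res_mul_op: "V \<in> opens U \<Longrightarrow> op_res V (mul_op U g) = mul_op V (restrict g V)"
  by (auto simp: op_res_def mul_op_def restrict_def fun_eq_iff dest: opens_trans opensD(2))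

lemma op_res_pd_op: "V \<in> opens U \<Longrightarrow> op_res V (pd_op U i) = pd_op V i"
  by (auto simp: op_res_def pd_op_def restrict_def fun_eq_iff dest: opens_trans)

section \<open>Differential operators as sections that lie locally in the generated subring\<close>

abbreviation op_gens :: "(complex^'n::finite) set \<Rightarrow> 'n oper set" where
  "op_gens V \<equiv> mul_op V ` holo V \<union> range (pd_op V)"

lemma op_gens_endo: "op_gens V \<subseteq> carrier (endo V)"
  by (auto intro: mul_op_endo pd_op_endo)

lemma op_res_generate:
  assumes V: "V \<in> opens U" and P: "P \<in> generate_ring (endo U) (op_gens U)"
  shows "op_res V P \<in> generate_ring (endo V) (op_gens V)"
proof -
  interpret ring_hom_ring "endo U" "endo V" "op_res V"
    by (rule op_res_hom_endo[OF V])
  note closed = R.generate_ring_in_carrier[OF op_gens_endo]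
  from P show ?thesis
  proof (induction rule: generate_ring.induct)
    case (incl h)
    then have "op_res V h \<in> op_gens V"
      using V holo_restrict[OF _ V] by (auto simp: op_res_mul_op op_res_pd_op)
    then show ?case by (rule generate_ring.incl)
  qed (simp_all add: closed generate_ring.one generate_ring.a_inv generate_ring.eng_add generate_ring.eng_mult)
qed

text \<open>The pattern shared by \<open>diffop\<close>, \<open>gen_ideal_sheaf\<close> and
  \<open>sum_ideal_sheaf\<close>.\<close>

definition loc :: "((complex^'n::finite) set \<Rightarrow> 'n oper set) \<Rightarrow> (complex^'n) set \<Rightarrow> 'n oper set" where
  "loc L U = {P. \<forall>x\<in>U. \<exists>V\<in>opens U. x \<in> V \<and> op_res V P \<in> L V}"

lemma locI: "(\<And>x. x \<in> U \<Longrightarrow> \<exists>V\<in>opens U. x \<in> V \<and> op_res V P \<in> L V) \<Longrightarrow> P \<in> loc L U"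
  by (simp add: loc_def)

lemma locE:
  assumes "P \<in> loc L U" "x \<in> U"
  obtains V where "V \<in> opens U" "x \<in> V" "op_res V P \<in> L V"
  using assms by (auto simp: loc_def)

text \<open>The intersection of the two neighbourhoods serves both conditions, which is why both
  families have to be stable under restriction.\<close>

lemma loc2:
  assumes P: "P \<in> loc L U" and Q: "Q \<in> loc L' U" and x: "x \<in> U"
    and res: "\<And>V W P. V \<in> opens U \<Longrightarrow> W \<in> opens V \<Longrightarrow> P \<in> L V \<Longrightarrow> op_res W P \<in> L W"
    and res': "\<And>V W P. V \<in> opens U \<Longrightarrow> W \<in> opens V \<Longrightarrow> P \<in> L' V \<Longrightarrow> op_res W P \<in> L' W"
  obtains V where "V \<in> opens U" "x \<in> V" "op_res V P \<in> L V" "op_res V Q \<in> L' V"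
proof -
  obtain V W where V: "V \<in> opens U" "x \<in> V" "op_res V P \<in> L V"
    and W: "W \<in> opens U" "x \<in> W" "op_res W Q \<in> L' W"
    using P Q x by (auto elim!: locE)
  have o: "V \<inter> W \<in> opens V" "V \<inter> W \<in> opens W" "V \<inter> W \<in> opens U"
    using V W by (auto simp: opens_def)
  show ?thesis
    using that[of "V \<inter> W"] o V W res[OF V(1) o(1) V(3)] res'[OF W(1) o(2) W(3)]
    by (simp add: op_res_op_res)
qed

lemma carrier_diffop:
  "carrier (diffop U) = carrier (endo U) \<inter> loc (\<lambda>V. generate_ring (endo V) (op_gens V)) U"
  by (auto simp: diffop_def loc_def)

lemma subring_diffop:
  assumes U: "open U"
  shows "subring (carrier (diffop U)) (endo U)"
proof -
  interpret ring "endo U" by (rule ring_endo)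
  let ?L = "\<lambda>V. generate_ring (endo V) (op_gens V)"
  have res: "\<And>V W P. V \<in> opens U \<Longrightarrow> W \<in> opens V \<Longrightarrow> P \<in> ?L V \<Longrightarrow> op_res W P \<in> ?L W"
    by (rule op_res_generate)
  show ?thesis
  proof (rule subringI)
    show "carrier (diffop U) \<subseteq> carrier (endo U)" by (auto simp: carrier_diffop)
    have "op_res U \<one>\<^bsub>endo U\<^esub> \<in> ?L U"
      by (simp add: op_res_self generate_ring.one)
    then show "\<one>\<^bsub>endo U\<^esub> \<in> carrier (diffop U)"
      using opensI[OF U order_refl] by (auto simp: carrier_diffop loc_def)
  next
    fix P assume P: "P \<in> carrier (diffop U)"
    have "\<exists>V\<in>opens U. x \<in> V \<and> op_res V (\<ominus>\<^bsub>endo U\<^esub> P) \<in> ?L V" if x: "x \<in> U" for x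
    proof -
      obtain V where V: "V \<in> opens U" "x \<in> V" "op_res V P \<in> ?L V"
        using P x by (auto simp: carrier_diffop elim: locE)
      interpret ring_hom_ring "endo U" "endo V" "op_res V"
        by (rule op_res_hom_endo[OF V(1)])
      have "op_res V (\<ominus>\<^bsub>endo U\<^esub> P) \<in> ?L V"
        using V P by (auto simp: carrier_diffop intro: generate_ring.a_inv)
      then show ?thesis using V by blast
    qed
    then show "\<ominus>\<^bsub>endo U\<^esub> P \<in> carrier (diffop U)"
      using P by (simp add: carrier_diffop locI)
  next
    fix P Q assume PQ: "P \<in> carrier (diffop U)" "Q \<in> carrier (diffop U)"
    then have PQ': "P \<in> carrier (endo U)" "Q \<in> carrier (endo U)" "P \<in> loc ?L U" "Q \<in> loc ?L U"
      by (auto simp: carrier_diffop)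
    have "\<exists>V\<in>opens U. x \<in> V \<and> op_res V (P \<otimes>\<^bsub>endo U\<^esub> Q) \<in> ?L V \<and> op_res V (P \<oplus>\<^bsub>endo U\<^esub> Q) \<in> ?L V"
      if x: "x \<in> U" for x
    proof -
      obtain V where V: "V \<in> opens U" "x \<in> V" "op_res V P \<in> ?L V" "op_res V Q \<in> ?L V"
        by (rule loc2[OF PQ'(3,4) x res res])
      interpret ring_hom_ring "endo U" "endo V" "op_res V"
        by (rule op_res_hom_endo[OF V(1)])
      show ?thesis
        using V PQ' by (intro bexI[OF _ V(1)]) (auto intro: generate_ring.eng_mult generate_ring.eng_add)
    qed
    then show "P \<otimes>\<^bsub>endo U\<^esub> Q \<in> carrier (diffop U)" "P \<oplus>\<^bsub>endo U\<^esub> Q \<in> carrier (diffop U)"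
      using PQ' by (auto simp: carrier_diffop intro!: locI)
  qed
qed

lemma ring_diffop: "open U \<Longrightarrow> ring (diffop U)"
  using ring.subring_is_ring[OF ring_endo subring_diffop] by (simp add: diffop_def)

lemma diffop_ops:
  "mult (diffop U) = mult (endo U)" "one (diffop U) = one (endo U)"
  "zero (diffop U) = zero (endo U)" "add (diffop U) = add (endo U)"
  by (simp_all add: diffop_def)

lemma diffop_endo: "P \<in> carrier (diffop U) \<Longrightarrow> P \<in> carrier (endo U)"
  by (simp add: carrier_diffop)

lemma op_res_diffop:
  assumes P: "P \<in> carrier (diffop U)" and V: "V \<in> opens U"
  shows "op_res V P \<in> carrier (diffop V)"
proof -
  let ?L = "\<lambda>V. generate_ring (endo V) (op_gens V)"
  have "\<exists>W\<in>opens V. x \<in> W \<and> op_res W (op_res V P) \<in> ?L W" if x: "x \<in> V" for x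
  proof -
    have "x \<in> U" using x V opensD by blast
    then obtain W where W: "W \<in> opens U" "x \<in> W" "op_res W P \<in> ?L W"
      using P by (auto simp: carrier_diffop elim: locE)
    have o: "V \<inter> W \<in> opens W" "V \<inter> W \<in> opens V" using V W by (auto simp: opens_def)
    have "op_res (V \<inter> W) (op_res V P) \<in> ?L (V \<inter> W)"
      using op_res_generate[OF o(1) W(3)] by (simp add: op_res_op_res o)
    then show ?thesis using o W x by blast
  qed
  then show ?thesis
    using op_res_endo[OF diffop_endo[OF P] V] by (simp add: carrier_diffop locI)
qed

lemma op_res_hom: "open U \<Longrightarrow> V \<in> opens U \<Longrightarrow> ring_hom_ring (diffop U) (diffop V) (op_res V)"
proof (rule ring_hom_ringI)
  assume U: "open U" and V: "V \<in> opens U"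
  interpret ring_hom_ring "endo U" "endo V" "op_res V"
    by (rule op_res_hom_endo[OF V])
  show "ring (diffop U)" "ring (diffop V)"
    using U V by (auto intro: ring_diffop opensD)
  show "op_res V (P \<otimes>\<^bsub>diffop U\<^esub> Q) = op_res V P \<otimes>\<^bsub>diffop V\<^esub> op_res V Q"
    "op_res V (P \<oplus>\<^bsub>diffop U\<^esub> Q) = op_res V P \<oplus>\<^bsub>diffop V\<^esub> op_res V Q"
    if "P \<in> carrier (diffop U)" "Q \<in> carrier (diffop U)" for P Q
    using that by (auto simp: diffop_ops dest!: diffop_endo)
  show "op_res V P \<in> carrier (diffop V)" if "P \<in> carrier (diffop U)" for P
    by (rule op_res_diffop[OF that V])
  show "op_res V \<one>\<^bsub>diffop U\<^esub> = \<one>\<^bsub>diffop V\<^esub>"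
    using hom_one by (simp add: diffop_ops)
qed

lemma gens_diffop:
  assumes U: "open U" and P: "P \<in> op_gens U"
  shows "P \<in> carrier (diffop U)"
proof -
  have E: "P \<in> carrier (endo U)" using op_gens_endo P by blast
  have "op_res U P \<in> generate_ring (endo U) (op_gens U)"
    unfolding op_res_self[OF E] by (rule generate_ring.incl[OF P])
  then show ?thesis
    using E opensI[OF U order_refl] by (auto simp: carrier_diffop loc_def)
qed


section \<open>Sheaves of left ideals\<close>

lemma left_idealI:
  assumes "ring R" "I \<subseteq> carrier R" "\<zero>\<^bsub>R\<^esub> \<in> I"
    and add: "\<And>x y. x \<in> I \<Longrightarrow> y \<in> I \<Longrightarrow> x \<oplus>\<^bsub>R\<^esub> y \<in> I"
    and mult: "\<And>x a. x \<in> carrier R \<Longrightarrow> a \<in> I \<Longrightarrow> x \<otimes>\<^bsub>R\<^esub> a \<in> I"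
  shows "left_ideal I R"
proof -
  interpret ring R by fact
  have "\<ominus>\<^bsub>R\<^esub> a \<in> I" if "a \<in> I" for a
    using mult[of "\<ominus>\<^bsub>R\<^esub> \<one>\<^bsub>R\<^esub>" a] that assms(2) by (auto simp: l_minus)
  then show ?thesis
    unfolding left_ideal_def using assms
    by (auto intro!: additive_subgroup.intro add.subgroupI)
qed

lemma left_idealD:
  assumes "ring R" "left_ideal I R"
  shows left_ideal_subset: "I \<subseteq> carrier R"
    and left_ideal_zero: "\<zero>\<^bsub>R\<^esub> \<in> I"
    and left_ideal_add: "x \<in> I \<Longrightarrow> y \<in> I \<Longrightarrow> x \<oplus>\<^bsub>R\<^esub> y \<in> I"
    and left_ideal_lmult: "r \<in> carrier R \<Longrightarrow> x \<in> I \<Longrightarrow> r \<otimes>\<^bsub>R\<^esub> x \<in> I"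
    and left_ideal_uminus: "x \<in> I \<Longrightarrow> \<ominus>\<^bsub>R\<^esub> x \<in> I"
proof -
  interpret ring R by fact
  interpret additive_subgroup I R using assms(2) by (simp add: left_ideal_def)
  show "I \<subseteq> carrier R" "\<zero>\<^bsub>R\<^esub> \<in> I" by (auto intro: a_Hcarr)
  show "x \<oplus>\<^bsub>R\<^esub> y \<in> I" if "x \<in> I" "y \<in> I" using that by simp
  show "r \<otimes>\<^bsub>R\<^esub> x \<in> I" if "r \<in> carrier R" "x \<in> I" using that assms(2) by (simp add: left_ideal_def)
  then show "\<ominus>\<^bsub>R\<^esub> x \<in> I" if "x \<in> I"
    using a_inv_closed that abelian_group_axioms by blast
qed

lemma left_ideal_left_genideal:
  assumes "ring R" "S \<subseteq> carrier R"
  shows "left_ideal (left_genideal R S) R"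
proof (rule left_idealI[OF assms(1)])
  interpret ring R by fact
  have "left_ideal (carrier R) R" by (rule left_idealI[OF assms(1)]) auto
  then show "left_genideal R S \<subseteq> carrier R" using assms(2) by (auto simp: left_genideal_def)
qed (auto simp: left_genideal_def left_ideal_zero left_ideal_add left_ideal_lmult assms(1))

lemma left_genideal_incl: "S \<subseteq> left_genideal R S"
  by (auto simp: left_genideal_def)

lemma left_genideal_min: "left_ideal I R \<Longrightarrow> S \<subseteq> I \<Longrightarrow> left_genideal R S \<subseteq> I"
  by (auto simp: left_genideal_def)

lemma ring_hom_a_minus:
  assumes "ring_hom_ring R S h" "x \<in> carrier R" "y \<in> carrier R"
  shows "h (x \<ominus>\<^bsub>R\<^esub> y) = h x \<ominus>\<^bsub>S\<^esub> h y"
proof -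
  interpret ring_hom_ring R S h by fact
  show ?thesis using assms(2,3) by (simp add: a_minus_def)
qed

locale ideal_presheaf =
  fixes L :: "'n::finite ideal_sheaf"
  assumes left_ideal: "open U \<Longrightarrow> left_ideal (L U) (diffop U)"
    and res: "open U \<Longrightarrow> V \<in> opens U \<Longrightarrow> P \<in> L U \<Longrightarrow> op_res V P \<in> L V"
begin

lemma subset: "open U \<Longrightarrow> P \<in> L U \<Longrightarrow> P \<in> carrier (diffop U)"
  using left_ideal_subset[OF ring_diffop left_ideal] by blast

lemma zero: "open U \<Longrightarrow> \<zero>\<^bsub>diffop U\<^esub> \<in> L U"
  using left_ideal_zero[OF ring_diffop left_ideal] by blast

lemma add: "open U \<Longrightarrow> P \<in> L U \<Longrightarrow> Q \<in> L U \<Longrightarrow> P \<oplus>\<^bsub>diffop U\<^esub> Q \<in> L U"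
  using left_ideal_add[OF ring_diffop left_ideal] by blast

lemma lmult: "open U \<Longrightarrow> R \<in> carrier (diffop U) \<Longrightarrow> P \<in> L U \<Longrightarrow> R \<otimes>\<^bsub>diffop U\<^esub> P \<in> L U"
  using left_ideal_lmult[OF ring_diffop left_ideal] by blast

lemma uminus: "open U \<Longrightarrow> P \<in> L U \<Longrightarrow> \<ominus>\<^bsub>diffop U\<^esub> P \<in> L U"
  using left_ideal_uminus[OF ring_diffop left_ideal] by blast

end

locale ideal_sheaf = ideal_presheaf +
  assumes glue: "open U \<Longrightarrow> P \<in> carrier (diffop U) \<Longrightarrow> P \<in> loc L U \<Longrightarrow> P \<in> L U"

lemma res_loc:
  assumes res: "\<And>U V P. open U \<Longrightarrow> V \<in> opens U \<Longrightarrow> P \<in> L U \<Longrightarrow> op_res V P \<in> L V"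
    and V: "V \<in> opens U" and P: "P \<in> loc L U"
  shows "op_res V P \<in> loc L V"
proof (rule locI)
  fix x assume x: "x \<in> V"
  then have "x \<in> U" using V opensD by blast
  then obtain W where W: "W \<in> opens U" "x \<in> W" "op_res W P \<in> L W"
    using P by (auto elim: locE)
  have o: "V \<inter> W \<in> opens W" "V \<inter> W \<in> opens V" using V W by (auto simp: opens_def)
  have "op_res (V \<inter> W) (op_res V P) \<in> L (V \<inter> W)"
    using res[OF opensD(1)[OF W(1)] o(1) W(3)] by (simp add: op_res_op_res o)
  then show "\<exists>W\<in>opens V. x \<in> W \<and> op_res W (op_res V P) \<in> L W"
    using o W x by blast
qed

text \<open>Sheafification inside the ring of operators. Sums are tested on common smaller
  neighbourhoods, and gluing holds because a condition that holds locally in the local sense holds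
  locally.\<close>

lemma ideal_sheaf_loc:
  assumes "ideal_presheaf L"
  shows "ideal_sheaf (\<lambda>U. carrier (diffop U) \<inter> loc L U)"
proof -
  interpret ideal_presheaf L by fact
  show ?thesis
  proof unfold_locales
    fix U :: "(complex^'a) set" assume U: "open U"
    interpret ring "diffop U" by (rule ring_diffop[OF U])
    show "left_ideal (carrier (diffop U) \<inter> loc L U) (diffop U)"
    proof (rule left_idealI[OF ring_diffop[OF U]])
      show "\<zero>\<^bsub>diffop U\<^esub> \<in> carrier (diffop U) \<inter> loc L U"
      proof
        have "op_res U \<zero>\<^bsub>diffop U\<^esub> \<in> L U"
          using op_res_self[OF diffop_endo[OF zero_closed]] zero[OF U] by simp
        then show "\<zero>\<^bsub>diffop U\<^esub> \<in> loc L U"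
          using opensI[OF U order_refl] by (intro locI) auto
      qed simp
    next
      fix P Q assume PQ: "P \<in> carrier (diffop U) \<inter> loc L U" "Q \<in> carrier (diffop U) \<inter> loc L U"
      have "P \<oplus>\<^bsub>diffop U\<^esub> Q \<in> loc L U"
      proof (rule locI)
        fix x assume x: "x \<in> U"
        obtain V where V: "V \<in> opens U" "x \<in> V" "op_res V P \<in> L V" "op_res V Q \<in> L V"
          by (rule loc2[OF IntD2[OF PQ(1)] IntD2[OF PQ(2)] x]) (auto intro: res dest: opensD)
        interpret H: ring_hom_ring "diffop U" "diffop V" "op_res V"
          by (rule op_res_hom[OF U V(1)])
        have "op_res V (P \<oplus>\<^bsub>diffop U\<^esub> Q) \<in> L V"
          using V PQ H.hom_add[of P Q] add[OF opensD(1)[OF V(1)] V(3,4)] by simp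
        then show "\<exists>V\<in>opens U. x \<in> V \<and> op_res V (P \<oplus>\<^bsub>diffop U\<^esub> Q) \<in> L V"
          using V by blast
      qed
      then show "P \<oplus>\<^bsub>diffop U\<^esub> Q \<in> carrier (diffop U) \<inter> loc L U"
        using PQ a_closed[of P Q] by blast
    next
      fix R P assume R: "R \<in> carrier (diffop U)" and P: "P \<in> carrier (diffop U) \<inter> loc L U"
      have "R \<otimes>\<^bsub>diffop U\<^esub> P \<in> loc L U"
      proof (rule locI)
        fix x assume x: "x \<in> U"
        obtain V where V: "V \<in> opens U" "x \<in> V" "op_res V P \<in> L V"
          using P x by (auto elim: locE)
        interpret H: ring_hom_ring "diffop U" "diffop V" "op_res V"
          by (rule op_res_hom[OF U V(1)])
        have "op_res V (R \<otimes>\<^bsub>diffop U\<^esub> P) \<in> L V"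
          using R P H.hom_mult[of R P] lmult[OF opensD(1)[OF V(1)] op_res_diffop[OF R V(1)] V(3)] by simp
        then show "\<exists>V\<in>opens U. x \<in> V \<and> op_res V (R \<otimes>\<^bsub>diffop U\<^esub> P) \<in> L V"
          using V by blast
      qed
      then show "R \<otimes>\<^bsub>diffop U\<^esub> P \<in> carrier (diffop U) \<inter> loc L U"
        using R P m_closed[of R P] by blast
    qed simp
  next
    fix U V :: "(complex^'a) set" and P assume "open U" "V \<in> opens U" "P \<in> carrier (diffop U) \<inter> loc L U"
    moreover from this have "op_res V P \<in> loc L V"
      by (intro res_loc[of L V U P]) (auto intro: res)
    ultimately show "op_res V P \<in> carrier (diffop V) \<inter> loc L V"
      by (auto intro: op_res_diffop)
  next
    fix U :: "(complex^'a) set" and P assume P: "open U" "P \<in> carrier (diffop U)"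
      "P \<in> loc (\<lambda>U. carrier (diffop U) \<inter> loc L U) U"
    have "P \<in> loc L U"
    proof (rule locI)
      fix x assume "x \<in> U"
      then obtain V where V: "V \<in> opens U" "x \<in> V" "op_res V P \<in> loc L V"
        using P(3) by (auto elim: locE)
      obtain W where W: "W \<in> opens V" "x \<in> W" "op_res W (op_res V P) \<in> L W"
        using V by (auto elim: locE)
      then show "\<exists>W\<in>opens U. x \<in> W \<and> op_res W P \<in> L W"
        using opens_trans[OF W(1) V(1)] by (auto simp: op_res_op_res)
    qed
    then show "P \<in> carrier (diffop U) \<inter> loc L U"
      using P by blast
  qed
qed

lemma gen_ideal_sheaf_loc:
  "gen_ideal_sheaf G = (\<lambda>U. carrier (diffop U) \<inter> loc (\<lambda>V. left_genideal (diffop V) (op_res V ` G)) U)"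
  by (auto simp: gen_ideal_sheaf_def loc_def fun_eq_iff)

lemma sum_ideal_sheaf_loc:
  "sum_ideal_sheaf I J = (\<lambda>U. carrier (diffop U) \<inter> loc (\<lambda>V. I V <+>\<^bsub>diffop V\<^esub> J V) U)"
  by (auto simp: sum_ideal_sheaf_def loc_def fun_eq_iff)

lemma op_res_image_diffop: "G \<subseteq> carrier DN \<Longrightarrow> open U \<Longrightarrow> op_res U ` G \<subseteq> carrier (diffop U)"
  by (auto intro!: op_res_diffop simp: opens_def)

lemma ideal_presheaf_left_genideal:
  assumes G: "G \<subseteq> carrier DN"
  shows "ideal_presheaf (\<lambda>V. left_genideal (diffop V) (op_res V ` G))"
proof
  fix U :: "(complex^'a) set" assume U: "open U"
  show lid: "left_ideal (left_genideal (diffop U) (op_res U ` G)) (diffop U)"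
    by (rule left_ideal_left_genideal[OF ring_diffop[OF U] op_res_image_diffop[OF G U]])
  fix V P assume V: "V \<in> opens U" and P: "P \<in> left_genideal (diffop U) (op_res U ` G)"
  have oV: "open V" using V opensD by blast
  let ?gV = "left_genideal (diffop V) (op_res V ` G)"
  have lidV: "left_ideal ?gV (diffop V)"
    by (rule left_ideal_left_genideal[OF ring_diffop[OF oV] op_res_image_diffop[OF G oV]])
  interpret H: ring_hom_ring "diffop U" "diffop V" "op_res V"
    by (rule op_res_hom[OF U V])
  \<comment> \<open>The sections whose restriction falls into the ideal over \<open>V\<close> form a
    left ideal containing the generators, and hence all of the generated ideal.\<close>
  let ?K = "{P \<in> carrier (diffop U). op_res V P \<in> ?gV}"
  note gV = left_idealD[OF H.S.ring_axioms lidV]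
  have "left_ideal ?K (diffop U)"
  proof (rule left_idealI[OF H.R.ring_axioms])
    show "\<zero>\<^bsub>diffop U\<^esub> \<in> ?K"
      using gV(2) H.hom_zero H.R.zero_closed by (simp)
    show "P \<oplus>\<^bsub>diffop U\<^esub> Q \<in> ?K" if "P \<in> ?K" "Q \<in> ?K" for P Q
      using gV(3) that by (simp)
    show "R \<otimes>\<^bsub>diffop U\<^esub> P \<in> ?K" if "R \<in> carrier (diffop U)" "P \<in> ?K" for R P
      using gV(4) that by (simp)
  qed blast
  moreover have "op_res U ` G \<subseteq> ?K"
    using op_res_image_diffop[OF G U] left_genideal_incl[of "op_res V ` G" "diffop V"] V
    by (auto simp: op_res_op_res)
  ultimately show "op_res V P \<in> ?gV"
    using left_genideal_min P by blast
qed

lemma ideal_sheaf_gen: "G \<subseteq> carrier DN \<Longrightarrow> ideal_sheaf (gen_ideal_sheaf G)"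
  unfolding gen_ideal_sheaf_loc by (intro ideal_sheaf_loc ideal_presheaf_left_genideal)

lemma op_res_DN: "P \<in> carrier DN \<Longrightarrow> op_res UNIV P = P"
  by (rule op_res_self[OF diffop_endo])

lemma UNIV_opens: "UNIV \<in> opens UNIV"
  by (simp add: opens_def)

lemma gen_ideal_sheaf_incl:
  assumes "G \<subseteq> carrier DN" "P \<in> G"
  shows "P \<in> gen_ideal_sheaf G UNIV"
proof -
  have "op_res UNIV P \<in> left_genideal DN (op_res UNIV ` G)"
    using left_genideal_incl[of "op_res UNIV ` G" DN] assms by blast
  then show ?thesis
    unfolding gen_ideal_sheaf_loc using assms UNIV_opens by (auto simp: loc_def)
qed

text \<open>Reduces an inclusion of ideal sheaves to global generators. The inclusion first holds on
  small sets, and gluing in \<open>J\<close> extends it to \<open>U\<close>.\<close>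

lemma gen_ideal_sheaf_min:
  assumes J: "ideal_sheaf J" and G: "G \<subseteq> J UNIV" and U: "open U"
  shows "gen_ideal_sheaf G U \<subseteq> J U"
proof
  interpret ideal_sheaf J by fact
  fix P assume P: "P \<in> gen_ideal_sheaf G U"
  have "P \<in> loc J U"
  proof (rule locI)
    fix x assume "x \<in> U"
    then obtain V where V: "V \<in> opens U" "x \<in> V" "op_res V P \<in> left_genideal (diffop V) (op_res V ` G)"
      using P by (auto simp: gen_ideal_sheaf_loc elim: locE)
    have oV: "open V" using V opensD by blast
    have "left_genideal (diffop V) (op_res V ` G) \<subseteq> J V"
      using G oV by (intro left_genideal_min left_ideal) (auto intro!: res[of UNIV] simp: opens_def)
    then show "\<exists>V\<in>opens U. x \<in> V \<and> op_res V P \<in> J V" using V by blast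
  qed
  then show "P \<in> J U" using P glue U by (auto simp: gen_ideal_sheaf_loc)
qed

lemma ideal_presheaf_sum:
  assumes "ideal_sheaf I" "ideal_sheaf J"
  shows "ideal_presheaf (\<lambda>V. I V <+>\<^bsub>diffop V\<^esub> J V)"
proof -
  interpret I: ideal_sheaf I by fact
  interpret J: ideal_sheaf J by fact
  show ?thesis
  proof
    fix U :: "(complex^'a) set" assume U: "open U"
    interpret ring "diffop U" by (rule ring_diffop[OF U])
    note IJ = I.subset[OF U] J.subset[OF U]
    show "left_ideal (I U <+>\<^bsub>diffop U\<^esub> J U) (diffop U)"
    proof (rule left_idealI[OF ring_axioms])
      show "I U <+>\<^bsub>diffop U\<^esub> J U \<subseteq> carrier (diffop U)"
        using IJ a_closed unfolding set_add_def' by blast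
      show "\<zero>\<^bsub>diffop U\<^esub> \<in> I U <+>\<^bsub>diffop U\<^esub> J U"
        using I.zero[OF U] J.zero[OF U] l_zero[OF zero_closed] unfolding set_add_def' by force
    next
      fix x y assume "x \<in> I U <+>\<^bsub>diffop U\<^esub> J U" "y \<in> I U <+>\<^bsub>diffop U\<^esub> J U"
      then obtain a b a' b' where ab: "a \<in> I U" "b \<in> J U" "a' \<in> I U" "b' \<in> J U"
        and xy: "x = a \<oplus>\<^bsub>diffop U\<^esub> b" "y = a' \<oplus>\<^bsub>diffop U\<^esub> b'"
        unfolding set_add_def' by blast
      have "x \<oplus>\<^bsub>diffop U\<^esub> y = (a \<oplus>\<^bsub>diffop U\<^esub> a') \<oplus>\<^bsub>diffop U\<^esub> (b \<oplus>\<^bsub>diffop U\<^esub> b')"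
        using ab IJ by (simp add: xy a_ac)
      then show "x \<oplus>\<^bsub>diffop U\<^esub> y \<in> I U <+>\<^bsub>diffop U\<^esub> J U"
        using I.add[OF U ab(1,3)] J.add[OF U ab(2,4)] unfolding set_add_def' by blast
    next
      fix r x assume r: "r \<in> carrier (diffop U)" and "x \<in> I U <+>\<^bsub>diffop U\<^esub> J U"
      then obtain a b where ab: "a \<in> I U" "b \<in> J U" and x: "x = a \<oplus>\<^bsub>diffop U\<^esub> b"
        unfolding set_add_def' by blast
      have "r \<otimes>\<^bsub>diffop U\<^esub> x = (r \<otimes>\<^bsub>diffop U\<^esub> a) \<oplus>\<^bsub>diffop U\<^esub> (r \<otimes>\<^bsub>diffop U\<^esub> b)"
        using ab IJ r by (simp add: x r_distr)
      then show "r \<otimes>\<^bsub>diffop U\<^esub> x \<in> I U <+>\<^bsub>diffop U\<^esub> J U"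
        using I.lmult[OF U r ab(1)] J.lmult[OF U r ab(2)] unfolding set_add_def' by blast
    qed
    fix V P assume V: "V \<in> opens U" and "P \<in> I U <+>\<^bsub>diffop U\<^esub> J U"
    then obtain a b where ab: "a \<in> I U" "b \<in> J U" and P: "P = a \<oplus>\<^bsub>diffop U\<^esub> b"
      unfolding set_add_def' by blast
    interpret H: ring_hom_ring "diffop U" "diffop V" "op_res V"
      by (rule op_res_hom[OF U V])
    have "op_res V P = op_res V a \<oplus>\<^bsub>diffop V\<^esub> op_res V b"
      using ab IJ by (simp add: P)
    then show "op_res V P \<in> I V <+>\<^bsub>diffop V\<^esub> J V"
      using I.res[OF U V ab(1)] J.res[OF U V ab(2)] unfolding set_add_def' by blast
  qed
qed

lemma ideal_sheaf_sum: "ideal_sheaf I \<Longrightarrow> ideal_sheaf J \<Longrightarrow> ideal_sheaf (sum_ideal_sheaf I J)"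
  unfolding sum_ideal_sheaf_loc by (intro ideal_sheaf_loc ideal_presheaf_sum)

lemma sum_ideal_sheaf_incl:
  assumes "ideal_sheaf I" "ideal_sheaf J"
  shows "I UNIV \<subseteq> sum_ideal_sheaf I J UNIV" "J UNIV \<subseteq> sum_ideal_sheaf I J UNIV"
proof -
  interpret I: ideal_sheaf I by fact
  interpret J: ideal_sheaf J by fact
  interpret ring DN by (rule ring_diffop) simp
  have *: "P \<in> sum_ideal_sheaf I J UNIV" if "P \<in> carrier DN" "P \<in> I UNIV <+>\<^bsub>DN\<^esub> J UNIV" for P
    using that UNIV_opens op_res_DN[of P] unfolding sum_ideal_sheaf_loc by (auto simp: loc_def)
  show "I UNIV \<subseteq> sum_ideal_sheaf I J UNIV"
  proof
    fix P assume P: "P \<in> I UNIV"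
    then have "P \<in> carrier DN" using I.subset by blast
    moreover have "P = P \<oplus>\<^bsub>DN\<^esub> \<zero>\<^bsub>DN\<^esub>" using calculation by (simp)
    ultimately show "P \<in> sum_ideal_sheaf I J UNIV"
      using * P J.zero[of UNIV] unfolding set_add_def' by blast
  qed
  show "J UNIV \<subseteq> sum_ideal_sheaf I J UNIV"
  proof
    fix P assume P: "P \<in> J UNIV"
    then have "P \<in> carrier DN" using J.subset by blast
    moreover have "P = \<zero>\<^bsub>DN\<^esub> \<oplus>\<^bsub>DN\<^esub> P" using calculation by (simp)
    ultimately show "P \<in> sum_ideal_sheaf I J UNIV"
      using * P I.zero[of UNIV] unfolding set_add_def' by blast
  qed
qed

lemma sum_ideal_sheaf_min:
  assumes K: "ideal_sheaf K" and I: "\<And>V. open V \<Longrightarrow> I V \<subseteq> K V" and J: "\<And>V. open V \<Longrightarrow> J V \<subseteq> K V"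
    and U: "open U"
  shows "sum_ideal_sheaf I J U \<subseteq> K U"
proof
  interpret ideal_sheaf K by fact
  fix P assume P: "P \<in> sum_ideal_sheaf I J U"
  have "P \<in> loc K U"
  proof (rule locI)
    fix x assume "x \<in> U"
    then obtain V where V: "V \<in> opens U" "x \<in> V" "op_res V P \<in> I V <+>\<^bsub>diffop V\<^esub> J V"
      using P by (auto simp: sum_ideal_sheaf_loc elim: locE)
    have oV: "open V" using V opensD by blast
    obtain a b where ab: "a \<in> I V" "b \<in> J V" "op_res V P = a \<oplus>\<^bsub>diffop V\<^esub> b"
      using V(3) by (auto simp: set_add_def')
    have "op_res V P \<in> K V"
      unfolding ab(3) by (rule add[OF oV subsetD[OF I[OF oV] ab(1)] subsetD[OF J[OF oV] ab(2)]])
    then show "\<exists>V\<in>opens U. x \<in> V \<and> op_res V P \<in> K V" using V by blast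
  qed
  then show "P \<in> K U" using P glue U by (auto simp: sum_ideal_sheaf_loc)
qed

text \<open>The ideal quotient of \<open>J\<close> by \<open>R\<close>. Because it is an ideal
  sheaf, the claim that right multiplication by \<open>R\<close> maps one ideal sheaf into another
  can be tested on generators through the minimality lemmas.\<close>

lemma ideal_sheaf_colon:
  assumes "ideal_sheaf J" and R: "R \<in> carrier DN"
  shows "ideal_sheaf (\<lambda>U. {P \<in> carrier (diffop U). P \<otimes>\<^bsub>diffop U\<^esub> op_res U R \<in> J U})"
proof -
  interpret ideal_sheaf J by fact
  have R': "op_res U R \<in> carrier (diffop U)" if "open U" for U
    using op_res_diffop[OF R] that by (simp add: opens_def)
  have res_mult: "op_res V (P \<otimes>\<^bsub>diffop U\<^esub> op_res U R) = op_res V P \<otimes>\<^bsub>diffop V\<^esub> op_res V R"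
    if "open U" "V \<in> opens U" "P \<in> carrier (diffop U)" for U V P
  proof -
    interpret H: ring_hom_ring "diffop U" "diffop V" "op_res V"
      by (rule op_res_hom[OF that(1,2)])
    show ?thesis
      using that R' by (simp add: op_res_op_res)
  qed
  show ?thesis
  proof unfold_locales
    fix U :: "(complex^'a) set" assume U: "open U"
    interpret ring "diffop U" by (rule ring_diffop[OF U])
    show "left_ideal {P \<in> carrier (diffop U). P \<otimes>\<^bsub>diffop U\<^esub> op_res U R \<in> J U} (diffop U)"
      by (rule left_idealI[OF ring_axioms])
         (use R'[OF U] zero[OF U] add[OF U] lmult[OF U] in \<open>auto simp: l_distr m_assoc\<close>)
  next
    fix U V :: "(complex^'a) set" and P
    assume "open U" "V \<in> opens U" "P \<in> {P \<in> carrier (diffop U). P \<otimes>\<^bsub>diffop U\<^esub> op_res U R \<in> J U}"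
    then show "op_res V P \<in> {P \<in> carrier (diffop V). P \<otimes>\<^bsub>diffop V\<^esub> op_res V R \<in> J V}"
      using res[of U V "P \<otimes>\<^bsub>diffop U\<^esub> op_res U R"] res_mult[of U V P] by (auto intro: op_res_diffop)
  next
    fix U :: "(complex^'a) set" and P
    assume U: "open U" and P: "P \<in> carrier (diffop U)"
      and lP: "P \<in> loc (\<lambda>U. {P \<in> carrier (diffop U). P \<otimes>\<^bsub>diffop U\<^esub> op_res U R \<in> J U}) U"
    interpret ring "diffop U" by (rule ring_diffop[OF U])
    have "P \<otimes>\<^bsub>diffop U\<^esub> op_res U R \<in> J U"
    proof (rule glue[OF U])
      show "P \<otimes>\<^bsub>diffop U\<^esub> op_res U R \<in> loc J U"
      proof (rule locI)
        fix x assume "x \<in> U"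
        then obtain V where "V \<in> opens U" "x \<in> V" "op_res V P \<otimes>\<^bsub>diffop V\<^esub> op_res V R \<in> J V"
          using lP by (auto elim: locE)
        then show "\<exists>V\<in>opens U. x \<in> V \<and> op_res V (P \<otimes>\<^bsub>diffop U\<^esub> op_res U R) \<in> J V"
          using res_mult[OF U _ P] by (auto)
      qed
    qed (use P R'[OF U] in \<open>simp\<close>)
    then show "P \<in> {P \<in> carrier (diffop U). P \<otimes>\<^bsub>diffop U\<^esub> op_res U R \<in> J U}"
      using P by simp
  qed
qed


section \<open>Right multiplication between quotients\<close>

lemma op_res_a_minus:
  assumes "open V" "Z \<in> opens V" "P \<in> carrier (diffop V)" "Q \<in> carrier (diffop V)"
  shows "op_res Z (P \<ominus>\<^bsub>diffop V\<^esub> Q) = op_res Z P \<ominus>\<^bsub>diffop Z\<^esub> op_res Z Q"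
  by (rule ring_hom_a_minus[OF op_res_hom[OF assms(1,2)] assms(3,4)])

lemma op_res_mult:
  assumes "open V" "Z \<in> opens V" "P \<in> carrier (diffop V)" "Q \<in> carrier (diffop V)"
  shows "op_res Z (P \<otimes>\<^bsub>diffop V\<^esub> Q) = op_res Z P \<otimes>\<^bsub>diffop Z\<^esub> op_res Z Q"
proof -
  interpret ring_hom_ring "diffop V" "diffop Z" "op_res Z" by (rule op_res_hom[OF assms(1,2)])
  show ?thesis using assms(3,4) by simp
qed

lemma op_res_add:
  assumes "open V" "Z \<in> opens V" "P \<in> carrier (diffop V)" "Q \<in> carrier (diffop V)"
  shows "op_res Z (P \<oplus>\<^bsub>diffop V\<^esub> Q) = op_res Z P \<oplus>\<^bsub>diffop Z\<^esub> op_res Z Q"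
proof -
  interpret ring_hom_ring "diffop V" "diffop Z" "op_res Z" by (rule op_res_hom[OF assms(1,2)])
  show ?thesis using assms(3,4) by simp
qed

text \<open>Stalk elements are computed on such representatives throughout; the side conditions on
  \<open>V\<close> and \<open>P\<close> travel with the class.\<close>

definition represents ::
  "'n::finite ideal_sheaf \<Rightarrow> complex^'n \<Rightarrow> (complex^'n) set \<Rightarrow> 'n oper \<Rightarrow> 'n stalk_class \<Rightarrow> bool" where
  "represents J x V P c \<longleftrightarrow> open V \<and> x \<in> V \<and> P \<in> carrier (diffop V) \<and> c = germ_class J x V P"

definition germ_rel ::
  "'n::finite ideal_sheaf \<Rightarrow> complex^'n \<Rightarrow> (complex^'n) set \<Rightarrow> 'n oper \<Rightarrow> (complex^'n) set \<Rightarrow> 'n oper \<Rightarrow> bool"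
  where "germ_rel J x V P W Q \<longleftrightarrow>
    (\<exists>Z\<in>opens (V \<inter> W). x \<in> Z \<and> op_res Z P \<ominus>\<^bsub>diffop Z\<^esub> op_res Z Q \<in> J Z)"

lemma germ_class_iff:
  "(W, Q) \<in> germ_class J x V P \<longleftrightarrow> open W \<and> x \<in> W \<and> Q \<in> carrier (diffop W) \<and> germ_rel J x V P W Q"
  by (auto simp: germ_class_def germ_rel_def)

context ideal_sheaf
begin

lemma germ_rel_refl:
  assumes "open V" "x \<in> V" "P \<in> carrier (diffop V)"
  shows "germ_rel L x V P V P"
proof -
  interpret ring "diffop V" by (rule ring_diffop[OF assms(1)])
  have "op_res V P \<ominus>\<^bsub>diffop V\<^esub> op_res V P \<in> L V"
    using assms(3) zero[OF assms(1)] op_res_self[OF diffop_endo[OF assms(3)]] by (simp add: a_minus_def r_neg)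
  then show ?thesis
    using assms by (auto simp: germ_rel_def opens_def)
qed

lemma germ_rel_sym:
  assumes "germ_rel L x V P W Q" "P \<in> carrier (diffop V)" "Q \<in> carrier (diffop W)"
  shows "germ_rel L x W Q V P"
proof -
  obtain Z where Z: "Z \<in> opens (V \<inter> W)" "x \<in> Z" "op_res Z P \<ominus>\<^bsub>diffop Z\<^esub> op_res Z Q \<in> L Z"
    using assms(1) by (auto simp: germ_rel_def)
  have o: "Z \<in> opens V" "Z \<in> opens W" "Z \<in> opens (W \<inter> V)" "open Z" using Z(1) by (auto simp: opens_def)
  interpret ring "diffop Z" by (rule ring_diffop[OF o(4)])
  have "op_res Z Q \<ominus>\<^bsub>diffop Z\<^esub> op_res Z P = \<ominus>\<^bsub>diffop Z\<^esub> (op_res Z P \<ominus>\<^bsub>diffop Z\<^esub> op_res Z Q)"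
    using op_res_diffop[OF assms(2) o(1)] op_res_diffop[OF assms(3) o(2)]
    by (simp add: a_minus_def minus_add a_comm)
  then show ?thesis
    unfolding germ_rel_def using uminus[OF o(4) Z(3)] Z(2) o(3) by (intro bexI[of _ Z]) auto
qed

lemma germ_rel_trans:
  assumes "germ_rel L x V P W Q" "germ_rel L x W Q Y R"
    and c: "P \<in> carrier (diffop V)" "Q \<in> carrier (diffop W)" "R \<in> carrier (diffop Y)"
  shows "germ_rel L x V P Y R"
proof -
  obtain Z where Z: "Z \<in> opens (V \<inter> W)" "x \<in> Z" "op_res Z P \<ominus>\<^bsub>diffop Z\<^esub> op_res Z Q \<in> L Z"
    using assms(1) by (auto simp: germ_rel_def)
  obtain Z' where Z': "Z' \<in> opens (W \<inter> Y)" "x \<in> Z'" "op_res Z' Q \<ominus>\<^bsub>diffop Z'\<^esub> op_res Z' R \<in> L Z'"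
    using assms(2) by (auto simp: germ_rel_def)
  let ?Z = "Z \<inter> Z'"
  have o: "Z \<in> opens V" "Z \<in> opens W" "Z' \<in> opens W" "Z' \<in> opens Y" "?Z \<in> opens Z" "?Z \<in> opens Z'"
    "?Z \<in> opens V" "?Z \<in> opens W" "?Z \<in> opens Y" "?Z \<in> opens (V \<inter> Y)" "open Z" "open Z'" "open ?Z"
    using Z(1) Z'(1) by (auto simp: opens_def)
  note c' = op_res_diffop[OF c(1) o(1)] op_res_diffop[OF c(2) o(2)]
    op_res_diffop[OF c(2) o(3)] op_res_diffop[OF c(3) o(4)]
  note c'' = op_res_diffop[OF c(1) o(7)] op_res_diffop[OF c(2) o(8)] op_res_diffop[OF c(3) o(9)]
  interpret ring "diffop ?Z" by (rule ring_diffop[OF o(13)])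
  have 1: "op_res ?Z P \<ominus>\<^bsub>diffop ?Z\<^esub> op_res ?Z Q \<in> L ?Z"
    using res[OF o(11,5) Z(3)] by (simp add: op_res_a_minus[OF o(11,5) c'(1,2)] op_res_op_res o(5))
  have 2: "op_res ?Z Q \<ominus>\<^bsub>diffop ?Z\<^esub> op_res ?Z R \<in> L ?Z"
    using res[OF o(12,6) Z'(3)] by (simp add: op_res_a_minus[OF o(12,6) c'(3,4)] op_res_op_res o(6))
  have "op_res ?Z P \<ominus>\<^bsub>diffop ?Z\<^esub> op_res ?Z R =
    (op_res ?Z P \<ominus>\<^bsub>diffop ?Z\<^esub> op_res ?Z Q) \<oplus>\<^bsub>diffop ?Z\<^esub> (op_res ?Z Q \<ominus>\<^bsub>diffop ?Z\<^esub> op_res ?Z R)"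
    using c'' by (simp add: a_minus_def a_assoc l_neg r_neg1)
  then show ?thesis
    unfolding germ_rel_def using add[OF o(13) 1 2] Z(2) Z'(2) o(10) by (intro bexI[of _ ?Z]) auto
qed

lemma germ_class_eq:
  assumes "germ_rel L x V P W Q" "P \<in> carrier (diffop V)" "Q \<in> carrier (diffop W)"
  shows "germ_class L x V P = germ_class L x W Q"
proof -
  have "(Y, R) \<in> germ_class L x V P \<longleftrightarrow> (Y, R) \<in> germ_class L x W Q" for Y R
    unfolding germ_class_iff
    using germ_rel_trans[of x V P W Q Y R] germ_rel_trans[of x W Q V P Y R] germ_rel_sym[of x V P W Q] assms
    by blast
  then show ?thesis by auto
qed

lemma representsD:
  assumes "represents L x V P c"
  shows "(V, P) \<in> c"
    and "(W, Q) \<in> c \<Longrightarrow> represents L x W Q c"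
    and "(W, Q) \<in> c \<Longrightarrow> germ_rel L x W Q V P"
proof -
  show "(V, P) \<in> c"
    using assms germ_rel_refl by (simp add: represents_def germ_class_iff)
  assume "(W, Q) \<in> c"
  then have Q: "open W" "x \<in> W" "Q \<in> carrier (diffop W)" "germ_rel L x V P W Q"
    using assms by (auto simp: represents_def germ_class_iff)
  then show "germ_rel L x W Q V P"
    using assms germ_rel_sym by (auto simp: represents_def)
  show "represents L x W Q c"
    using Q assms germ_class_eq by (auto simp: represents_def)
qed

lemma represents_refine:
  assumes "represents L x V P c" "(W, Q) \<in> c"
  obtains Z where "Z \<in> opens V" "Z \<in> opens W" "x \<in> Z" "open Z"
    "op_res Z Q \<ominus>\<^bsub>diffop Z\<^esub> op_res Z P \<in> L Z"
  using representsD(3)[OF assms] unfolding germ_rel_def opens_def by auto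

lemma germ_class_cong:
  assumes "open V" "open W" "Z \<in> opens V" "Z \<in> opens W" "x \<in> Z"
    and "P \<in> carrier (diffop V)" "Q \<in> carrier (diffop W)"
    and "op_res Z P \<ominus>\<^bsub>diffop Z\<^esub> op_res Z Q \<in> L Z"
  shows "germ_class L x V P = germ_class L x W Q"
  using assms by (intro germ_class_eq) (auto simp: germ_rel_def opens_def)

lemma sects_represents:
  assumes "s \<in> sects (quot_module L) U" "x \<in> U"
  obtains V P where "V \<in> opens U" "x \<in> V" "P \<in> carrier (diffop V)"
    "\<And>y. y \<in> V \<Longrightarrow> represents L y V P (s y)"
proof -
  have "\<exists>V\<in>opens U. x \<in> V \<and> (\<exists>P\<in>carrier (diffop V). \<forall>y\<in>V. s y = germ_class L y V P)"
    using assms by (simp add: quot_module_def)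
  then obtain V P where "V \<in> opens U" "x \<in> V" "P \<in> carrier (diffop V)" "\<forall>y\<in>V. s y = germ_class L y V P"
    by blast
  then show ?thesis
    by (intro that[of V P]) (auto simp: represents_def dest: opensD)
qed

text \<open>The operations of the quotient are unions over all representatives. A class is nonempty
  by \<open>representsD(1)\<close>, so a constant contribution is the value of the union.\<close>

lemma UN_represents:
  assumes "represents L x V P c" "\<And>W Q. (W, Q) \<in> c \<Longrightarrow> h W Q = d"
  shows "(\<Union>(W, Q)\<in>c. h W Q) = d"
  using representsD(1)[OF assms(1)] assms(2) by fastforce

text \<open>Independence of the representatives: on a common neighbourhood the difference of the two
  sums is the sum of two differences lying in \<open>L\<close>.\<close>

lemma madd_represents:
  assumes x: "x \<in> U" and P: "represents L x V P (s x)" and Q: "represents L x W Q (t x)"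
  shows "represents L x (V \<inter> W) (op_res (V \<inter> W) P \<oplus>\<^bsub>diffop (V \<inter> W)\<^esub> op_res (V \<inter> W) Q)
    (madd (quot_module L) U s t x)"
proof -
  let ?g = "\<lambda>V P W Q. germ_class L x (V \<inter> W) (op_res (V \<inter> W) P \<oplus>\<^bsub>diffop (V \<inter> W)\<^esub> op_res (V \<inter> W) Q)"
  have c: "op_res (V \<inter> W) P \<oplus>\<^bsub>diffop (V \<inter> W)\<^esub> op_res (V \<inter> W) Q \<in> carrier (diffop (V \<inter> W))"
    if "open V" "open W" "P \<in> carrier (diffop V)" "Q \<in> carrier (diffop W)" for V W P Q
  proof -
    have o: "open (V \<inter> W)" "V \<inter> W \<in> opens V" "V \<inter> W \<in> opens W" using that by (auto simp: opens_def)
    interpret ring "diffop (V \<inter> W)" by (rule ring_diffop[OF o(1)])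
    show ?thesis using op_res_diffop[OF that(3) o(2)] op_res_diffop[OF that(4) o(3)] by simp
  qed
  have "?g V' P' W' Q' = ?g V P W Q" if PQ': "(V', P') \<in> s x" "(W', Q') \<in> t x" for V' P' W' Q'
  proof -
    note r = P Q representsD(2)[OF P PQ'(1)] representsD(2)[OF Q PQ'(2)]
    have b: "open V" "open W" "open V'" "open W'" "P \<in> carrier (diffop V)" "Q \<in> carrier (diffop W)"
      "P' \<in> carrier (diffop V')" "Q' \<in> carrier (diffop W')"
      using r by (auto simp: represents_def)
    obtain Y where Y: "Y \<in> opens V" "Y \<in> opens V'" "x \<in> Y" "open Y"
        "op_res Y P' \<ominus>\<^bsub>diffop Y\<^esub> op_res Y P \<in> L Y"
      by (rule represents_refine[OF P PQ'(1)])
    obtain Z where Z: "Z \<in> opens W" "Z \<in> opens W'" "x \<in> Z" "open Z"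
        "op_res Z Q' \<ominus>\<^bsub>diffop Z\<^esub> op_res Z Q \<in> L Z"
      by (rule represents_refine[OF Q PQ'(2)])
    let ?Z = "Y \<inter> Z"
    have o: "?Z \<in> opens Y" "?Z \<in> opens Z" "?Z \<in> opens V" "?Z \<in> opens V'" "?Z \<in> opens W" "?Z \<in> opens W'"
      "?Z \<in> opens (V \<inter> W)" "?Z \<in> opens (V' \<inter> W')" "open ?Z" "open (V \<inter> W)" "open (V' \<inter> W')"
      "V \<inter> W \<in> opens V" "V \<inter> W \<in> opens W" "V' \<inter> W' \<in> opens V'" "V' \<inter> W' \<in> opens W'"
      using Y Z b by (auto simp: opens_def)
    interpret ring "diffop ?Z" by (rule ring_diffop[OF o(9)])
    note c' = op_res_diffop[OF b(5) o(3)] op_res_diffop[OF b(6) o(5)]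
      op_res_diffop[OF b(7) o(4)] op_res_diffop[OF b(8) o(6)]
    have 1: "op_res ?Z P' \<ominus>\<^bsub>diffop ?Z\<^esub> op_res ?Z P \<in> L ?Z"
      using res[OF Y(4) o(1) Y(5)] by (simp add: op_res_op_res o(1)
          op_res_a_minus[OF Y(4) o(1) op_res_diffop[OF b(7) Y(2)] op_res_diffop[OF b(5) Y(1)]])
    have 2: "op_res ?Z Q' \<ominus>\<^bsub>diffop ?Z\<^esub> op_res ?Z Q \<in> L ?Z"
      using res[OF Z(4) o(2) Z(5)] by (simp add: op_res_op_res o(2)
          op_res_a_minus[OF Z(4) o(2) op_res_diffop[OF b(8) Z(2)] op_res_diffop[OF b(6) Z(1)]])
    have "(op_res ?Z P' \<oplus>\<^bsub>diffop ?Z\<^esub> op_res ?Z Q') \<ominus>\<^bsub>diffop ?Z\<^esub> (op_res ?Z P \<oplus>\<^bsub>diffop ?Z\<^esub> op_res ?Z Q)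
      = (op_res ?Z P' \<ominus>\<^bsub>diffop ?Z\<^esub> op_res ?Z P) \<oplus>\<^bsub>diffop ?Z\<^esub> (op_res ?Z Q' \<ominus>\<^bsub>diffop ?Z\<^esub> op_res ?Z Q)"
      using c' by (simp add: a_minus_def minus_add a_ac)
    then have 3: "(op_res ?Z P' \<oplus>\<^bsub>diffop ?Z\<^esub> op_res ?Z Q') \<ominus>\<^bsub>diffop ?Z\<^esub> (op_res ?Z P \<oplus>\<^bsub>diffop ?Z\<^esub> op_res ?Z Q) \<in> L ?Z"
      using add[OF o(9) 1 2] by simp
    show ?thesis
    proof (rule germ_class_cong[OF o(11,10,8,7)])
      show "x \<in> ?Z" using Y Z by simp
      show "op_res ?Z (op_res (V' \<inter> W') P' \<oplus>\<^bsub>diffop (V' \<inter> W')\<^esub> op_res (V' \<inter> W') Q') \<ominus>\<^bsub>diffop ?Z\<^esub>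
          op_res ?Z (op_res (V \<inter> W) P \<oplus>\<^bsub>diffop (V \<inter> W)\<^esub> op_res (V \<inter> W) Q) \<in> L ?Z"
        using 3 by (simp add: op_res_op_res o(7,8)
          op_res_add[OF o(10,7) op_res_diffop[OF b(5) o(12)] op_res_diffop[OF b(6) o(13)]]
          op_res_add[OF o(11,8) op_res_diffop[OF b(7) o(14)] op_res_diffop[OF b(8) o(15)]])
    qed (use c b in auto)
  qed
  then have "(\<Union>(V', P')\<in>s x. \<Union>(W', Q')\<in>t x. ?g V' P' W' Q') = ?g V P W Q"
    by (intro UN_represents[OF P] UN_represents[OF Q])
  then show ?thesis
    using x P Q c[of V W P Q] by (auto simp: represents_def quot_module_def)
qed

text \<open>Changing the representative by an element of \<open>L\<close> changes the product by a
  left multiple of that element, which stays in the left ideal.\<close>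

lemma msmult_represents:
  assumes U: "open U" and x: "x \<in> U" and P: "represents L x V P (s x)" and R: "R \<in> carrier (diffop U)"
  shows "represents L x (U \<inter> V) (op_res (U \<inter> V) R \<otimes>\<^bsub>diffop (U \<inter> V)\<^esub> op_res (U \<inter> V) P)
    (msmult (quot_module L) U R s x)"
proof -
  let ?g = "\<lambda>V P. germ_class L x (U \<inter> V) (op_res (U \<inter> V) R \<otimes>\<^bsub>diffop (U \<inter> V)\<^esub> op_res (U \<inter> V) P)"
  have c: "op_res (U \<inter> V) R \<otimes>\<^bsub>diffop (U \<inter> V)\<^esub> op_res (U \<inter> V) P \<in> carrier (diffop (U \<inter> V))"
    if "open V" "P \<in> carrier (diffop V)" for V P
  proof -
    have o: "open (U \<inter> V)" "U \<inter> V \<in> opens U" "U \<inter> V \<in> opens V" using that U by (auto simp: opens_def)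
    interpret ring "diffop (U \<inter> V)" by (rule ring_diffop[OF o(1)])
    show ?thesis using op_res_diffop[OF R o(2)] op_res_diffop[OF that(2) o(3)] by simp
  qed
  have "?g V' P' = ?g V P" if P': "(V', P') \<in> s x" for V' P'
  proof -
    note r = P representsD(2)[OF P P']
    have b: "open V" "open V'" "P \<in> carrier (diffop V)" "P' \<in> carrier (diffop V')"
      using r by (auto simp: represents_def)
    obtain Y where Y: "Y \<in> opens V" "Y \<in> opens V'" "x \<in> Y" "open Y"
        "op_res Y P' \<ominus>\<^bsub>diffop Y\<^esub> op_res Y P \<in> L Y"
      by (rule represents_refine[OF P P'])
    let ?Z = "U \<inter> Y"
    have o: "?Z \<in> opens Y" "?Z \<in> opens V" "?Z \<in> opens V'" "?Z \<in> opens U"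
      "?Z \<in> opens (U \<inter> V)" "?Z \<in> opens (U \<inter> V')" "open ?Z" "open (U \<inter> V)" "open (U \<inter> V')"
      "U \<inter> V \<in> opens U" "U \<inter> V \<in> opens V" "U \<inter> V' \<in> opens U" "U \<inter> V' \<in> opens V'"
      using Y b U by (auto simp: opens_def)
    interpret ring "diffop ?Z" by (rule ring_diffop[OF o(7)])
    note c' = op_res_diffop[OF b(3) o(2)] op_res_diffop[OF b(4) o(3)] op_res_diffop[OF R o(4)]
    have 1: "op_res ?Z P' \<ominus>\<^bsub>diffop ?Z\<^esub> op_res ?Z P \<in> L ?Z"
      using res[OF Y(4) o(1) Y(5)] by (simp add: op_res_op_res o(1)
          op_res_a_minus[OF Y(4) o(1) op_res_diffop[OF b(4) Y(2)] op_res_diffop[OF b(3) Y(1)]])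
    have "(op_res ?Z R \<otimes>\<^bsub>diffop ?Z\<^esub> op_res ?Z P') \<ominus>\<^bsub>diffop ?Z\<^esub> (op_res ?Z R \<otimes>\<^bsub>diffop ?Z\<^esub> op_res ?Z P)
      = op_res ?Z R \<otimes>\<^bsub>diffop ?Z\<^esub> (op_res ?Z P' \<ominus>\<^bsub>diffop ?Z\<^esub> op_res ?Z P)"
      using c' by (simp add: a_minus_def r_minus r_distr)
    then have 3: "(op_res ?Z R \<otimes>\<^bsub>diffop ?Z\<^esub> op_res ?Z P') \<ominus>\<^bsub>diffop ?Z\<^esub> (op_res ?Z R \<otimes>\<^bsub>diffop ?Z\<^esub> op_res ?Z P) \<in> L ?Z"
      using lmult[OF o(7) c'(3) 1] by simp
    show ?thesis
    proof (rule germ_class_cong[OF o(9,8,6,5)])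
      show "x \<in> ?Z" using Y x by simp
      show "op_res ?Z (op_res (U \<inter> V') R \<otimes>\<^bsub>diffop (U \<inter> V')\<^esub> op_res (U \<inter> V') P') \<ominus>\<^bsub>diffop ?Z\<^esub>
          op_res ?Z (op_res (U \<inter> V) R \<otimes>\<^bsub>diffop (U \<inter> V)\<^esub> op_res (U \<inter> V) P) \<in> L ?Z"
        using 3 by (simp add: op_res_op_res o(5,6)
          op_res_mult[OF o(8,5) op_res_diffop[OF R o(10)] op_res_diffop[OF b(3) o(11)]]
          op_res_mult[OF o(9,6) op_res_diffop[OF R o(12)] op_res_diffop[OF b(4) o(13)]])
    qed (use c b in auto)
  qed
  then have "(\<Union>(V', P')\<in>s x. ?g V' P') = ?g V P"
    by (intro UN_represents[OF P])
  then show ?thesis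
    using U x P c[of V P] by (auto simp: represents_def quot_module_def)
qed

end

locale right_multiplication = J: ideal_sheaf J + J': ideal_sheaf J'
  for J J' :: "'n::finite ideal_sheaf" +
  fixes R :: "'n oper"
  assumes R: "R \<in> carrier DN"
    and right_mult_mem: "open U \<Longrightarrow> P \<in> J U \<Longrightarrow> P \<otimes>\<^bsub>diffop U\<^esub> op_res U R \<in> J' U"
begin

lemma R_res: "open U \<Longrightarrow> op_res U R \<in> carrier (diffop U)"
  using op_res_diffop[OF R] by (simp add: opens_def)

text \<open>Two representatives differ by an element of \<open>J\<close>, and
  \<open>right_mult_mem\<close> carries this difference into \<open>J'\<close>.\<close>

lemma right_mult_represents:
  assumes x: "x \<in> U" and P: "represents J x V P (s x)"
  shows "represents J' x V (P \<otimes>\<^bsub>diffop V\<^esub> op_res V R) (right_mult_map J' R U s x)"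
proof -
  let ?g = "\<lambda>V P. germ_class J' x V (P \<otimes>\<^bsub>diffop V\<^esub> op_res V R)"
  have c: "P \<otimes>\<^bsub>diffop V\<^esub> op_res V R \<in> carrier (diffop V)"
    if "open V" "P \<in> carrier (diffop V)" for V P
  proof -
    interpret ring "diffop V" by (rule ring_diffop[OF that(1)])
    show ?thesis using that R_res by simp
  qed
  have "?g V' P' = ?g V P" if P': "(V', P') \<in> s x" for V' P'
  proof -
    note r = P J.representsD(2)[OF P P']
    have b: "open V" "open V'" "P \<in> carrier (diffop V)" "P' \<in> carrier (diffop V')"
      using r by (auto simp: represents_def)
    obtain Z where Z: "Z \<in> opens V" "Z \<in> opens V'" "x \<in> Z" "open Z"
        "op_res Z P' \<ominus>\<^bsub>diffop Z\<^esub> op_res Z P \<in> J Z"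
      by (rule J.represents_refine[OF P P'])
    interpret ring "diffop Z" by (rule ring_diffop[OF Z(4)])
    note c' = op_res_diffop[OF b(3) Z(1)] op_res_diffop[OF b(4) Z(2)] R_res[OF Z(4)]
    have "(op_res Z P' \<otimes>\<^bsub>diffop Z\<^esub> op_res Z R) \<ominus>\<^bsub>diffop Z\<^esub> (op_res Z P \<otimes>\<^bsub>diffop Z\<^esub> op_res Z R)
      = (op_res Z P' \<ominus>\<^bsub>diffop Z\<^esub> op_res Z P) \<otimes>\<^bsub>diffop Z\<^esub> op_res Z R"
      using c' by (simp add: a_minus_def l_minus l_distr)
    then have 3: "(op_res Z P' \<otimes>\<^bsub>diffop Z\<^esub> op_res Z R) \<ominus>\<^bsub>diffop Z\<^esub> (op_res Z P \<otimes>\<^bsub>diffop Z\<^esub> op_res Z R) \<in> J' Z"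
      using right_mult_mem[OF Z(4,5)] by simp
    show ?thesis
    proof (rule J'.germ_class_cong[OF b(2,1) Z(2,1,3)])
      show "op_res Z (P' \<otimes>\<^bsub>diffop V'\<^esub> op_res V' R) \<ominus>\<^bsub>diffop Z\<^esub> op_res Z (P \<otimes>\<^bsub>diffop V\<^esub> op_res V R) \<in> J' Z"
        using 3 by (simp add: op_res_op_res Z(1,2)
          op_res_mult[OF b(1) Z(1) b(3) R_res[OF b(1)]] op_res_mult[OF b(2) Z(2) b(4) R_res[OF b(2)]])
    qed (use c b in auto)
  qed
  then have "(\<Union>(V', P')\<in>s x. ?g V' P') = ?g V P"
    by (intro J.UN_represents[OF P])
  then show ?thesis
    using x P c[of V P] by (auto simp: represents_def right_mult_map_def)
qed

text \<open>Evaluated on representatives at a point, additivity is distributivity in the ring of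
  operators and linearity is associativity.\<close>

lemma dmod_hom_right_mult: "dmod_hom (quot_module J) (quot_module J') (right_mult_map J' R)"
  unfolding dmod_hom_def
proof (intro allI impI conjI ballI)
  fix U :: "(complex^'n) set" assume U: "open U"
  have rep: "\<exists>V P. V \<in> opens U \<and> represents J x V P (s x)" if "s \<in> sects (quot_module J) U" "x \<in> U" for s x
    using J.sects_represents[OF that] by metis
  have ext: "right_mult_map J' R U s \<in> extensional U"
    "madd (quot_module M) U s t \<in> extensional U" "msmult (quot_module M) U R' s \<in> extensional U" for s t M R' U
    by (auto simp: right_mult_map_def quot_module_def)
  show "right_mult_map J' R U \<in> sects (quot_module J) U \<rightarrow> sects (quot_module J') U"
  proof
    fix s assume s: "s \<in> sects (quot_module J) U"
    have "\<exists>V\<in>opens U. x \<in> V \<and> (\<exists>P\<in>carrier (diffop V). \<forall>y\<in>V. right_mult_map J' R U s y = germ_class J' y V P)"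
      if x: "x \<in> U" for x
    proof -
      obtain V P where V: "V \<in> opens U" "x \<in> V" and P: "\<And>y. y \<in> V \<Longrightarrow> represents J y V P (s y)"
        by (rule J.sects_represents[OF s x]) (rule that)
      have "represents J' y V (P \<otimes>\<^bsub>diffop V\<^esub> op_res V R) (right_mult_map J' R U s y)" if "y \<in> V" for y
        using right_mult_represents[where s = s, OF _ P[OF that]] that V(1) opensD by blast
      then show ?thesis
        using V unfolding represents_def by blast
    qed
    then show "right_mult_map J' R U s \<in> sects (quot_module J') U"
      using ext(1)[of U s] by (simp add: quot_module_def)
  qed
  show "right_mult_map J' R U (madd (quot_module J) U s t)
      = madd (quot_module J') U (right_mult_map J' R U s) (right_mult_map J' R U t)"
    if s: "s \<in> sects (quot_module J) U" and t: "t \<in> sects (quot_module J) U" for s t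
  proof (rule extensionalityI[OF ext(1,2)])
    fix x assume x: "x \<in> U"
    obtain V P where P: "represents J x V P (s x)" using rep[OF s x] by blast
    obtain W Q where Q: "represents J x W Q (t x)" using rep[OF t x] by blast
    have b: "open V" "open W" "P \<in> carrier (diffop V)" "Q \<in> carrier (diffop W)"
      using P Q by (auto simp: represents_def)
    have o: "open (V \<inter> W)" "V \<inter> W \<in> opens V" "V \<inter> W \<in> opens W" using b by (auto simp: opens_def)
    interpret ring "diffop (V \<inter> W)" by (rule ring_diffop[OF o(1)])
    note c = op_res_diffop[OF b(3) o(2)] op_res_diffop[OF b(4) o(3)] R_res[OF o(1)]
    have "op_res (V \<inter> W) (P \<otimes>\<^bsub>diffop V\<^esub> op_res V R) \<oplus>\<^bsub>diffop (V \<inter> W)\<^esub> op_res (V \<inter> W) (Q \<otimes>\<^bsub>diffop W\<^esub> op_res W R)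
      = (op_res (V \<inter> W) P \<oplus>\<^bsub>diffop (V \<inter> W)\<^esub> op_res (V \<inter> W) Q) \<otimes>\<^bsub>diffop (V \<inter> W)\<^esub> op_res (V \<inter> W) R"
      using c by (simp add: l_distr op_res_op_res o
          op_res_mult[OF b(1) o(2) b(3) R_res[OF b(1)]] op_res_mult[OF b(2) o(3) b(4) R_res[OF b(2)]])
    then show "right_mult_map J' R U (madd (quot_module J) U s t) x
        = madd (quot_module J') U (right_mult_map J' R U s) (right_mult_map J' R U t) x"
      using right_mult_represents[where s = "madd (quot_module J) U s t",
          OF x J.madd_represents[where s = s and t = t, OF x P Q]]
        J'.madd_represents[where s = "right_mult_map J' R U s" and t = "right_mult_map J' R U t",
          OF x right_mult_represents[where s = s, OF x P] right_mult_represents[where s = t, OF x Q]]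
      by (simp add: represents_def)
  qed
  show "right_mult_map J' R U (msmult (quot_module J) U R' s)
      = msmult (quot_module J') U R' (right_mult_map J' R U s)"
    if R': "R' \<in> carrier (diffop U)" and s: "s \<in> sects (quot_module J) U" for R' s
  proof (rule extensionalityI[OF ext(1,3)])
    fix x assume x: "x \<in> U"
    obtain V P where P: "represents J x V P (s x)" using rep[OF s x] by blast
    have b: "open V" "P \<in> carrier (diffop V)"
      using P by (auto simp: represents_def)
    have o: "open (U \<inter> V)" "U \<inter> V \<in> opens V" "U \<inter> V \<in> opens U" using b U by (auto simp: opens_def)
    interpret ring "diffop (U \<inter> V)" by (rule ring_diffop[OF o(1)])
    note c = op_res_diffop[OF b(2) o(2)] op_res_diffop[OF R' o(3)] R_res[OF o(1)]
    have "op_res (U \<inter> V) R' \<otimes>\<^bsub>diffop (U \<inter> V)\<^esub> op_res (U \<inter> V) (P \<otimes>\<^bsub>diffop V\<^esub> op_res V R)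
      = (op_res (U \<inter> V) R' \<otimes>\<^bsub>diffop (U \<inter> V)\<^esub> op_res (U \<inter> V) P) \<otimes>\<^bsub>diffop (U \<inter> V)\<^esub> op_res (U \<inter> V) R"
      using c by (simp add: m_assoc op_res_op_res o op_res_mult[OF b(1) o(2) b(2) R_res[OF b(1)]])
    then show "right_mult_map J' R U (msmult (quot_module J) U R' s) x
        = msmult (quot_module J') U R' (right_mult_map J' R U s) x"
      using right_mult_represents[where s = "msmult (quot_module J) U R' s",
          OF x J.msmult_represents[where s = s, OF U x P R']]
        J'.msmult_represents[where s = "right_mult_map J' R U s",
          OF U x right_mult_represents[where s = s, OF x P] R']
      by (simp add: represents_def)
  qed
  show "right_mult_map J' R V (mres (quot_module J) V s) = mres (quot_module J') V (right_mult_map J' R U s)"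
    if "V \<in> opens U" for V s
    using opensD(2)[OF that] by (auto simp: quot_module_def right_mult_map_def fun_eq_iff)
qed

end

text \<open>A representative \<open>P\<close> is sent to P R S, and P R S - P = P (R S - 1) lies in
  the left ideal. A single congruence over the whole space thus settles all stalks.\<close>

lemma right_mult_map_inverse:
  assumes "right_multiplication J J' R" "right_multiplication J' J S"
    and RS: "R \<otimes>\<^bsub>DN\<^esub> S \<ominus>\<^bsub>DN\<^esub> \<one>\<^bsub>DN\<^esub> \<in> J UNIV"
    and s: "s \<in> sects (quot_module J) U"
  shows "right_mult_map J S U (right_mult_map J' R U s) = s"
proof (rule extensionalityI)
  interpret R: right_multiplication J J' R by fact
  interpret S: right_multiplication J' J S by fact
  show "right_mult_map J S U (right_mult_map J' R U s) \<in> extensional U"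
    by (simp add: right_mult_map_def)
  show "s \<in> extensional U" using s by (simp add: quot_module_def)
  fix x assume x: "x \<in> U"
  obtain V P where P: "represents J x V P (s x)"
    by (rule R.J.sects_represents[OF s x]) (use x in blast)
  have b: "open V" "x \<in> V" "P \<in> carrier (diffop V)" using P by (auto simp: represents_def)
  have V: "V \<in> opens UNIV" "V \<in> opens V" using b by (auto simp: opens_def)
  interpret D: ring DN by (rule ring_diffop) simp
  interpret ring "diffop V" by (rule ring_diffop[OF b(1)])
  note c = b(3) R.R_res[OF b(1)] S.R_res[OF b(1)]
  interpret H: ring_hom_ring DN "diffop V" "op_res V" by (rule op_res_hom[OF open_UNIV V(1)])
  have "op_res V (R \<otimes>\<^bsub>DN\<^esub> S \<ominus>\<^bsub>DN\<^esub> \<one>\<^bsub>DN\<^esub>) = op_res V R \<otimes>\<^bsub>diffop V\<^esub> op_res V S \<ominus>\<^bsub>diffop V\<^esub> \<one>\<^bsub>diffop V\<^esub>"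
    using R.R S.R by (simp add: a_minus_def)
  then have "op_res V R \<otimes>\<^bsub>diffop V\<^esub> op_res V S \<ominus>\<^bsub>diffop V\<^esub> \<one>\<^bsub>diffop V\<^esub> \<in> J V"
    using R.J.res[OF open_UNIV V(1) RS] by simp
  from R.J.lmult[OF b(1,3) this]
  have "P \<otimes>\<^bsub>diffop V\<^esub> op_res V R \<otimes>\<^bsub>diffop V\<^esub> op_res V S \<ominus>\<^bsub>diffop V\<^esub> P \<in> J V"
    using c by (simp add: a_minus_def r_distr r_minus m_assoc)
  then have "germ_class J x V (P \<otimes>\<^bsub>diffop V\<^esub> op_res V R \<otimes>\<^bsub>diffop V\<^esub> op_res V S) = germ_class J x V P"
    using c b V by (intro R.J.germ_class_cong[of _ _ V])
      (auto simp: op_res_self[OF diffop_endo])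
  then show "right_mult_map J S U (right_mult_map J' R U s) x = s x"
    using P S.right_mult_represents[where s = "right_mult_map J' R U s",
      OF x R.right_mult_represents[where s = s, OF x P]]
    by (simp add: represents_def)
qed

lemma dmod_iso_right_mult:
  assumes "right_multiplication J J' R" "right_multiplication J' J S"
    and "R \<otimes>\<^bsub>DN\<^esub> S \<ominus>\<^bsub>DN\<^esub> \<one>\<^bsub>DN\<^esub> \<in> J UNIV" "S \<otimes>\<^bsub>DN\<^esub> R \<ominus>\<^bsub>DN\<^esub> \<one>\<^bsub>DN\<^esub> \<in> J' UNIV"
  shows "dmod_iso (quot_module J) (quot_module J') (right_mult_map J' R)"
  unfolding dmod_iso_def
  using right_multiplication.dmod_hom_right_mult[OF assms(1)]
    right_multiplication.dmod_hom_right_mult[OF assms(2)]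
    right_mult_map_inverse[OF assms(1,2,3)] right_mult_map_inverse[OF assms(2,1,4)]
  by blast


section \<open>Global differential operators as a type\<close>

lemma ring_DN: "ring DN"
  by (rule ring_diffop) simp

text \<open>Demanded by the class \<open>ring_1\<close>. The constant function 1 separates the two
  operators.\<close>

lemma one_neq_zero_DN: "(\<one>\<^bsub>DN\<^esub> :: 'n::finite oper) \<noteq> \<zero>\<^bsub>DN\<^esub>"
proof
  let ?f = "\<lambda>z::complex^'n. 1"
  assume "(\<one>\<^bsub>DN\<^esub> :: 'n oper) = \<zero>\<^bsub>DN\<^esub>"
  then have "(\<one>\<^bsub>DN\<^esub> :: 'n oper) UNIV ?f 0 = (\<zero>\<^bsub>DN\<^esub> :: 'n oper) UNIV ?f 0"
    by simp
  moreover have "?f \<in> holo UNIV"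
    by (simp add: holo_iff holo_diff_const)
  ultimately show False
    by (simp add: diffop_ops endo_ops UNIV_opens)
qed

text \<open>The algebraic computation lives in the type class \<open>ring_1\<close>, so the carrier
  of the ring of global operators is made into a type.\<close>

typedef (overloaded) ('n::finite) dop = "carrier (DN :: 'n oper ring)"
  using ring.ring_simprules(6)[OF ring_DN] by blast

instantiation dop :: (finite) ring_1
begin

definition "0 = Abs_dop \<zero>\<^bsub>DN\<^esub>"
definition "1 = Abs_dop \<one>\<^bsub>DN\<^esub>"
definition "P + Q = Abs_dop (Rep_dop P \<oplus>\<^bsub>DN\<^esub> Rep_dop Q)"
definition "P * Q = Abs_dop (Rep_dop P \<otimes>\<^bsub>DN\<^esub> Rep_dop Q)"
definition "P - Q = Abs_dop (Rep_dop P \<ominus>\<^bsub>DN\<^esub> Rep_dop Q)"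
definition "- P = Abs_dop (\<ominus>\<^bsub>DN\<^esub> Rep_dop P)"

lemma Rep_dop_ops:
  shows Rep_dop_0: "Rep_dop (0 :: 'a dop) = \<zero>\<^bsub>DN\<^esub>"
    and Rep_dop_1: "Rep_dop (1 :: 'a dop) = \<one>\<^bsub>DN\<^esub>"
    and Rep_dop_add: "Rep_dop (P + Q :: 'a dop) = Rep_dop P \<oplus>\<^bsub>DN\<^esub> Rep_dop Q"
    and Rep_dop_mult: "Rep_dop (P * Q :: 'a dop) = Rep_dop P \<otimes>\<^bsub>DN\<^esub> Rep_dop Q"
    and Rep_dop_diff: "Rep_dop (P - Q :: 'a dop) = Rep_dop P \<ominus>\<^bsub>DN\<^esub> Rep_dop Q"
    and Rep_dop_uminus: "Rep_dop (- P :: 'a dop) = \<ominus>\<^bsub>DN\<^esub> Rep_dop P"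
proof -
  interpret ring "DN :: 'a oper ring" by (rule ring_DN)
  note [simp] = zero_dop_def one_dop_def plus_dop_def times_dop_def minus_dop_def uminus_dop_def
    Abs_dop_inverse Rep_dop
  show "Rep_dop (0 :: 'a dop) = \<zero>\<^bsub>DN\<^esub>" "Rep_dop (1 :: 'a dop) = \<one>\<^bsub>DN\<^esub>"
    "Rep_dop (P + Q :: 'a dop) = Rep_dop P \<oplus>\<^bsub>DN\<^esub> Rep_dop Q"
    "Rep_dop (P * Q :: 'a dop) = Rep_dop P \<otimes>\<^bsub>DN\<^esub> Rep_dop Q"
    "Rep_dop (P - Q :: 'a dop) = Rep_dop P \<ominus>\<^bsub>DN\<^esub> Rep_dop Q"
    "Rep_dop (- P :: 'a dop) = \<ominus>\<^bsub>DN\<^esub> Rep_dop P"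
    by simp_all
qed

instance
proof
  interpret ring "DN :: 'a oper ring" by (rule ring_DN)
  note [simp] = Rep_dop_ops Rep_dop
  fix a b c :: "'a dop"
  show "a * b * c = a * (b * c)" "1 * a = a" "a * 1 = a" "a + b + c = a + (b + c)" "a + b = b + a"
    "0 + a = a" "- a + a = 0" "a - b = a + - b" "(a + b) * c = a * c + b * c" "a * (b + c) = a * b + a * c"
    by (simp_all add: Rep_dop_inject[symmetric] m_assoc a_ac r_neg a_minus_def l_distr r_distr)
  show "(0 :: 'a dop) \<noteq> 1"
    using one_neq_zero_DN by (metis Rep_dop_0 Rep_dop_1)
qed

end

lemma Rep_dop_sum:
  fixes f :: "'b \<Rightarrow> 'n::finite dop"
  assumes "finite A"
  shows "Rep_dop (sum f A) = (\<Oplus>\<^bsub>DN\<^esub>h\<in>A. Rep_dop (f h))"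
proof -
  interpret ring "DN :: 'n oper ring" by (rule ring_DN)
  show ?thesis
    using assms by induction (auto simp: Rep_dop_ops Rep_dop)
qed

lemma mul_op_DN:
  assumes "holo_diff UNIV g"
  shows "mul_op UNIV g \<in> carrier DN"
  using assms by (intro gens_diffop) (auto simp: holo_iff)

lemma pd_op_DN: "pd_op UNIV i \<in> carrier DN"
  by (intro gens_diffop) auto

lemma mul_op_apply: "open V \<Longrightarrow> f \<in> holo V \<Longrightarrow> z \<in> V \<Longrightarrow> mul_op UNIV g V f z = g z * f z"
  by (simp add: mul_op_def opens_def)

lemma pd_op_apply: "open V \<Longrightarrow> f \<in> holo V \<Longrightarrow> z \<in> V \<Longrightarrow> pd_op UNIV i V f z = pderiv_at i f z"
  by (simp add: pd_op_eq opens_def)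

lemma mul_op_holo: "holo_diff UNIV g \<Longrightarrow> open V \<Longrightarrow> f \<in> holo V \<Longrightarrow> mul_op UNIV g V f \<in> holo V"
  using endo_holo[OF diffop_endo[OF mul_op_DN]] by (simp add: opens_def)

lemma pd_op_holo: "open V \<Longrightarrow> f \<in> holo V \<Longrightarrow> pd_op UNIV i V f \<in> holo V"
  using endo_holo[OF diffop_endo[OF pd_op_DN]] by (simp add: opens_def)

lemma dop_eqI:
  assumes "\<And>V f z. open V \<Longrightarrow> f \<in> holo V \<Longrightarrow> z \<in> V \<Longrightarrow> Rep_dop P V f z = Rep_dop Q V f z"
  shows "P = Q"
  unfolding Rep_dop_inject[symmetric]
  by (rule endo_eqI[OF diffop_endo[OF Rep_dop] diffop_endo[OF Rep_dop]]) (auto simp: assms opens_def)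

lemma Rep_dop_apply:
  assumes "open V" "f \<in> holo V"
  shows "Rep_dop (P * Q) V f = Rep_dop P V (Rep_dop Q V f)"
    and "z \<in> V \<Longrightarrow> Rep_dop (P + Q) V f z = Rep_dop P V f z + Rep_dop Q V f z"
    and "Rep_dop 1 V f = f"
    and "z \<in> V \<Longrightarrow> Rep_dop 0 V f z = 0"
  using assms by (auto simp: Rep_dop_ops diffop_ops endo_ops opens_def)

definition xop :: "(nat \<Rightarrow> 'n::finite) \<Rightarrow> nat \<Rightarrow> 'n dop" where
  "xop \<iota> h = Abs_dop (coord \<iota> h)"

definition dpart :: "(nat \<Rightarrow> 'n::finite) \<Rightarrow> nat \<Rightarrow> 'n dop" where
  "dpart \<iota> h = Abs_dop (pd \<iota> h)"

definition konst :: "complex \<Rightarrow> 'n::finite dop" where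
  "konst c = Abs_dop (cnst c)"

lemma Rep_dop_gens [simp]:
  "Rep_dop (xop \<iota> h) = coord \<iota> h" "Rep_dop (dpart \<iota> h) = pd \<iota> h" "Rep_dop (konst c) = cnst c"
  by (simp_all add: xop_def dpart_def konst_def coord_def pd_def cnst_def
      Abs_dop_inverse mul_op_DN pd_op_DN holo_diff_const holo_diff_coord)

lemma pderiv_at_mul_op:
  assumes g: "holo_diff UNIV g" and V: "open V" and f: "f \<in> holo V" and z: "z \<in> V"
  shows "pderiv_at i (mul_op UNIV g V f) z = g z * pderiv_at i f z + pderiv_at i g z * f z"
proof -
  have hd: "holo_diff V g" "holo_diff V f"
    using f V holo_diff_subset[OF g V] by (auto simp: holo_iff)
  have "pderiv_at i (mul_op UNIV g V f) z = pderiv_at i (\<lambda>z. g z * f z) z"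
    by (rule pderiv_at_cong[OF holo_diff_mult[OF hd] _ z]) (simp add: mul_op_apply V f)
  then show ?thesis
    by (simp add: pderiv_at_mult[OF hd z])
qed

text \<open>Here the analysis enters the algebra: partial derivatives commute by Cauchy's formula,
  and the remaining relations follow from the product rule.\<close>

lemma weyl_algebra_dop:
  fixes \<iota> :: "nat \<Rightarrow> 'n::finite"
  assumes k: "CARD('n) \<ge> 2" and bij: "bij_betw \<iota> {1..CARD('n)} UNIV"
  shows "weyl_algebra CARD('n) (xop \<iota>) (dpart \<iota>) konst"
proof
  note hol = mul_op_holo[OF holo_diff_const[OF open_UNIV]] mul_op_holo[OF holo_diff_coord[OF open_UNIV]] pd_op_holo
  note app = Rep_dop_apply mul_op_apply pd_op_apply hol
    pderiv_at_mul_op[OF holo_diff_const[OF open_UNIV]] pderiv_at_mul_op[OF holo_diff_coord[OF open_UNIV]]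
    coord_def pd_def cnst_def pderiv_at_const pderiv_at_coord
  fix a b :: complex and p q :: nat
  show "konst (a + b) = konst a + (konst b :: 'n dop)" "konst (a * b) = konst a * (konst b :: 'n dop)"
    "konst 1 = (1 :: 'n dop)"
    by (auto intro!: dop_eqI simp: app distrib_right)
  show "dpart \<iota> p * konst a = konst a * dpart \<iota> p" "xop \<iota> p * konst a = konst a * xop \<iota> p"
    "xop \<iota> p * xop \<iota> q = xop \<iota> q * xop \<iota> p"
    by (auto intro!: dop_eqI simp: app)
  show "dpart \<iota> p * dpart \<iota> q = dpart \<iota> q * dpart \<iota> p"
  proof (rule dop_eqI)
    fix V :: "(complex^'n) set" and f z assume V: "open V" and f: "f \<in> holo V" and z: "z \<in> V"
    have hd: "holo_diff V f" using f V by (simp add: holo_iff)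
    have "Rep_dop (dpart \<iota> p * dpart \<iota> q) V f z = pderiv_at (\<iota> p) (pderiv_at (\<iota> q) f) z" for p q
    proof -
      have "Rep_dop (dpart \<iota> p * dpart \<iota> q) V f z = pderiv_at (\<iota> p) (pd_op UNIV (\<iota> q) V f) z"
        using V f z by (simp add: app)
      \<comment> \<open>The section is cut off outside \<open>V\<close>; it is replaced by the
        unrestricted partial derivative, which agrees with it on the open set
        \<open>V\<close>.\<close>
      also have "\<dots> = pderiv_at (\<iota> p) (pderiv_at (\<iota> q) f) z"
        by (rule pderiv_at_cong[OF holo_diff_pderiv_at[OF hd] _ z]) (simp add: pd_op_apply V f)
      finally show ?thesis .
    qed
    then show "Rep_dop (dpart \<iota> p * dpart \<iota> q) V f z = Rep_dop (dpart \<iota> q * dpart \<iota> p) V f z"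
      using pderiv_at_commute[OF hd z] by simp
  qed
  show "dpart \<iota> p * xop \<iota> q = xop \<iota> q * dpart \<iota> p + (if p = q then 1 else 0)"
    if "p \<in> {1..CARD('n)}" "q \<in> {1..CARD('n)}"
  proof -
    \<comment> \<open>The derivative of a coordinate compares labels, the Weyl relation compares
      numbers; injectivity of the labelling identifies the two conditions.\<close>
    have "\<iota> p = \<iota> q \<longleftrightarrow> p = q"
      using bij_betw_imp_inj_on[OF bij] that by (auto simp: inj_on_eq_iff)
    then show ?thesis
      by (auto intro!: dop_eqI simp: app)
  qed
  show "2 \<le> CARD('n)" by (rule k)
qed

definition I_gens :: "(nat \<Rightarrow> 'n::finite) \<Rightarrow> complex \<Rightarrow> 'n oper set" where
  "I_gens \<iota> \<mu> = {A_op \<iota> p q | p q. p \<in> {1..CARD('n) - 1} \<and> q \<in> {2..CARD('n)}} \<union>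
      {T_op \<iota> \<mu> m | m. m \<in> {2..CARD('n)}}"

context
  fixes \<iota> :: "nat \<Rightarrow> 'n::finite"
  assumes k: "CARD('n) \<ge> 2" and bij: "bij_betw \<iota> {1..CARD('n)} UNIV"
begin

interpretation W: weyl_algebra "CARD('n)" "xop \<iota>" "dpart \<iota>" konst
  by (rule weyl_algebra_dop[OF k bij])

lemma Rep_dop_E: "Rep_dop W.E = E_op \<iota>"
  by (simp add: W.E_def E_op_def Rep_dop_sum Rep_dop_mult)

lemma Rep_dop_U0: "Rep_dop W.U0 = U0_op \<iota>"
  by (simp add: W.U0_def U0_op_def Rep_dop_sum Rep_dop_mult)

lemma Rep_dop_A: "Rep_dop (W.A_gen p q) = A_op \<iota> p q"
  by (simp add: W.A_gen_def A_op_def Rep_dop_ops)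

lemma Rep_dop_T: "Rep_dop (W.T_gen \<mu> m) = T_op \<iota> \<mu> m"
  by (simp add: W.T_gen_def T_op_def Rep_dop_ops Rep_dop_E)

lemma Rep_dop_H: "Rep_dop (W.U0 - konst l) = U0_op \<iota> \<ominus>\<^bsub>DN\<^esub> cnst l"
  by (simp add: Rep_dop_ops Rep_dop_U0)

lemma gens_DN: "I_gens \<iota> \<mu> \<subseteq> carrier DN" "{U0_op \<iota> \<ominus>\<^bsub>DN\<^esub> cnst l} \<subseteq> carrier DN"
  unfolding I_gens_def
  by (auto simp: Rep_dop_A[symmetric] Rep_dop_T[symmetric] Rep_dop_H[symmetric] Rep_dop)

lemma J_sheaf_eq: "J_sheaf \<iota> \<mu> l =
    sum_ideal_sheaf (gen_ideal_sheaf (I_gens \<iota> \<mu>)) (gen_ideal_sheaf {U0_op \<iota> \<ominus>\<^bsub>DN\<^esub> cnst l})"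
  by (simp add: J_sheaf_def I_sheaf_def I_gens_def)

lemma ideal_sheaf_J_sheaf: "ideal_sheaf (J_sheaf \<iota> \<mu> l)"
  unfolding J_sheaf_eq by (intro ideal_sheaf_sum ideal_sheaf_gen gens_DN)

lemma gens_J_sheaf: "I_gens \<iota> \<mu> \<subseteq> J_sheaf \<iota> \<mu> l UNIV" "U0_op \<iota> \<ominus>\<^bsub>DN\<^esub> cnst l \<in> J_sheaf \<iota> \<mu> l UNIV"
  unfolding J_sheaf_eq
  using sum_ideal_sheaf_incl[OF ideal_sheaf_gen[OF gens_DN(1)] ideal_sheaf_gen[OF gens_DN(2)]]
    gen_ideal_sheaf_incl[OF gens_DN(1)] gen_ideal_sheaf_incl[OF gens_DN(2)]
  by blast+

text \<open>The ideal quotient of the target sheaf by \<open>R\<close> contains the generators, and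
  minimality of \<open>J_sheaf\<close> extends this to all sections over every open set.\<close>

lemma right_multiplication_J_sheaf:
  assumes I: "\<And>X. X \<in> I_gens \<iota> \<mu> \<Longrightarrow> X \<otimes>\<^bsub>DN\<^esub> Rep_dop R \<in> J_sheaf \<iota> \<mu>' l UNIV"
    and H: "(U0_op \<iota> \<ominus>\<^bsub>DN\<^esub> cnst l) \<otimes>\<^bsub>DN\<^esub> Rep_dop R \<in> J_sheaf \<iota> \<mu>' l UNIV"
  shows "right_multiplication (J_sheaf \<iota> \<mu> l) (J_sheaf \<iota> \<mu>' l) (Rep_dop R)"
proof (intro right_multiplication.intro right_multiplication_axioms.intro ideal_sheaf_J_sheaf Rep_dop)
  fix U P assume U: "open U" and P: "P \<in> J_sheaf \<iota> \<mu> l U"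
  let ?C = "\<lambda>U. {P \<in> carrier (diffop U). P \<otimes>\<^bsub>diffop U\<^esub> op_res U (Rep_dop R) \<in> J_sheaf \<iota> \<mu>' l U}"
  have C: "ideal_sheaf ?C"
    by (rule ideal_sheaf_colon[OF ideal_sheaf_J_sheaf Rep_dop])
  have "J_sheaf \<iota> \<mu> l U \<subseteq> ?C U"
    unfolding J_sheaf_eq[of \<mu>]
  proof (intro sum_ideal_sheaf_min[OF C _ _ U] gen_ideal_sheaf_min[OF C])
    show "I_gens \<iota> \<mu> \<subseteq> ?C UNIV" "{U0_op \<iota> \<ominus>\<^bsub>DN\<^esub> cnst l} \<subseteq> ?C UNIV"
      using I H gens_DN by (auto simp: op_res_DN Rep_dop)
  qed
  then show "P \<otimes>\<^bsub>diffop U\<^esub> op_res U (Rep_dop R) \<in> J_sheaf \<iota> \<mu>' l U"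
    using P by blast
qed

lemma left_ideal_set_J_sheaf: "left_ideal_set {P. Rep_dop P \<in> J_sheaf \<iota> \<mu> l UNIV}"
proof -
  interpret ideal_sheaf "J_sheaf \<iota> \<mu> l" by (rule ideal_sheaf_J_sheaf)
  show ?thesis
    by unfold_locales (auto simp: Rep_dop_ops intro: zero add lmult Rep_dop)
qed

lemma dmod_iso_square_map:
  assumes c: "\<And>j. j < CARD('n) \<Longrightarrow> l + of_nat CARD('n) * \<mu> \<noteq> - of_nat j"
  shows "dmod_iso (N_module \<iota> (\<mu> + 1) l) (N_module \<iota> \<mu> l) (square_map \<iota> \<mu> l)"
proof -
  define c where "c = - l - of_nat CARD('n) * \<mu>"
  \<comment> \<open>The divisor equals \<open>- (l + k * \<mu> + (k - q))\<close>, so the values to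
    be excluded are those with \<open>j = k - q\<close>, which runs through 0 to k - 1.\<close>
  have ne: "c - of_nat CARD('n) + of_nat q \<noteq> 0" if "1 \<le> q" "q \<le> CARD('n)" for q
    using c[of "CARD('n) - q"] that by (auto simp: c_def of_nat_diff algebra_simps eq_neg_iff_add_eq_0)
  let ?J = "\<lambda>\<mu>. {P. Rep_dop P \<in> J_sheaf \<iota> \<mu> l UNIV}"
  let ?R = "W.E + konst \<mu>"
  have gens: "W.A_gen p q \<in> ?J \<mu>" if "p \<in> {1..CARD('n) - 1}" "q \<in> {2..CARD('n)}" for \<mu> p q
    using gens_J_sheaf(1)[of \<mu> l] that by (auto simp: Rep_dop_A I_gens_def)
  have gens': "W.T_gen \<mu> m \<in> ?J \<mu>" if "m \<in> {2..CARD('n)}" for \<mu> m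
    using gens_J_sheaf(1)[of \<mu> l] that by (auto simp: Rep_dop_T I_gens_def)
  have gens'': "W.U0 - konst l \<in> ?J \<mu>" for \<mu>
    using gens_J_sheaf(2)[of l \<mu>] by (simp add: Rep_dop_H)
  have "\<exists>S. S * ?R - 1 \<in> ?J \<mu> \<and> ?R * S - 1 \<in> ?J (\<mu> + 1) \<and>
    (\<forall>p\<in>{1..CARD('n) - 1}. \<forall>q\<in>{2..CARD('n)}. W.A_gen p q * ?R \<in> ?J \<mu> \<and> W.A_gen p q * S \<in> ?J (\<mu> + 1)) \<and>
    (\<forall>m\<in>{2..CARD('n)}. W.T_gen (\<mu> + 1) m * ?R \<in> ?J \<mu> \<and> W.T_gen \<mu> m * S \<in> ?J (\<mu> + 1)) \<and>
    (W.U0 - konst l) * ?R \<in> ?J \<mu> \<and> (W.U0 - konst l) * S \<in> ?J (\<mu> + 1)"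
    by (rule W.inverse_exists[OF ne])
       (use gens gens' gens'' in \<open>auto simp: c_def left_ideal_set_J_sheaf\<close>)
  then obtain S where SR: "S * ?R - 1 \<in> ?J \<mu>" and RS: "?R * S - 1 \<in> ?J (\<mu> + 1)"
    and A: "\<And>p q. p \<in> {1..CARD('n) - 1} \<Longrightarrow> q \<in> {2..CARD('n)} \<Longrightarrow>
        W.A_gen p q * ?R \<in> ?J \<mu> \<and> W.A_gen p q * S \<in> ?J (\<mu> + 1)"
    and T: "\<And>m. m \<in> {2..CARD('n)} \<Longrightarrow> W.T_gen (\<mu> + 1) m * ?R \<in> ?J \<mu> \<and> W.T_gen \<mu> m * S \<in> ?J (\<mu> + 1)"
    and H: "(W.U0 - konst l) * ?R \<in> ?J \<mu>" "(W.U0 - konst l) * S \<in> ?J (\<mu> + 1)"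
    by blast
  have "right_multiplication (J_sheaf \<iota> (\<mu> + 1) l) (J_sheaf \<iota> \<mu> l) (Rep_dop ?R)"
    using A T H by (intro right_multiplication_J_sheaf)
      (auto simp: I_gens_def Rep_dop_A[symmetric] Rep_dop_T[symmetric] Rep_dop_H[symmetric] Rep_dop_mult[symmetric])
  moreover have "right_multiplication (J_sheaf \<iota> \<mu> l) (J_sheaf \<iota> (\<mu> + 1) l) (Rep_dop S)"
    using A T H by (intro right_multiplication_J_sheaf)
      (auto simp: I_gens_def Rep_dop_A[symmetric] Rep_dop_T[symmetric] Rep_dop_H[symmetric] Rep_dop_mult[symmetric])
  moreover have "Rep_dop ?R \<otimes>\<^bsub>DN\<^esub> Rep_dop S \<ominus>\<^bsub>DN\<^esub> \<one>\<^bsub>DN\<^esub> \<in> J_sheaf \<iota> (\<mu> + 1) l UNIV"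
    "Rep_dop S \<otimes>\<^bsub>DN\<^esub> Rep_dop ?R \<ominus>\<^bsub>DN\<^esub> \<one>\<^bsub>DN\<^esub> \<in> J_sheaf \<iota> \<mu> l UNIV"
    using SR RS by (simp_all add: Rep_dop_mult Rep_dop_diff Rep_dop_1)
  ultimately have "dmod_iso (quot_module (J_sheaf \<iota> (\<mu> + 1) l)) (quot_module (J_sheaf \<iota> \<mu> l))
      (right_mult_map (J_sheaf \<iota> \<mu> l) (Rep_dop ?R))"
    by (rule dmod_iso_right_mult)
  then show ?thesis
    by (simp add: N_module_def square_map_def Rep_dop_add Rep_dop_E)
qed

end

theorem theorem4p2p1:
  fixes \<iota> :: "nat \<Rightarrow> 'n::finite" and \<mu> l :: complex
  assumes "CARD('n) \<ge> 2"
    and "bij_betw \<iota> {1..CARD('n)} UNIV"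
    and "\<mu> \<noteq> 0"
    and "l \<notin> \<nat>"
    and "l + of_nat CARD('n) * \<mu> \<notin> {- of_nat j | j. j \<in> {0..CARD('n) - 1}}"
  shows "dmod_iso (N_module \<iota> (\<mu> + 1) l) (N_module \<iota> \<mu> l) (square_map \<iota> \<mu> l)"
proof (rule dmod_iso_square_map[OF assms(1,2)])
  fix j assume "j < CARD('n)"
  then show "l + of_nat CARD('n) * \<mu> \<noteq> - of_nat j"
    using assms(5) by auto
qed

end
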